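(* Let $\mathbb F$ be a nonabelian free group of finite rank and let $g$ be a positive integer. If $N(H_g,P_g)$ is a solid bound for $(H_g,P_g)$ (defined in the context), then $$N(H_g,P_g)\ \ge\ \hat f_{\mathbb F}(g)\ \ge\ \hat f'_{\mathbb F}(g)\ \ge\ 2^g.$$
   Context: Commutators are $[a,b]=aba^{-1}b^{-1}$ and $i_z$ denotes conjugation by $z$. For $g\ge0$ let $H_g=\langle a_1,b_1,\dots,a_g,b_g\rangle$ be the free group of rank $2g$ on the indicated basis (trivial if $g=0$), $\partial_g=[a_1,b_1]\cdots[a_g,b_g]\in H_g$, and $P_g=\langle\partial_g\rangle$. For $x\in\mathbb F$, a genus $g$ representation of $x$ is a homomorphism $h:H_g\to\mathbb F$ with $h(\partial_g)=x$; equivalently, an extension to $H_g$ of the homomorphism $P_g\to\mathbb F$, $\partial_g\mapsto x$. Fractional Dehn twists. Two genus $g$ representations $h,h'$ of $x$ are related by a fractional Dehn twist if one of the following holds. (i) $H_g=A*_CB$ with $C$ cyclic and $\partial_g\in A$, and there is $z\in\mathbb F$ centralizing $h(C)$ such that $h'|_A=h|_A$ and $h'|_B=i_z\circ(h|_B)$. (ii) $H_g=\langle A,t\mid t^{-1}ct=\phi(c),\ c\in C\rangle$ is an HNN extension, where $\phi:C\to C'$ is an isomorphism between cyclic subgroups of $A$, $\partial_g\in A$, and there is $z\in\mathbb F$ centralizing $h(C)$ such that $h'|_A=h|_A$ and $h'(t)=z\,h(t)$. The equivalence relation $\sim$ on genus $g$ representations of $x$ is the one generated by being related by a fractional Dehn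 twist. A genus $g$ representation $h$ of $x$ is $\sim$-injective if every genus $g$ representation of $x$ equivalent to $h$ (including $h$) is injective. For $x\in[\mathbb F,\mathbb F]$, the algebraic genus $\mathrm{a\text{-}genus}(x)$ is the smallest $g\ge0$ such that $x$ has a genus $g$ representation. A genus $g$ representation of $x$ is minimal if $g=\mathrm{a\text{-}genus}(x)$. A subgroup $S\le G$ is primitive if $t\in G$, $n\ge1$, $t^n\in S$ imply $t\in S$. A representation $h$ is admissible if $h$ is injective with primitive image in $\mathbb F$. Let $\mathrm{num}(x)$ be the number of $\sim$-equivalence classes of minimal $\sim$-injective representations of $x$, and let $\mathrm{num}'(x)$ be the number of distinct subgroups of $\mathbb F$ that are images of minimal admissible representations of $x$. Set $\hat f_{\mathbb F}(g)=\sup\{\mathrm{num}(x)\mid x\in[\mathbb F,\mathbb F],\ \mathrm{a\text{-}genus}(x)=g\}$ and $\hat f'_{\mathbb F}(g)=\sup\{\mathrm{num}'(x)\mid x\in[\mathbb F,\mathbb F],\ \mathrm{a\text{-}genus}(x)=g\}$. Solid bound. A number $N(H_g,P_g)$ is a solid bound for $(H_g,P_g)$ if there is a finite set $\mathcal F=\{q_i:H_g\to L_i\}$ of proper quotients of $H_g$ (surjective, non-injective homomorphisms) such that every homomorphism $P_g\to\mathbb F$ has at most $N(H_g,P_g)$ $\sim$-equivalence classes of extensions $h:H_g\to\mathbb F$ with the property that no element of the equivalence class of $h$ factors through an element of $\mathcal F$. (That such a number exists is a theorem of Sela.) *)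

theory Defs
  imports "HOL-Algebra.Generated_Groups" "HOL-Library.Extended_Nat"
begin

section \<open>Free groups\<close>

text \<open>
  The free group on a set \<open>X\<close> consists of the reduced words over \<open>X\<close> and its formal inverses:
  \<open>(x, True)\<close> is the letter \<open>x\<close> and \<open>(x, False)\<close> its inverse.
\<close>

type_synonym 'x word = "('x \<times> bool) list"

definition reduced :: "'x word \<Rightarrow> bool" where
  "reduced = successively (\<lambda>l m. \<not> (fst l = fst m \<and> snd l \<noteq> snd m))"

fun red_cons :: "'x \<times> bool \<Rightarrow> 'x word \<Rightarrow> 'x word" where
  "red_cons l [] = [l]"
| "red_cons l (m # w) = (if fst l = fst m \<and> snd l \<noteq> snd m then w else l # m # w)"

definition free_group :: "'x set \<Rightarrow> 'x word monoid" where
  "free_group X = \<lparr>carrier = {w. reduced w \<and> fst ` set w \<subseteq> X},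
                   monoid.mult = (\<lambda>u v. foldr red_cons u v),
                   one = []\<rparr>"

definition letter :: "'x \<Rightarrow> 'x word" where
  "letter x = [(x, True)]"

fun word_eval :: "('g, 'm) monoid_scheme \<Rightarrow> ('x \<Rightarrow> 'g) \<Rightarrow> 'x word \<Rightarrow> 'g" where
  "word_eval G e [] = \<one>\<^bsub>G\<^esub>"
| "word_eval G e (l # w) =
     (if snd l then e (fst l) else inv\<^bsub>G\<^esub> (e (fst l))) \<otimes>\<^bsub>G\<^esub> word_eval G e w"

definition free_basis :: "('g, 'm) monoid_scheme \<Rightarrow> 'g set \<Rightarrow> bool" where
  "free_basis G S \<longleftrightarrow> S \<subseteq> carrier G \<and> word_eval G (\<lambda>s. s) \<in> iso (free_group S) G"

definition free_of_finite_rank :: "('g, 'm) monoid_scheme \<Rightarrow> bool" where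
  "free_of_finite_rank G \<longleftrightarrow> group G \<and> (\<exists>S. finite S \<and> free_basis G S)"

lemma free_group_simps [simp]:
  "w \<in> carrier (free_group X) \<longleftrightarrow> reduced w \<and> fst ` set w \<subseteq> X"
  "u \<otimes>\<^bsub>free_group X\<^esub> v = foldr red_cons u v"
  "\<one>\<^bsub>free_group X\<^esub> = []"
  by (simp_all add: free_group_def)

lemma reduced_red_cons: "reduced w \<Longrightarrow> reduced (red_cons l w)"
  by (cases w) (auto simp: reduced_def successively_Cons)

lemma set_red_cons: "set (red_cons l w) \<subseteq> insert l (set w)"
  by (cases w) auto

lemma red_cons_cancel:
  "reduced w \<Longrightarrow> fst l = fst m \<Longrightarrow> snd l \<noteq> snd m \<Longrightarrow> red_cons l (red_cons m w) = w"
  by (cases w; cases "tl w") (auto simp: reduced_def successively_Cons prod_eq_iff)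

lemma reduced_foldr: "reduced v \<Longrightarrow> reduced (foldr red_cons u v)"
  by (induction u) (auto intro: reduced_red_cons)

lemma set_foldr: "set (foldr red_cons u v) \<subseteq> set u \<union> set v"
  by (induction u) (use set_red_cons in fastforce)+

lemma letters_foldr:
  "fst ` set u \<subseteq> X \<Longrightarrow> fst ` set v \<subseteq> X \<Longrightarrow> fst ` set (foldr red_cons u v) \<subseteq> X"
  by (rule order_trans[OF image_mono[OF set_foldr]]) (simp add: image_Un)

lemma foldr_red_cons:
  assumes "reduced v"
  shows "foldr red_cons (red_cons l u) v = red_cons l (foldr red_cons u v)"
  using red_cons_cancel[OF reduced_foldr[OF assms]] by (cases u) auto

lemma foldr_assoc:
  assumes "reduced w"
  shows "foldr red_cons (foldr red_cons u v) w = foldr red_cons u (foldr red_cons v w)"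
  by (induction u) (auto simp: foldr_red_cons[OF assms])

lemma foldr_reduced_Nil: "reduced w \<Longrightarrow> foldr red_cons w [] = w"
proof (induction w)
  case (Cons l w)
  then have "foldr red_cons w [] = w" by (auto simp: reduced_def successively_Cons)
  with Cons.prems show ?case by (cases w) (auto simp: reduced_def)
qed simp

definition flip :: "'x \<times> bool \<Rightarrow> 'x \<times> bool" where
  "flip l = (fst l, \<not> snd l)"

lemma foldr_inverse: "reduced v \<Longrightarrow> foldr red_cons (rev (map flip w)) (foldr red_cons w v) = v"
  by (induction w arbitrary: v) (auto simp: red_cons_cancel reduced_foldr flip_def)

lemma group_free_group: "group (free_group X)"
proof (rule groupI)
  fix u v assume "u \<in> carrier (free_group X)" "v \<in> carrier (free_group X)"
  then show "u \<otimes>\<^bsub>free_group X\<^esub> v \<in> carrier (free_group X)"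
    by (simp add: reduced_foldr letters_foldr)
next
  fix w assume w: "w \<in> carrier (free_group X)"
  let ?v = "foldr red_cons (rev (map flip w)) []"
  have r: "reduced []" by (simp add: reduced_def)
  have "fst ` set ?v \<subseteq> X"
    using w by (intro letters_foldr) (auto simp: flip_def)
  moreover have "foldr red_cons ?v w = []"
    using w foldr_assoc[of w "rev (map flip w)" "[]"] foldr_inverse[OF r, of w]
    by (simp add: foldr_reduced_Nil)
  ultimately show "\<exists>y\<in>carrier (free_group X). y \<otimes>\<^bsub>free_group X\<^esub> w = \<one>\<^bsub>free_group X\<^esub>"
    using reduced_foldr[OF r] by (intro bexI[of _ ?v]) auto
qed (auto simp: foldr_assoc, simp add: reduced_def)

lemma word_eval_closed:
  assumes "group G" "e \<in> X \<rightarrow> carrier G" "fst ` set w \<subseteq> X"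
  shows "word_eval G e w \<in> carrier G"
proof -
  interpret group G by fact
  show ?thesis using assms(2,3) by (induction w) (auto simp: Pi_iff)
qed

lemma word_eval_red_cons:
  assumes "group G" "e \<in> X \<rightarrow> carrier G" "fst l \<in> X" "fst ` set w \<subseteq> X"
  shows "word_eval G e (red_cons l w) = word_eval G e (l # w)"
proof (cases w)
  case (Cons m v)
  interpret group G by fact
  have "word_eval G e v \<in> carrier G" "e (fst m) \<in> carrier G"
    using assms Cons by (auto simp: Pi_iff intro!: word_eval_closed[OF assms(1,2)])
  then show ?thesis
    using Cons by (auto simp: inv_solve_left m_assoc[symmetric])
qed simp

lemma word_eval_hom:
  assumes "group G" "e \<in> X \<rightarrow> carrier G"
  shows "word_eval G e \<in> hom (free_group X) G"
proof (rule homI)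
  interpret group G by fact
  fix u v assume "u \<in> carrier (free_group X)" "v \<in> carrier (free_group X)"
  then have "fst ` set u \<subseteq> X" "fst ` set v \<subseteq> X" by auto
  then have "word_eval G e (foldr red_cons u v) = word_eval G e u \<otimes>\<^bsub>G\<^esub> word_eval G e v"
  proof (induction u)
    case Nil
    then show ?case using word_eval_closed[OF assms] by simp
  next
    case (Cons l u)
    have "fst ` set (foldr red_cons u v) \<subseteq> X"
      using Cons.prems by (intro letters_foldr) auto
    moreover have "e (fst l) \<in> carrier G" using Cons.prems assms(2) by auto
    ultimately show ?case
      using Cons word_eval_closed[OF assms, of u] word_eval_closed[OF assms, of v]
        word_eval_red_cons[OF assms, of l "foldr red_cons u v"]
      by (simp add: m_assoc)
  qed
  then show "word_eval G e (u \<otimes>\<^bsub>free_group X\<^esub> v) = word_eval G e u \<otimes>\<^bsub>G\<^esub> word_eval G e v"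
    by simp
qed (use word_eval_closed[OF assms] in auto)


section \<open>Presentations and splittings\<close>

definition normal_closure :: "('g, 'm) monoid_scheme \<Rightarrow> 'g set \<Rightarrow> 'g set" where
  "normal_closure G R = \<Inter>{N. N \<lhd> G \<and> R \<subseteq> N}"

text \<open>\<open>G\<close> is presented by generators \<open>X\<close> (realised in \<open>G\<close> through \<open>e\<close>) and relators \<open>R\<close>.\<close>

definition presented_by ::
  "('g, 'm) monoid_scheme \<Rightarrow> 'x set \<Rightarrow> 'x word set \<Rightarrow> ('x \<Rightarrow> 'g) \<Rightarrow> bool" where
  "presented_by G X R e \<longleftrightarrow>
     e \<in> X \<rightarrow> carrier G \<and> R \<subseteq> carrier (free_group X) \<and>
     word_eval G e \<in> epi (free_group X) G \<and>
     kernel (free_group X) G (word_eval G e) = normal_closure (free_group X) R"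

text \<open>The relators \<open>a \<cdot> b \<cdot> (a b)\<inverse>\<close> of the multiplication table of the subgroup \<open>A\<close>.\<close>

definition table_relators ::
  "('g, 'm) monoid_scheme \<Rightarrow> 'x set \<Rightarrow> ('g \<Rightarrow> 'x) \<Rightarrow> 'g set \<Rightarrow> 'x word set" where
  "table_relators G X \<iota> A =
     {letter (\<iota> a) \<otimes>\<^bsub>free_group X\<^esub> letter (\<iota> b)
        \<otimes>\<^bsub>free_group X\<^esub> inv\<^bsub>free_group X\<^esub> letter (\<iota> (a \<otimes>\<^bsub>G\<^esub> b)) | a b. a \<in> A \<and> b \<in> A}"

text \<open>
  \<open>G = A *\<^sub>C B\<close> for subgroups \<open>A\<close>, \<open>B\<close>, \<open>C \<le> A \<inter> B\<close> of \<open>G\<close>: the canonical map onto \<open>G\<close> from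
  the free product of \<open>A\<close> and \<open>B\<close> with the two copies of \<open>C\<close> identified is an isomorphism.
\<close>

definition amalgam_splitting ::
  "('g, 'm) monoid_scheme \<Rightarrow> 'g set \<Rightarrow> 'g set \<Rightarrow> 'g set \<Rightarrow> bool" where
  "amalgam_splitting G A B C \<longleftrightarrow>
     subgroup A G \<and> subgroup B G \<and> subgroup C G \<and> C \<subseteq> A \<and> C \<subseteq> B \<and>
     (let X = A <+> B in
      presented_by G X
        (table_relators G X Inl A \<union> table_relators G X Inr B \<union>
         {letter (Inl c) \<otimes>\<^bsub>free_group X\<^esub> inv\<^bsub>free_group X\<^esub> letter (Inr c) | c. c \<in> C})
        (case_sum (\<lambda>a. a) (\<lambda>b. b)))"

text \<open>
  \<open>G = \<langle>A, t | t\<inverse> c t = \<phi>(c), c \<in> C\<rangle>\<close> for subgroups \<open>A\<close> and \<open>C, C' \<le> A\<close> of \<open>G\<close> and \<open>t \<in> G\<close>.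
  In the presentation \<open>None\<close> is the generator for \<open>t\<close> and \<open>Some a\<close> the one for \<open>a \<in> A\<close>.
\<close>

definition hnn_splitting ::
  "('g, 'm) monoid_scheme \<Rightarrow> 'g set \<Rightarrow> 'g set \<Rightarrow> 'g set \<Rightarrow> ('g \<Rightarrow> 'g) \<Rightarrow> 'g \<Rightarrow> bool" where
  "hnn_splitting G A C C' \<phi> t \<longleftrightarrow>
     subgroup A G \<and> subgroup C G \<and> subgroup C' G \<and> C \<subseteq> A \<and> C' \<subseteq> A \<and> t \<in> carrier G \<and>
     \<phi> \<in> iso (G\<lparr>carrier := C\<rparr>) (G\<lparr>carrier := C'\<rparr>) \<and>
     (let X = insert None (Some ` A) in
      presented_by G X
        (table_relators G X Some A \<union>
         {inv\<^bsub>free_group X\<^esub> letter None \<otimes>\<^bsub>free_group X\<^esub> letter (Some c)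
            \<otimes>\<^bsub>free_group X\<^esub> letter None
            \<otimes>\<^bsub>free_group X\<^esub> inv\<^bsub>free_group X\<^esub> letter (Some (\<phi> c)) | c. c \<in> C})
        (case_option t (\<lambda>a. a)))"

definition cyclic_subgroup :: "'g set \<Rightarrow> ('g, 'm) monoid_scheme \<Rightarrow> bool" where
  "cyclic_subgroup C G \<longleftrightarrow> (\<exists>c\<in>carrier G. C = generate G {c})"

definition primitive_subgroup :: "'g set \<Rightarrow> ('g, 'm) monoid_scheme \<Rightarrow> bool" where
  "primitive_subgroup S G \<longleftrightarrow>
     subgroup S G \<and> (\<forall>t\<in>carrier G. \<forall>n::nat. n \<ge> 1 \<longrightarrow> t [^]\<^bsub>G\<^esub> n \<in> S \<longrightarrow> t \<in> S)"


section \<open>Genus \<open>g\<close> representations\<close>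

datatype surface_gen = GenA nat | GenB nat

type_synonym surface_word = "surface_gen word"

definition surf_group :: "nat \<Rightarrow> surface_word monoid" where
  "surf_group g = free_group (GenA ` {1..g} \<union> GenB ` {1..g})"

definition commutator :: "('g, 'm) monoid_scheme \<Rightarrow> 'g \<Rightarrow> 'g \<Rightarrow> 'g" where
  "commutator G a b = a \<otimes>\<^bsub>G\<^esub> b \<otimes>\<^bsub>G\<^esub> inv\<^bsub>G\<^esub> a \<otimes>\<^bsub>G\<^esub> inv\<^bsub>G\<^esub> b"

definition boundary :: "nat \<Rightarrow> surface_word" where
  "boundary g = foldr (\<lambda>i w. commutator (surf_group g) (letter (GenA i)) (letter (GenB i)) \<otimes>\<^bsub>surf_group g\<^esub> w)
                      [1..<g + 1] \<one>\<^bsub>surf_group g\<^esub>"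

definition boundary_group :: "nat \<Rightarrow> surface_word set" where
  "boundary_group g = generate (surf_group g) {boundary g}"

text \<open>
  Homomorphisms out of \<open>surf_group g\<close> are taken to be extensional (\<open>undefined\<close> off the carrier), so that
  two of them are equal, and are counted once, iff they agree on \<open>surf_group g\<close>.
\<close>

definition genus_reps :: "('a, 'b) monoid_scheme \<Rightarrow> nat \<Rightarrow> 'a \<Rightarrow> (surface_word \<Rightarrow> 'a) set" where
  "genus_reps F g x = {h \<in> hom (surf_group g) F \<inter> extensional (carrier (surf_group g)). h (boundary g) = x}"

definition frac_twist ::
  "('a, 'b) monoid_scheme \<Rightarrow> nat \<Rightarrow> (surface_word \<Rightarrow> 'a) \<Rightarrow> (surface_word \<Rightarrow> 'a) \<Rightarrow> bool" where
  "frac_twist F g h h' \<longleftrightarrow>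
     (\<exists>A B C z. amalgam_splitting (surf_group g) A B C \<and> cyclic_subgroup C (surf_group g) \<and> boundary g \<in> A \<and>
        z \<in> carrier F \<and> (\<forall>c\<in>C. z \<otimes>\<^bsub>F\<^esub> h c = h c \<otimes>\<^bsub>F\<^esub> z) \<and>
        (\<forall>a\<in>A. h' a = h a) \<and> (\<forall>b\<in>B. h' b = z \<otimes>\<^bsub>F\<^esub> h b \<otimes>\<^bsub>F\<^esub> inv\<^bsub>F\<^esub> z)) \<or>
     (\<exists>A C C' \<phi> t z. hnn_splitting (surf_group g) A C C' \<phi> t \<and>
        cyclic_subgroup C (surf_group g) \<and> cyclic_subgroup C' (surf_group g) \<and> boundary g \<in> A \<and>
        z \<in> carrier F \<and> (\<forall>c\<in>C. z \<otimes>\<^bsub>F\<^esub> h c = h c \<otimes>\<^bsub>F\<^esub> z) \<and>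
        (\<forall>a\<in>A. h' a = h a) \<and> h' t = z \<otimes>\<^bsub>F\<^esub> h t)"

definition twist_equiv ::
  "('a, 'b) monoid_scheme \<Rightarrow> nat \<Rightarrow> 'a \<Rightarrow> ((surface_word \<Rightarrow> 'a) \<times> (surface_word \<Rightarrow> 'a)) set" where
  "twist_equiv F g x =
     {(h, h'). h \<in> genus_reps F g x \<and> h' \<in> genus_reps F g x \<and>
        equivclp (\<lambda>k k'. k \<in> genus_reps F g x \<and> k' \<in> genus_reps F g x \<and> frac_twist F g k k') h h'}"

lemma equiv_twist_equiv: "equiv (genus_reps F g x) (twist_equiv F g x)"
proof (rule equivI)
  show "refl_on (genus_reps F g x) (twist_equiv F g x)"
    by (auto simp: refl_on_def twist_equiv_def)
  show "sym (twist_equiv F g x)"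
    by (auto simp: sym_def twist_equiv_def intro: equivclp_sym)
  show "trans (twist_equiv F g x)"
    by (auto simp: trans_def twist_equiv_def intro: equivclp_trans)
qed (auto simp: twist_equiv_def)

definition twist_injective :: "('a, 'b) monoid_scheme \<Rightarrow> nat \<Rightarrow> 'a \<Rightarrow> (surface_word \<Rightarrow> 'a) \<Rightarrow> bool" where
  "twist_injective F g x h \<longleftrightarrow> (\<forall>h'. (h, h') \<in> twist_equiv F g x \<longrightarrow> inj_on h' (carrier (surf_group g)))"

definition admissible :: "('a, 'b) monoid_scheme \<Rightarrow> nat \<Rightarrow> (surface_word \<Rightarrow> 'a) \<Rightarrow> bool" where
  "admissible F g h \<longleftrightarrow> inj_on h (carrier (surf_group g)) \<and> primitive_subgroup (h ` carrier (surf_group g)) F"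

definition a_genus :: "('a, 'b) monoid_scheme \<Rightarrow> 'a \<Rightarrow> nat" where
  "a_genus F x = (LEAST g. genus_reps F g x \<noteq> {})"

definition ecard :: "'c set \<Rightarrow> enat" where
  "ecard S = (if finite S then enat (card S) else \<infinity>)"

definition rep_num :: "('a, 'b) monoid_scheme \<Rightarrow> 'a \<Rightarrow> enat" where
  "rep_num F x = (let g = a_genus F x in
     ecard {twist_equiv F g x `` {h} | h. h \<in> genus_reps F g x \<and> twist_injective F g x h})"

definition rep_num' :: "('a, 'b) monoid_scheme \<Rightarrow> 'a \<Rightarrow> enat" where
  "rep_num' F x = (let g = a_genus F x in
     ecard {h ` carrier (surf_group g) | h. h \<in> genus_reps F g x \<and> admissible F g h})"

definition fhat :: "('a, 'b) monoid_scheme \<Rightarrow> nat \<Rightarrow> enat" where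
  "fhat F g = Sup {rep_num F x | x. x \<in> derived F (carrier F) \<and> a_genus F x = g}"

definition fhat' :: "('a, 'b) monoid_scheme \<Rightarrow> nat \<Rightarrow> enat" where
  "fhat' F g = Sup {rep_num' F x | x. x \<in> derived F (carrier F) \<and> a_genus F x = g}"


section \<open>Solid bounds\<close>

definition extensions ::
  "('a, 'b) monoid_scheme \<Rightarrow> nat \<Rightarrow> (surface_word \<Rightarrow> 'a) \<Rightarrow> (surface_word \<Rightarrow> 'a) set" where
  "extensions F g f =
     {h \<in> hom (surf_group g) F \<inter> extensional (carrier (surf_group g)).
        \<forall>p\<in>boundary_group g. h p = f p}"

lemma group_surf_group: "group (surf_group g)"
  by (simp add: surf_group_def group_free_group)

lemma letter_in_surf_group:
  "i \<in> {1..g} \<Longrightarrow>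
     letter (GenA i) \<in> carrier (surf_group g) \<and> letter (GenB i) \<in> carrier (surf_group g)"
  by (auto simp: surf_group_def letter_def reduced_def)

lemma boundary_in_surf_group: "boundary g \<in> carrier (surf_group g)"
proof -
  interpret group "surf_group g" by (rule group_surf_group)
  let ?f = "\<lambda>i w. commutator (surf_group g) (letter (GenA i)) (letter (GenB i)) \<otimes>\<^bsub>surf_group g\<^esub> w"
  have *: "foldr ?f ks \<one>\<^bsub>surf_group g\<^esub> \<in> carrier (surf_group g)" if "set ks \<subseteq> {1..g}" for ks
    using that by (induction ks) (auto simp: commutator_def letter_in_surf_group)
  show ?thesis
    unfolding boundary_def by (rule *) (simp add: atLeastLessThanSuc_atLeastAtMost del: upt_Suc)
qed

lemma extensions_eq_genus_reps:
  assumes "group F" "f \<in> hom (surf_group g\<lparr>carrier := boundary_group g\<rparr>) F"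
  shows "extensions F g f = genus_reps F g (f (boundary g))"
proof -
  interpret G: group "surf_group g" by (rule group_surf_group)
  have sub: "subgroup (boundary_group g) (surf_group g)"
    unfolding boundary_group_def by (rule G.generate_is_subgroup) (simp add: boundary_in_surf_group)
  have bd: "boundary g \<in> boundary_group g"
    unfolding boundary_group_def by (rule generate.incl) simp
  interpret f: group_hom "surf_group g\<lparr>carrier := boundary_group g\<rparr>" F f
    using assms G.subgroup_imp_group[OF sub] by (simp add: group_hom_def group_hom_axioms_def)
  have "h p = f p" if h: "h \<in> hom (surf_group g) F" "h (boundary g) = f (boundary g)" and p: "p \<in> boundary_group g" for h p
  proof -
    interpret h: group_hom "surf_group g" F h
      using h assms G.is_group by (simp add: group_hom_def group_hom_axioms_def)
    from p[unfolded boundary_group_def] show ?thesis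
    proof (induction rule: generate.induct)
      case one
      show ?case using f.hom_one by simp
    next
      case (incl p)
      then show ?case using h by simp
    next
      case (inv p)
      then show ?case
        using h f.hom_inv[of p] bd boundary_in_surf_group G.m_inv_consistent[OF sub] by simp
    next
      case (eng p q)
      then have "p \<in> boundary_group g" "q \<in> boundary_group g" by (auto simp: boundary_group_def)
      moreover from this have "p \<in> carrier (surf_group g)" "q \<in> carrier (surf_group g)"
        using subgroup.subset[OF sub] by auto
      ultimately have "h (p \<otimes>\<^bsub>surf_group g\<^esub> q) = h p \<otimes>\<^bsub>F\<^esub> h q"
        "f (p \<otimes>\<^bsub>surf_group g\<^esub> q) = f p \<otimes>\<^bsub>F\<^esub> f q"
        using f.hom_mult[of p q] h.hom_mult[of p q] by simp_all
      then show ?case by (simp only: eng.IH)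
    qed
  qed
  with bd show ?thesis by (auto simp: extensions_def genus_reps_def)
qed

definition factors_through ::
  "('a, 'b) monoid_scheme \<Rightarrow> nat \<Rightarrow> (surface_word \<Rightarrow> 'a) \<Rightarrow>
     'l monoid \<times> (surface_word \<Rightarrow> 'l) \<Rightarrow> bool" where
  "factors_through F g h Lq \<longleftrightarrow>
     (\<exists>k\<in>hom (fst Lq) F. \<forall>w\<in>carrier (surf_group g). h w = k (snd Lq w))"

text \<open>
  The targets of the quotient maps are groups carried by sets of words. This loses no generality:
  every quotient of \<open>surf_group g\<close> is isomorphic to some \<open>surf_group g Mod K\<close>, whose elements are cosets, and
  whether a homomorphism factors through a quotient map depends only on the kernel of the latter.
\<close>

definition proper_quotient ::
  "nat \<Rightarrow> surface_word set monoid \<times> (surface_word \<Rightarrow> surface_word set) \<Rightarrow> bool" where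
  "proper_quotient g Lq \<longleftrightarrow>
     group (fst Lq) \<and> snd Lq \<in> epi (surf_group g) (fst Lq) \<and> \<not> inj_on (snd Lq) (carrier (surf_group g))"

definition solid_bound :: "('a, 'b) monoid_scheme \<Rightarrow> nat \<Rightarrow> nat \<Rightarrow> bool" where
  "solid_bound F g N \<longleftrightarrow>
     (\<exists>Q. finite Q \<and> (\<forall>Lq\<in>Q. proper_quotient g Lq) \<and>
        (\<forall>f\<in>hom (surf_group g\<lparr>carrier := boundary_group g\<rparr>) F.
           ecard {twist_equiv F g (f (boundary g)) `` {h} | h.
                    h \<in> extensions F g f \<and>
                    (\<forall>h'\<in>twist_equiv F g (f (boundary g)) `` {h}.
                       \<forall>Lq\<in>Q. \<not> factors_through F g h' Lq)} \<le> enat N))"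

end

theory Submission
  imports Defs
begin

text \<open>
  Upper bounds. Injective representations do not factor through proper quotients, so
  \<open>\<sim>\<close>-injective classes are counted by a solid bound. If \<open>h\<close> is admissible and \<open>z\<close> centralizes
  \<open>h(C) \<noteq> 1\<close>, then a power of \<open>z\<close> lies in \<open>h(C)\<close>, so \<open>z = h(\<zeta>)\<close> by primitivity, and the twist of \<open>h\<close>
  by \<open>z\<close> is \<open>h\<close> composed with the twist of \<open>H\<^sub>g\<close> by \<open>\<zeta>\<close>. The latter fixes \<open>\<zeta>\<close>, since roots in free groups
  are unique, and so it is an automorphism. If \<open>C = 1\<close>, then killing \<open>B\<close> (or \<open>t\<close>) is an idempotent
  endomorphism that fixes \<open>\<partial>\<^sub>g\<close>; it preserves the symplectic form on the abelianization, is the identity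
  there, and is injective by the Magnus expansion. So the splitting is trivial. Hence twists
  preserve the image and the injectivity of admissible representations.

  Lower bound. In the free group on \<open>p, q\<close> there is a commutator that is the boundary word of two
  distinct primitive subgroups of rank 2. The free product of \<open>g\<close> copies contains a product of
  \<open>g\<close> such commutators, which bounds \<open>2\<^sup>g\<close> distinct primitive subgroups, and has genus \<open>g\<close> because of
  the rank of the symplectic form. This free product is embedded in the free group on \<open>a, b\<close> as a retract
  of the normal closure of \<open>b\<close>, so primitivity is preserved. Its generators contain many
  independent marker syllables \<open>a\<^sup>n\<close>; reading off the syllables of one kind is multiplicative up
  to boundedly many errors, each of which concerns only one kind, so some kind recovers
  the original product from any expression of its image as few commutators, and the genus is preserved, too.
\<close>


section \<open>Reduced words\<close>

text \<open>The ambient group may have rank 2 while H_g has rank 2g, so the example must be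
  embedded, and the two properties to be preserved call for different tools. The retraction that
  transports primitivity is multiplicative only on words of exponent sum 0 in \<open>a\<close>.
  Roots of elements of the image stay there, but a representation of small genus may send generators
  anywhere, so the retraction cannot pull it back. Syllable maps are defined everywhere and fail
  only where words meet. The number of failures is bounded by the lengths of the two words being
  evaluated, whatever elements are substituted into them, so the number of markers can be fixed
  before the hypothetical representation is known. Heights separate the two tools inside a marker:
  only its first conjugate of \<open>b\<close> lies at a height at most 0, and the retraction sees
  nothing else. In the Magnus expansion, degree one is the abelianization and degree two carries the
  symplectic form, while the lowest degree in which two series differ decides injectivity and
  uniqueness of roots.\<close>

definition winv :: "'x word \<Rightarrow> 'x word" where
  "winv w = rev (map flip w)"

lemma flip_flip [simp]: "flip (flip l) = l"
  by (simp add: flip_def)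

lemma fst_flip [simp]: "fst (flip l) = fst l"
  by (simp add: flip_def)

lemma flip_ne [simp]: "flip l \<noteq> l" "l \<noteq> flip l"
  by (simp_all add: flip_def prod_eq_iff)

lemma flip_eq_iff: "flip l = m \<longleftrightarrow> l = flip m"
  by auto

lemma cancel_iff: "fst l = fst m \<and> snd l \<noteq> snd m \<longleftrightarrow> m = flip l"
  by (auto simp: flip_def prod_eq_iff)

lemma winv_simps [simp]:
  "winv [] = []" "winv (l # w) = winv w @ [flip l]" "winv (u @ v) = winv v @ winv u"
  "winv (winv w) = w" "length (winv w) = length w" "fst ` set (winv w) = fst ` set w"
  by (auto simp: winv_def rev_map image_image o_def)

lemma winv_eq_Nil [simp]: "winv w = [] \<longleftrightarrow> w = []"
  by (simp add: winv_def)

lemma last_winv: "w \<noteq> [] \<Longrightarrow> last (winv w) = flip (hd w)"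
  by (simp add: winv_def last_rev hd_map)

lemma reduced_Nil [simp]: "reduced []"
  by (simp add: reduced_def)

lemma reduced_alt: "reduced = successively (\<lambda>l m. m \<noteq> flip l)"
  unfolding reduced_def cancel_iff ..

lemma reduced_Cons: "reduced (l # w) \<longleftrightarrow> reduced w \<and> (w = [] \<or> hd w \<noteq> flip l)"
  unfolding reduced_alt by (cases w) auto

lemma reduced_append:
  "reduced (u @ v) \<longleftrightarrow> reduced u \<and> reduced v \<and> (u = [] \<or> v = [] \<or> hd v \<noteq> flip (last u))"
  unfolding reduced_alt by (auto simp: successively_append_iff)

lemma reduced_winv [simp]: "reduced (winv w) = reduced w"
proof (induction w)
  case (Cons l w)
  then show ?case
    by (cases "w = []") (auto simp: reduced_append reduced_Cons last_winv flip_eq_iff)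
qed simp

lemma red_cons_Cons: "red_cons l (m # w) = (if m = flip l then w else l # m # w)"
  by (simp only: red_cons.simps cancel_iff)

lemma red_cons_reduced: "reduced (l # w) \<Longrightarrow> red_cons l w = l # w"
  by (cases w) (auto simp: reduced_Cons red_cons_Cons simp del: red_cons.simps(2))

lemma foldr_red_cons_append: "reduced (u @ v) \<Longrightarrow> foldr red_cons u v = u @ v"
  by (induction u) (simp_all add: reduced_Cons red_cons_reduced del: red_cons.simps)

lemma inv_free_group:
  assumes "w \<in> carrier (free_group X)"
  shows "inv\<^bsub>free_group X\<^esub> w = winv w"
proof -
  interpret group "free_group X" by (rule group_free_group)
  have "foldr red_cons (winv w) w = []"
    using foldr_inverse[of "[]" w] assms by (simp add: winv_def foldr_reduced_Nil)
  then show ?thesis using assms by (intro inv_equality) auto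
qed

text \<open>Locates all cancellation of a product in one piece \<open>c\<close>. The length
  comparisons for commuting words and the error bound for syllable maps both start from this
  factorization.\<close>

lemma foldr_red_cons_split:
  assumes "reduced u" "reduced v"
  shows "\<exists>u' c v'. u = u' @ c \<and> v = winv c @ v' \<and> foldr red_cons u v = u' @ v'"
  using assms(1)
proof (induction u)
  case Nil
  show ?case by (intro exI[of _ "[]"] exI[of _ v]) simp
next
  case (Cons l u)
  then obtain u' c v' where *: "u = u' @ c" "v = winv c @ v'" "foldr red_cons u v = u' @ v'"
    by (auto simp: reduced_Cons)
  show ?case
  proof (cases "u' = [] \<and> v' \<noteq> [] \<and> hd v' = flip l")
    case True
    then obtain v'' where "v' = flip l # v''" by (cases v') auto
    then show ?thesis using * True
      by (intro exI[of _ "[]"] exI[of _ "l # c"] exI[of _ v''])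
        (auto simp: red_cons_Cons simp del: red_cons.simps)
  next
    case False
    have "red_cons l (u' @ v') = l # u' @ v'"
      using False Cons.prems *(1)
      by (cases "u' @ v'"; cases u') (auto simp: red_cons_Cons reduced_Cons simp del: red_cons.simps(2))
    then show ?thesis using *
      by (intro exI[of _ "l # u'"] exI[of _ c] exI[of _ v']) simp
  qed
qed

lemma letter_in_free_group: "x \<in> X \<Longrightarrow> letter x \<in> carrier (free_group X)"
  by (simp add: letter_def reduced_Cons)

lemma word_eval_cong:
  "(\<And>x. x \<in> fst ` set w \<Longrightarrow> e x = e' x) \<Longrightarrow> word_eval G e w = word_eval G e' w"
  by (induction w) auto

lemma hom_word_eval:
  assumes "group G" "group H" "f \<in> hom G H" "e \<in> X \<rightarrow> carrier G" "fst ` set w \<subseteq> X"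
  shows "f (word_eval G e w) = word_eval H (\<lambda>x. f (e x)) w"
proof -
  interpret f: group_hom G H f
    using assms by (simp add: group_hom_def group_hom_axioms_def)
  show ?thesis using assms(5)
  proof (induction w)
    case (Cons l w)
    moreover have "e (fst l) \<in> carrier G" using Cons.prems assms(4) by auto
    ultimately show ?case
      using word_eval_closed[OF assms(1,4), of w] by simp
  qed simp
qed

lemma word_eval_letters:
  assumes "fst ` set w \<subseteq> X" "reduced w"
  shows "word_eval (free_group X) letter w = w"
  using assms
proof (induction w)
  case (Cons l w)
  have "inv\<^bsub>free_group X\<^esub> letter (fst l) = [(fst l, False)]"
    using Cons.prems inv_free_group[OF letter_in_free_group, of "fst l" X]
    by (simp add: letter_def flip_def)
  then show ?case
    using Cons red_cons_reduced[of l w] by (cases l; cases "snd l") (auto simp: reduced_Cons letter_def)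
qed simp

lemma free_group_hom_eq:
  assumes "group G" "f \<in> hom (free_group X) G" "w \<in> carrier (free_group X)"
  shows "f w = word_eval G (\<lambda>x. f (letter x)) w"
  using hom_word_eval[OF group_free_group assms(1,2), of letter X w] assms(3)
    word_eval_letters[of w X] letter_in_free_group[of _ X] by (auto simp: Pi_iff)

lemma word_eval_letter:
  assumes "group G" "e x \<in> carrier G"
  shows "word_eval G e (letter x) = e x"
proof -
  interpret group G by fact
  show ?thesis using assms by (simp add: letter_def)
qed


section \<open>Magnus coefficients\<close>

text \<open>
  \<open>magnus w I\<close> is the coefficient of the monomial \<open>I\<close> in the image of \<open>w\<close> under the Magnus
  expansion \<open>x \<mapsto> 1 + X\<close> into noncommutative power series; \<open>mag l\<close> is left multiplication by
  the image of the letter \<open>l\<close>, and \<open>conv\<close> is the product of series.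
\<close>

fun mag :: "'x \<times> bool \<Rightarrow> ('x list \<Rightarrow> int) \<Rightarrow> 'x list \<Rightarrow> int" where
  "mag l \<phi> [] = \<phi> []"
| "mag l \<phi> (y # I) =
     \<phi> (y # I) + (if y = fst l then (if snd l then \<phi> I else - mag l \<phi> I) else 0)"

definition unit_series :: "'x list \<Rightarrow> int" where
  "unit_series I = (if I = [] then 1 else 0)"

definition magnus :: "'x word \<Rightarrow> 'x list \<Rightarrow> int" where
  "magnus w = foldr mag w unit_series"

fun conv :: "('x list \<Rightarrow> int) \<Rightarrow> ('x list \<Rightarrow> int) \<Rightarrow> 'x list \<Rightarrow> int" where
  "conv \<phi> \<psi> [] = \<phi> [] * \<psi> []"
| "conv \<phi> \<psi> (x # I) = \<phi> [] * \<psi> (x # I) + conv (\<lambda>J. \<phi> (x # J)) \<psi> I"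

lemma unit_series_simps [simp]: "unit_series [] = 1" "unit_series (x # I) = 0"
  by (simp_all add: unit_series_def)

text \<open>For a negative letter the recursion solves \<open>\<psi> = \<phi> - X \<psi>\<close>, so
  it is multiplication by the inverse of \<open>1 + X\<close>.\<close>

lemma mag_flip [simp]: "mag l (mag (flip l) \<phi>) = \<phi>"
proof
  fix I show "mag l (mag (flip l) \<phi>) I = \<phi> I"
    by (induction I) (auto simp: flip_def)
qed

lemma foldr_mag_red_cons: "foldr mag (red_cons l w) \<phi> = mag l (foldr mag w \<phi>)"
  by (cases w) (auto simp: red_cons_Cons simp del: red_cons.simps(2))

lemma foldr_mag_mult: "foldr mag (foldr red_cons u v) \<phi> = foldr mag u (foldr mag v \<phi>)"
  by (induction u) (simp_all add: foldr_mag_red_cons)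

lemma conv_add_left: "conv (\<lambda>J. \<phi> J + \<phi>' J) \<psi> I = conv \<phi> \<psi> I + conv \<phi>' \<psi> I"
  by (induction I arbitrary: \<phi> \<phi>') (simp_all add: algebra_simps)

lemma conv_cmult_left: "conv (\<lambda>J. c * \<phi> J) \<psi> I = c * conv \<phi> \<psi> I"
  by (induction I arbitrary: \<phi>) (simp_all add: algebra_simps)

lemma conv_zero_left [simp]: "conv (\<lambda>J. 0) \<psi> I = 0"
  by (induction I) simp_all

lemma conv_unit_left [simp]: "conv unit_series \<psi> = \<psi>"
proof
  fix I show "conv unit_series \<psi> I = \<psi> I" by (cases I) simp_all
qed

lemma conv_mag: "conv (mag l \<phi>) \<psi> I = mag l (conv \<phi> \<psi>) I"
proof (induction I)
  case (Cons x I)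
  have "(\<lambda>J. mag l \<phi> (x # J)) = (\<lambda>J. \<phi> (x # J) +
      (if x = fst l then if snd l then 1 else -1 else 0) * (if snd l then \<phi> J else mag l \<phi> J))"
    by auto
  then show ?case
    using Cons by (cases "snd l") (simp_all only: conv.simps conv_add_left conv_cmult_left mag.simps, auto)
qed simp

lemma magnus_Nil [simp]: "magnus [] = unit_series"
  by (simp add: magnus_def)

lemma magnus_Cons: "magnus (l # w) = mag l (magnus w)"
  by (simp add: magnus_def)

lemma foldr_mag_conv: "foldr mag u \<phi> = conv (magnus u) \<phi>"
  by (induction u) (auto simp: magnus_Cons conv_mag)

lemma magnus_mult: "magnus (foldr red_cons u v) = conv (magnus u) (magnus v)"
proof -
  have "magnus (foldr red_cons u v) = foldr mag u (magnus v)"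
    by (simp add: magnus_def foldr_mag_mult)
  then show ?thesis by (simp add: foldr_mag_conv)
qed

lemma magnus_const [simp]: "magnus w [] = 1"
  by (induction w) (simp_all add: magnus_Cons)

lemma magnus_mult1: "magnus (foldr red_cons u v) [x] = magnus u [x] + magnus v [x]"
  by (simp add: magnus_mult)

lemma magnus_mult2:
  "magnus (foldr red_cons u v) [x, y] = magnus u [x, y] + magnus u [x] * magnus v [y] + magnus v [x, y]"
  by (simp add: magnus_mult)

lemma magnus_winv_left: "reduced w \<Longrightarrow> conv (magnus (winv w)) (magnus w) = unit_series"
  using foldr_inverse[of "[]" w] magnus_mult[of "winv w" w]
  by (simp add: winv_def foldr_reduced_Nil)

text \<open>
  A reduced word \<open>x\<^sub>1\<^bsup>k\<^sub>1\<^esup> \<dots> x\<^sub>m\<^bsup>k\<^sub>m\<^esup>\<close> is detected by its coefficient \<open>k\<^sub>1 \<dots> k\<^sub>m\<close> at the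
  monomial \<open>x\<^sub>1 \<dots> x\<^sub>m\<close>.
\<close>

fun syllables :: "'x word \<Rightarrow> 'x list" where
  "syllables [] = []"
| "syllables (l # w) =
     (if w \<noteq> [] \<and> fst (hd w) = fst l then syllables w else fst l # syllables w)"

lemma hd_syllables: "w \<noteq> [] \<Longrightarrow> syllables w \<noteq> [] \<and> hd (syllables w) = fst (hd w)"
  by (induction w) auto

lemma distinct_adj_syllables: "distinct_adj (syllables w)"
proof (induction w)
  case (Cons l w)
  then show ?case
    using hd_syllables[of w]
    by (cases "w = []"; cases "syllables w") (auto simp: distinct_adj_Cons)
qed simp

lemma mag_other: "J = [] \<or> hd J \<noteq> fst l \<Longrightarrow> mag l \<phi> J = \<phi> J"
  by (cases J) auto

lemma mag_distinct_adj:
  assumes "distinct_adj (fst l # J)"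
  shows "mag l \<phi> (fst l # J) = \<phi> (fst l # J) + (if snd l then 1 else - 1) * \<phi> J"
  using mag_other[of J l \<phi>] assms by (cases J) (auto simp: distinct_adj_Cons)

text \<open>A monomial without adjacent repetitions takes at most one letter from each syllable. The
  second alternative serves the induction when a letter extends the leading syllable: the number of
  syllables stays the same, but the tail of \<open>J\<close> cannot start with that letter.\<close>

lemma magnus_beyond_syllables:
  assumes "reduced w" "distinct_adj J"
    and "length J > length (syllables w) \<or>
      length J = length (syllables w) \<and> w \<noteq> [] \<and> hd J \<noteq> fst (hd w)"
  shows "magnus w J = 0"
  using assms
proof (induction w arbitrary: J)
  case Nil
  then show ?case by (cases J) auto
next
  case (Cons l w)
  have w: "reduced w" using Cons.prems by (simp add: reduced_Cons)
  from Cons.prems(3) have "J \<noteq> []" by (auto split: if_splits simp: hd_syllables)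
  then obtain y J' where J: "J = y # J'" by (cases J) auto
  have dJ': "distinct_adj J'" using Cons.prems(2) J by (cases J') auto
  have J0: "magnus w J = 0"
    using Cons.prems(3) by (intro Cons.IH[OF w Cons.prems(2)]) (auto split: if_splits)
  show ?case
  proof (cases "y = fst l")
    case True
    have "magnus w J' = 0"
    proof (rule Cons.IH[OF w dJ'])
      show "length (syllables w) < length J' \<or>
        length J' = length (syllables w) \<and> w \<noteq> [] \<and> hd J' \<noteq> fst (hd w)"
        using Cons.prems(2,3) True J hd_syllables[of w]
        by (cases J'; cases "syllables w") (auto split: if_splits simp: distinct_adj_Cons)
    qed
    then show ?thesis
      using J0 mag_distinct_adj[of l J' "magnus w"] Cons.prems(2) J True by (simp add: magnus_Cons)
  next
    case False
    then show ?thesis using J0 J by (simp add: magnus_Cons)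
  qed
qed

text \<open>\<open>k\<close> is the exponent of the leading syllable and \<open>P\<close> the
  product of the remaining exponents. The sign is recorded because a letter that extends this
  syllable of a reduced word has the same sign, so \<open>k\<close> cannot return to 0.\<close>

lemma magnus_syllables:
  assumes "reduced w" "w \<noteq> []"
  shows "\<exists>k P. P \<noteq> 0 \<and> (if snd (hd w) then k > 0 else k < 0) \<and>
    magnus w (syllables w) = k * P \<and> magnus w (tl (syllables w)) = P"
  using assms
proof (induction w)
  case (Cons l w)
  have w: "reduced w" using Cons.prems by (simp add: reduced_Cons)
  let ?s = "if snd l then 1 else - 1 :: int"
  show ?case
  proof (cases "w \<noteq> [] \<and> fst (hd w) = fst l")
    case True
    then obtain k P where kP: "P \<noteq> 0" "if snd (hd w) then k > 0 else k < 0"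
      "magnus w (syllables w) = k * P" "magnus w (tl (syllables w)) = P"
      using Cons.IH w by auto
    obtain I where I: "syllables w = fst l # I"
      using hd_syllables[of w] True by (cases "syllables w") auto
    have dI: "distinct_adj (fst l # I)" using distinct_adj_syllables[of w] I by simp
    have "snd (hd w) = snd l"
      using Cons.prems True by (auto simp: reduced_Cons flip_def prod_eq_iff)
    moreover have "magnus (l # w) (fst l # I) = k * P + ?s * P"
      using kP I mag_distinct_adj[OF dI, of "magnus w"] by (simp add: magnus_Cons)
    moreover have "magnus (l # w) I = P"
      using kP I dI mag_other[of I l "magnus w"]
      by (cases I) (auto simp: magnus_Cons distinct_adj_Cons)
    ultimately show ?thesis
      using kP True I
      by (intro exI[of _ "k + ?s"] exI[of _ P]) (auto simp: algebra_simps split: if_splits)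
  next
    case False
    let ?I = "syllables w"
    have hdI: "?I = [] \<or> hd ?I \<noteq> fst l" using hd_syllables[of w] False by (cases "w = []") simp_all
    then have dI: "distinct_adj (fst l # ?I)"
      using distinct_adj_syllables[of w] by (cases ?I) (auto simp: distinct_adj_Cons)
    have "magnus w (fst l # ?I) = 0"
      using magnus_beyond_syllables[OF w dI] by simp
    then have "magnus (l # w) (fst l # ?I) = ?s * magnus w ?I"
      using mag_distinct_adj[OF dI, of "magnus w"] by (simp add: magnus_Cons)
    moreover have "magnus (l # w) ?I = magnus w ?I"
      using mag_other[OF hdI] by (simp add: magnus_Cons)
    moreover have "magnus w ?I \<noteq> 0"
    proof (cases "w = []")
      case False
      then obtain k P where "P \<noteq> 0" "if snd (hd w) then k > 0 else k < 0" "magnus w ?I = k * P"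
        using Cons.IH w by auto
      then show ?thesis by (auto split: if_splits)
    qed simp
    ultimately show ?thesis
      using False by (intro exI[of _ ?s] exI[of _ "magnus w ?I"]) auto
  qed
qed simp

lemma magnus_eq_unit_iff:
  assumes "reduced w"
  shows "magnus w = unit_series \<longleftrightarrow> w = []"
proof
  assume m: "magnus w = unit_series"
  show "w = []"
  proof (rule ccontr)
    assume "w \<noteq> []"
    with magnus_syllables[OF assms] hd_syllables[of w] m show False
      by (cases "syllables w") (auto split: if_splits)
  qed
qed simp

lemma magnus_inject:
  assumes "reduced u" "reduced v" "magnus u = magnus v"
  shows "u = v"
proof -
  have "magnus (foldr red_cons (winv u) v) = unit_series"
    using magnus_mult[of "winv u" v] assms magnus_winv_left[of u] by simp
  then have "foldr red_cons (winv u) v = []"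
    using magnus_eq_unit_iff[OF reduced_foldr[OF assms(2)]] by simp
  then have "foldr red_cons u (foldr red_cons (winv u) v) = u"
    using assms foldr_reduced_Nil by simp
  moreover have "foldr red_cons u (foldr red_cons (winv u) v) = v"
    using foldr_inverse[OF assms(2), of "winv u"] by (simp add: winv_def[symmetric])
  ultimately show ?thesis by simp
qed

section \<open>Uniqueness of roots\<close>

lemma conv_cong:
  assumes "\<And>J. length J \<le> length I \<Longrightarrow> \<phi> J = \<phi>' J" "\<And>J. length J \<le> length I \<Longrightarrow> \<psi> J = \<psi>' J"
  shows "conv \<phi> \<psi> I = conv \<phi>' \<psi>' I"
  using assms
proof (induction I arbitrary: \<phi> \<phi>')
  case (Cons x I)
  have "conv (\<lambda>J. \<phi> (x # J)) \<psi> I = conv (\<lambda>J. \<phi>' (x # J)) \<psi>' I"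
    by (rule Cons.IH) (use Cons.prems in auto)
  then show ?case using Cons.prems(1)[of "[]"] Cons.prems(2)[of "x # I"] by simp
qed simp

text \<open>The mixed terms involve only lower degrees, where nothing changes; in the top degree
  each factor meets the constant term 1 of the other.\<close>

lemma conv_diff_top:
  assumes "\<And>J. length J < length I \<Longrightarrow> \<phi> J = \<phi>' J" "\<And>J. length J < length I \<Longrightarrow> \<psi> J = \<psi>' J"
    and "\<phi> [] = 1" "\<psi> [] = 1" "I \<noteq> []"
  shows "conv \<phi> \<psi> I - conv \<phi>' \<psi>' I = \<phi> I - \<phi>' I + (\<psi> I - \<psi>' I)"
proof -
  have aux: "conv \<phi> \<psi> I - conv \<phi>' \<psi>' I = \<phi> I - \<phi>' I"
    if "\<And>J. length J < length I \<Longrightarrow> \<phi> J = \<phi>' J" "\<And>J. length J \<le> length I \<Longrightarrow> \<psi> J = \<psi>' J"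
      "\<psi> [] = 1" for \<phi> \<phi>' \<psi> \<psi>' :: "'a list \<Rightarrow> int" and I
    using that
  proof (induction I arbitrary: \<phi> \<phi>')
    case Nil
    then show ?case using Nil(2)[of "[]"] Nil(3) by simp
  next
    case (Cons x I)
    have "conv (\<lambda>J. \<phi> (x # J)) \<psi> I - conv (\<lambda>J. \<phi>' (x # J)) \<psi>' I = \<phi> (x # I) - \<phi>' (x # I)"
      by (rule Cons.IH) (use Cons.prems in auto)
    then show ?case using Cons.prems(1)[of "[]"] Cons.prems(2)[of "x # I"] by simp
  qed
  obtain x J where I: "I = x # J" using assms(5) by (cases I) auto
  have "conv (\<lambda>J. \<phi> (x # J)) \<psi> J - conv (\<lambda>J. \<phi>' (x # J)) \<psi>' J = \<phi> (x # J) - \<phi>' (x # J)"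
    by (rule aux) (use assms I in auto)
  moreover have "\<phi>' [] = 1" using assms(1)[of "[]"] assms(3) I by simp
  ultimately show ?thesis using assms(3) I by simp
qed

lemma magnus_pow_diff:
  fixes u v :: "'x word"
  defines "wpow \<equiv> \<lambda>(u :: 'x word) n. ((foldr red_cons u) ^^ n) []"
  assumes eq: "\<And>J. length J < length I \<Longrightarrow> magnus u J = magnus v J" and I: "I \<noteq> []"
  shows "(\<forall>J. length J < length I \<longrightarrow> magnus (wpow u n) J = magnus (wpow v n) J) \<and>
    magnus (wpow u n) I - magnus (wpow v n) I = int n * (magnus u I - magnus v I)"
proof (induction n)
  case 0
  then show ?case by (simp add: wpow_def)
next
  case (Suc n)
  have *: "magnus (wpow w (Suc n)) J = conv (magnus w) (magnus (wpow w n)) J" for w J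
    by (simp add: wpow_def magnus_mult)
  have low: "magnus (wpow u (Suc n)) J = magnus (wpow v (Suc n)) J" if "length J < length I" for J
    unfolding * by (rule conv_cong) (use that Suc eq in auto)
  have "magnus (wpow u (Suc n)) I - magnus (wpow v (Suc n)) I =
      magnus u I - magnus v I + (magnus (wpow u n) I - magnus (wpow v n) I)"
    unfolding * by (rule conv_diff_top) (use Suc eq I in auto)
  with low Suc show ?case by (simp add: algebra_simps)
qed

lemma free_group_pow: "u [^]\<^bsub>free_group X\<^esub> (n::nat) = ((foldr red_cons u) ^^ n) []"
  if "u \<in> carrier (free_group X)"
proof -
  interpret group "free_group X" by (rule group_free_group)
  show ?thesis
  proof (induction n)
    case (Suc n)
    have "u [^]\<^bsub>free_group X\<^esub> Suc n = u \<otimes>\<^bsub>free_group X\<^esub> u [^]\<^bsub>free_group X\<^esub> n"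
      using that nat_pow_Suc2 by blast
    then show ?case using Suc by simp
  qed simp
qed

definition unique_roots :: "('a, 'b) monoid_scheme \<Rightarrow> bool" where
  "unique_roots G \<longleftrightarrow> (\<forall>u\<in>carrier G. \<forall>v\<in>carrier G. \<forall>n::nat.
     n \<ge> 1 \<longrightarrow> u [^]\<^bsub>G\<^esub> n = v [^]\<^bsub>G\<^esub> n \<longrightarrow> u = v)"

text \<open>Induction on the degree: once the coefficients of \<open>u\<close> and \<open>v\<close>
  agree in lower degrees, those of the powers at \<open>I\<close> differ by \<open>n\<close> times
  the difference at \<open>I\<close>, and the integers have no torsion.\<close>

lemma unique_roots_free_group: "unique_roots (free_group X)"
  unfolding unique_roots_def
proof (intro ballI allI impI)
  fix u v and n :: nat
  assume uv: "u \<in> carrier (free_group X)" "v \<in> carrier (free_group X)" "1 \<le> n"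
    and eq: "u [^]\<^bsub>free_group X\<^esub> n = v [^]\<^bsub>free_group X\<^esub> n"
  have "magnus u I = magnus v I" for I
  proof (induction "length I" arbitrary: I rule: less_induct)
    case less
    show ?case
    proof (cases "I = []")
      case False
      then show ?thesis
        using magnus_pow_diff[of I u v n] less eq uv by (simp add: free_group_pow del: free_group_simps)
    qed simp
  qed
  then have "magnus u = magnus v" ..
  with uv show "u = v" using magnus_inject[of u v] by simp
qed

section \<open>Substitution into the Magnus expansion\<close>

lemma conv_assoc: "conv (conv a b) c I = conv a (conv b c) I"
proof (induction I arbitrary: a)
  case (Cons x I)
  then show ?case
    by (simp add: conv_add_left conv_cmult_left algebra_simps)
qed simp

lemma conv_sum_right:
  "conv \<phi> (\<lambda>J. \<Sum>k\<in>A. c k * \<psi> k J) I = (\<Sum>k\<in>A. c k * conv \<phi> (\<psi> k) I)"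
  by (induction I arbitrary: \<phi>)
    (simp_all add: sum_distrib_left algebra_simps sum.distrib)

text \<open>\<open>subst_coeff e K I\<close> is the coefficient of \<open>I\<close> after substituting \<open>e x - 1\<close> for each
  variable \<open>x\<close> of the monomial \<open>K\<close>.\<close>

fun subst_coeff :: "('x \<Rightarrow> 'y list \<Rightarrow> int) \<Rightarrow> 'x list \<Rightarrow> 'y list \<Rightarrow> int" where
  "subst_coeff e [] = unit_series"
| "subst_coeff e (x # K) = conv (\<lambda>J. e x J - unit_series J) (subst_coeff e K)"

text \<open>Each factor, \<open>e x\<close> minus 1, has no constant term, so the product over
  \<open>K\<close> starts in degree \<open>length K\<close>.\<close>

lemma subst_coeff_long:
  assumes "\<And>x. e x [] = 1" "length I < length K"
  shows "subst_coeff e K I = 0"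
  using assms(2)
proof (induction K arbitrary: I)
  case (Cons x K)
  have "conv \<phi> (subst_coeff e K) I = 0" if "length I < length K" for \<phi> I
    using that Cons.IH by (induction I arbitrary: \<phi>) auto
  then show ?case using Cons.prems assms(1) Cons.IH by (cases I) auto
qed simp

text \<open>In the lowest possible degree only the linear parts of the factors contribute.\<close>

lemma subst_coeff_top:
  assumes "\<And>x. e x [] = 1" "\<And>x y. x \<in> X \<Longrightarrow> e x [y] = (if x = y then 1 else 0)"
    "length I = length K" "set K \<subseteq> X"
  shows "subst_coeff e K I = (if K = I then 1 else 0)"
  using assms(3,4)
proof (induction K arbitrary: I)
  case (Cons x K)
  then obtain y J where I: "I = y # J" "length J = length K" by (cases I) auto
  have z: "conv \<phi> (subst_coeff e K) I = 0" if "length I < length K" for \<phi> I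
    using that subst_coeff_long[of e, OF assms(1)] by (induction I arbitrary: \<phi>) auto
  have "conv \<phi> (subst_coeff e K) J = \<phi> [] * subst_coeff e K J" for \<phi>
    using I(2) z by (cases J) auto
  then show ?case using Cons I assms(1,2) by auto
qed simp

definition words_upto :: "'x set \<Rightarrow> nat \<Rightarrow> 'x list set" where
  "words_upto X n = {K. set K \<subseteq> X \<and> length K \<le> n}"

lemma finite_words_upto: "finite X \<Longrightarrow> finite (words_upto X n)"
  unfolding words_upto_def by (rule finite_lists_length_le)

lemma subst_mag:
  assumes "finite X" "x \<in> X" "\<And>x. e x [] = 1" "length I \<le> n"
  shows "(\<Sum>K\<in>words_upto X n. mag (x, True) \<phi> K * subst_coeff e K I) =
    conv (e x) (\<lambda>I. \<Sum>K\<in>words_upto X n. \<phi> K * subst_coeff e K I) I"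
proof -
  let ?W = "words_upto X n"
  have fin: "finite ?W" by (rule finite_words_upto[OF assms(1)])
  have A: "{K \<in> ?W. K \<noteq> [] \<and> hd K = x} = (\<lambda>K. x # K) ` {K \<in> ?W. length K < n}" (is "?A = ?B")
  proof (rule Set.set_eqI)
    fix K show "K \<in> ?A \<longleftrightarrow> K \<in> ?B"
      using assms(2) by (cases K) (auto simp: words_upto_def)
  qed
  \<comment> \<open>Prepending \<open>x\<close> to a word of length \<open>n\<close> leaves the
    truncated range. Such words contribute nothing at \<open>I\<close>, which is why a finite sum
    suffices.\<close>
  have long: "subst_coeff e (x # K) I = 0" if "\<not> length K < n" for K
    using subst_coeff_long[of e I "x # K", OF assms(3)] assms(4) that by simp
  have split: "mag (x, True) \<phi> K = \<phi> K + (if K \<noteq> [] \<and> hd K = x then \<phi> (tl K) else 0)" for K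
    by (cases K) auto
  have "(\<Sum>K\<in>?W. (if K \<noteq> [] \<and> hd K = x then \<phi> (tl K) else 0) * subst_coeff e K I) =
    (\<Sum>K\<in>{K \<in> ?W. K \<noteq> [] \<and> hd K = x}. \<phi> (tl K) * subst_coeff e K I)"
    by (rule sum.mono_neutral_cong_right) (use fin in auto)
  also have "\<dots> = (\<Sum>K\<in>{K \<in> ?W. length K < n}. \<phi> K * subst_coeff e (x # K) I)"
    unfolding A by (simp add: sum.reindex inj_on_def)
  also have "\<dots> = (\<Sum>K\<in>?W. \<phi> K * subst_coeff e (x # K) I)"
    by (rule sum.mono_neutral_left) (use fin long in \<open>auto simp del: subst_coeff.simps\<close>)
  also have "\<dots> = conv (\<lambda>J. e x J - unit_series J) (\<lambda>I. \<Sum>K\<in>?W. \<phi> K * subst_coeff e K I) I"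
    by (simp add: conv_sum_right)
  also have "\<dots> = conv (e x) (\<lambda>I. \<Sum>K\<in>?W. \<phi> K * subst_coeff e K I) I -
      (\<Sum>K\<in>?W. \<phi> K * subst_coeff e K I)"
    using conv_add_left[of "\<lambda>J. e x J - unit_series J" unit_series
        "\<lambda>I. \<Sum>K\<in>?W. \<phi> K * subst_coeff e K I" I] by simp
  finally show ?thesis by (simp add: split distrib_right sum.distrib)
qed

lemma magnus_word_eval:
  assumes X: "finite X" and E: "E \<in> X \<rightarrow> carrier (free_group Y)"
    and w: "fst ` set w \<subseteq> X" and n: "length I \<le> n"
  shows "magnus (word_eval (free_group Y) E w) I =
    (\<Sum>K\<in>words_upto X n. magnus w K * subst_coeff (\<lambda>x. magnus (E x)) K I)"
  using w n
proof (induction w arbitrary: I)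
  case Nil
  have "(\<Sum>K\<in>words_upto X n. magnus [] K * subst_coeff (\<lambda>x. magnus (E x)) K I) =
      (\<Sum>K\<in>{[]}. magnus [] K * subst_coeff (\<lambda>x. magnus (E x)) K I)"
    by (rule sum.mono_neutral_right)
      (auto simp: finite_words_upto[OF X] unit_series_def, simp add: words_upto_def)
  then show ?case by simp
next
  case (Cons l w)
  let ?S = "\<lambda>\<phi> I. \<Sum>K\<in>words_upto X n. \<phi> K * subst_coeff (\<lambda>x. magnus (E x)) K I"
  let ?w = "word_eval (free_group Y) E w"
  have x: "fst l \<in> X" and Ex: "E (fst l) \<in> carrier (free_group Y)"
    using Cons.prems E by (auto simp del: free_group_simps)
  have IH: "magnus ?w J = ?S (magnus w) J" if "length J \<le> n" for J
    using Cons that by auto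
  have sub: "?S (mag (fst l, True) \<phi>) J = conv (magnus (E (fst l))) (?S \<phi>) J" if "length J \<le> n" for \<phi> J
    using subst_mag[OF X x _ that, of "\<lambda>x. magnus (E x)" \<phi>] by simp
  show ?case
  proof (cases "snd l")
    case True
    then have l: "l = (fst l, True)" by (simp add: prod_eq_iff)
    have "magnus (word_eval (free_group Y) E (l # w)) I = conv (magnus (E (fst l))) (magnus ?w) I"
      using True by (simp add: magnus_mult)
    also have "\<dots> = conv (magnus (E (fst l))) (?S (magnus w)) I"
      by (rule conv_cong) (use IH Cons.prems in auto)
    also have "\<dots> = ?S (magnus (l # w)) I"
      using sub[of I "magnus w"] l Cons.prems(2) by (metis magnus_Cons)
    finally show ?thesis .
  next
    case False
    then have l: "flip l = (fst l, True)" by (simp add: flip_def)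
    \<comment> \<open>An inverse letter is handled backwards: the series of \<open>w\<close> arises
      from that of \<open>l # w\<close> by a positive letter, so the rule for positive letters
      applies and \<open>E (fst l)\<close> cancels against its inverse.\<close>
    have w: "magnus w = mag (fst l, True) (magnus (l # w))"
      using mag_flip[of "flip l" "magnus w"] unfolding l by (simp add: magnus_Cons l[symmetric])
    have inv: "inv\<^bsub>free_group Y\<^esub> E (fst l) = winv (E (fst l))"
      by (rule inv_free_group[OF Ex])
    have "magnus (word_eval (free_group Y) E (l # w)) I =
        conv (magnus (winv (E (fst l)))) (magnus ?w) I"
      using False by (simp add: magnus_mult inv)
    also have "\<dots> = conv (magnus (winv (E (fst l)))) (?S (mag (fst l, True) (magnus (l # w)))) I"
      by (rule conv_cong) (use IH w Cons.prems in auto)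
    also have "\<dots> = conv (magnus (winv (E (fst l)))) (conv (magnus (E (fst l))) (?S (magnus (l # w)))) I"
      by (rule conv_cong) (use sub Cons.prems in auto)
    also have "\<dots> = ?S (magnus (l # w)) I"
      using magnus_winv_left[of "E (fst l)"] Ex by (simp add: conv_assoc[symmetric])
    finally show ?thesis .
  qed
qed

lemma magnus_support:
  assumes "fst ` set w \<subseteq> X" "\<not> set I \<subseteq> X"
  shows "magnus w I = 0"
  using assms
proof (induction w arbitrary: I)
  case Nil
  then show ?case by (cases I) auto
next
  case (Cons l w)
  have "mag l \<phi> I = 0" if "\<not> set I \<subseteq> X" "\<And>I. \<not> set I \<subseteq> X \<Longrightarrow> \<phi> I = 0" for \<phi> I
    using that Cons.prems(1) by (induction I) auto
  then show ?case using Cons by (auto simp: magnus_Cons)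
qed

text \<open>If \<open>w\<close> is not trivial, take a monomial of least degree at which its series
  differs from 1. Substituting series whose linear parts are the variables themselves alters this
  coefficient only through shorter nonempty monomials, which are absent, so \<open>f w\<close> has
  the same coefficient there.\<close>

lemma inj_if_id_on_abelianization:
  assumes X: "finite X" and f: "f \<in> hom (free_group X) (free_group X)"
    and ab: "\<And>x y. x \<in> X \<Longrightarrow> magnus (f (letter x)) [y] = (if x = y then 1 else 0)"
  shows "inj_on f (carrier (free_group X))"
proof -
  interpret f: group_hom "free_group X" "free_group X" f
    using f by (simp add: group_hom_def group_hom_axioms_def group_free_group)
  have E: "(\<lambda>x. f (letter x)) \<in> X \<rightarrow> carrier (free_group X)"
    using letter_in_free_group[of _ X] f.hom_closed by blast
  have "w = []" if w: "w \<in> carrier (free_group X)" "f w = []" for w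
  proof (rule ccontr)
    assume "w \<noteq> []"
    then have "magnus w \<noteq> unit_series" using magnus_eq_unit_iff w by auto
    then obtain I where "magnus w I \<noteq> unit_series I" by auto
    then have "\<exists>m I. length I = m \<and> magnus w I \<noteq> unit_series I" by auto
    then obtain m where m: "\<exists>I. length I = m \<and> magnus w I \<noteq> unit_series I"
      and min: "\<And>k. k < m \<Longrightarrow> \<not> (\<exists>I. length I = k \<and> magnus w I \<noteq> unit_series I)"
      using exists_least_iff[of "\<lambda>m. \<exists>I. length I = m \<and> magnus w I \<noteq> unit_series I"] by auto
    from m obtain I where I: "length I = m" "magnus w I \<noteq> unit_series I" by auto
    have I0: "I \<noteq> []" using I by auto
    have IX: "set I \<subseteq> X"
      using magnus_support[of w X I] w I I0 by (auto simp: unit_series_def)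
    have "magnus (f w) I = (\<Sum>K\<in>words_upto X m. magnus w K * subst_coeff (\<lambda>x. magnus (f (letter x))) K I)"
      using magnus_word_eval[OF X E, of w I m] w I free_group_hom_eq[OF group_free_group f, of w] by simp
    also have "\<dots> = (\<Sum>K\<in>{I}. magnus w K * subst_coeff (\<lambda>x. magnus (f (letter x))) K I)"
    proof (rule sum.mono_neutral_right)
      show "\<forall>K\<in>words_upto X m - {I}. magnus w K * subst_coeff (\<lambda>x. magnus (f (letter x))) K I = 0"
      proof
        fix K assume K: "K \<in> words_upto X m - {I}"
        show "magnus w K * subst_coeff (\<lambda>x. magnus (f (letter x))) K I = 0"
        proof (cases "length K = m")
          case True
          then show ?thesis
            using K I subst_coeff_top[where X = X and K = K and I = I and e = "\<lambda>x. magnus (f (letter x))"] ab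
            by (auto simp: words_upto_def)
        next
          case False
          then have "magnus w K = unit_series K" using K min[of "length K"] by (auto simp: words_upto_def)
          then show ?thesis using I0 by (cases K; cases I) auto
        qed
      qed
    qed (use X IX I in \<open>simp_all add: finite_words_upto, simp add: words_upto_def\<close>)
    also have "\<dots> = magnus w I"
      using subst_coeff_top[where X = X and K = I and I = I and e = "\<lambda>x. magnus (f (letter x))"] ab IX by simp
    finally show False using w I by simp
  qed
  then show ?thesis
    by (intro f.inj_on_one_iff[THEN iffD2]) auto
qed


section \<open>Commuting elements of free groups\<close>

lemma free_group_pow_concat:
  assumes "z \<in> carrier (free_group X)" "reduced (concat (replicate n z))"
  shows "z [^]\<^bsub>free_group X\<^esub> n = concat (replicate n z)"
  unfolding free_group_pow[OF assms(1)] using assms(2)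
proof (induction n)
  case (Suc n)
  then have "reduced (concat (replicate n z))" by (simp add: reduced_append)
  then show ?case
    using Suc foldr_red_cons_append[of z "concat (replicate n z)"] by simp
qed simp

text \<open>Without cancellation \<open>u v\<close> has full length, so \<open>v u\<close> cannot
  cancel either and \<open>u @ v = v @ u\<close> holds literally; commuting lists are powers of a
  common list.\<close>

lemma commuting_words_if_no_cancel:
  assumes u: "u \<in> carrier (free_group X)" "u \<noteq> []" and v: "v \<in> carrier (free_group X)" "v \<noteq> []"
    and comm: "foldr red_cons u v = foldr red_cons v u" and nc: "hd v \<noteq> flip (last u)"
  shows "\<exists>w\<in>carrier (free_group X). \<exists>(i::int) (j::int). u = w [^]\<^bsub>free_group X\<^esub> i \<and> v = w [^]\<^bsub>free_group X\<^esub> j"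
proof -
  let ?F = "free_group X"
  have uv: "foldr red_cons u v = u @ v" using assms by (intro foldr_red_cons_append) (simp add: reduced_append)
  have red: "reduced u" "reduced v" using u v by simp_all
  obtain v' c u' where *: "v = v' @ c" "u = winv c @ u'" "foldr red_cons v u = v' @ u'"
    using foldr_red_cons_split[OF red(2,1)] by blast
  then have "length (u @ v) = length (v' @ u')" using uv comm by simp
  moreover have "length v = length v' + length c" "length u = length c + length u'" using *(1,2) by simp_all
  ultimately have "c = []" by simp
  with * uv comm have "u @ v = v @ u" by simp
  then obtain m n z where z: "concat (replicate m z) = u" "concat (replicate n z) = v"
    using comm_append_are_replicate by blast
  have "m \<noteq> 0" using z u by auto
  then obtain m' where "m = Suc m'" by (cases m) auto
  then have "u = z @ concat (replicate m' z)" using z by simp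
  then have "z \<in> carrier ?F" using u by (auto simp: reduced_append)
  then show ?thesis
    using z u v free_group_pow_concat[of z X m] free_group_pow_concat[of z X n]
    by (intro bexI[of _ z] exI[of _ "int m"] exI[of _ "int n"]) (auto simp: int_pow_int)
qed

definition commuting_powers :: "('a, 'b) monoid_scheme \<Rightarrow> bool" where
  "commuting_powers G \<longleftrightarrow> (\<forall>u\<in>carrier G. \<forall>v\<in>carrier G. u \<otimes>\<^bsub>G\<^esub> v = v \<otimes>\<^bsub>G\<^esub> u \<longrightarrow>
     (\<exists>w\<in>carrier G. \<exists>(i::int) (j::int). u = w [^]\<^bsub>G\<^esub> i \<and> v = w [^]\<^bsub>G\<^esub> j))"

lemma (in group) inv_commute:
  assumes "x \<in> carrier G" "y \<in> carrier G" "x \<otimes> y = y \<otimes> x"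
  shows "inv x \<otimes> y = y \<otimes> inv x"
proof -
  have "inv x \<otimes> y = inv x \<otimes> (y \<otimes> x) \<otimes> inv x" using assms(1,2) by (simp add: m_assoc)
  also have "\<dots> = y \<otimes> inv x" using assms(1,2) by (simp add: assms(3)[symmetric] m_assoc[symmetric])
  finally show ?thesis .
qed

lemma (in group) conj_hom: "x \<in> carrier G \<Longrightarrow> (\<lambda>y. x \<otimes> y \<otimes> inv x) \<in> hom G G"
  by (rule homI) (simp_all add: m_assoc inv_solve_left)

lemma (in group) conj_int_pow:
  assumes "x \<in> carrier G" "w \<in> carrier G"
  shows "x \<otimes> w [^] (i::int) \<otimes> inv x = (x \<otimes> w \<otimes> inv x) [^] i"
  using hom_int_pow[OF conj_hom[OF assms(1)] assms(2), of i] is_group by simp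

lemma ends_conj:
  assumes "w \<noteq> []" "hd w = a" "last w = flip a"
  obtains w' where "w = a # w' @ [flip a]"
proof -
  obtain v where v: "w = a # v" using assms by (cases w) auto
  then have "v \<noteq> []" using assms by auto
  then obtain w' b where "v = w' @ [b]" by (cases v rule: rev_cases) auto
  then show ?thesis using v assms that by auto
qed

text \<open>Induction on the total length. If \<open>v\<close> does not cancel against
  \<open>u\<close> or against \<open>winv u\<close>, the literal case applies. Otherwise both words
  begin with a letter \<open>a\<close> and end with its inverse, and conjugating by that letter
  shortens them.\<close>

lemma commuting_powers_free_group: "commuting_powers (free_group X)"
proof -
  interpret G: group "free_group X" by (rule group_free_group)
  let ?F = "free_group X"
  let ?P = "\<lambda>u v. \<exists>w\<in>carrier ?F. \<exists>(i::int) (j::int).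
    u = w [^]\<^bsub>?F\<^esub> i \<and> v = w [^]\<^bsub>?F\<^esub> j"
  have "?P u v" if "u \<in> carrier ?F" "v \<in> carrier ?F"
    "u \<otimes>\<^bsub>?F\<^esub> v = v \<otimes>\<^bsub>?F\<^esub> u" for u v
    using that
  proof (induction "length u + length v" arbitrary: u v rule: less_induct)
    case less
    note u = less.prems(1) and v = less.prems(2) and comm = less.prems(3)
    have iu: "inv\<^bsub>?F\<^esub> u = winv u" by (rule inv_free_group[OF u])
    consider "u = []" | "v = []" | "u \<noteq> []" "v \<noteq> []" "hd v \<noteq> flip (last u)"
      | "u \<noteq> []" "v \<noteq> []" "hd v \<noteq> hd u"
      | "u \<noteq> []" "v \<noteq> []" "hd v = flip (last u)" "hd v = hd u" by blast
    then show ?case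
    proof cases
      case 1
      then show ?thesis using v G.one_closed
        by (intro bexI[of _ v] exI[of _ 0] exI[of _ 1]) (auto simp: G.int_pow_1 simp del: free_group_simps(1))
    next
      case 2
      then show ?thesis using u G.one_closed
        by (intro bexI[of _ u] exI[of _ 1] exI[of _ 0]) (auto simp: G.int_pow_1 simp del: free_group_simps(1))
    next
      case 3
      then show ?thesis using commuting_words_if_no_cancel[of u X v] u v comm by simp
    next
      case 4
      have "inv\<^bsub>?F\<^esub> u \<otimes>\<^bsub>?F\<^esub> v = v \<otimes>\<^bsub>?F\<^esub> inv\<^bsub>?F\<^esub> u"
        using u v comm by (rule G.inv_commute)
      then have "?P (winv u) v"
        using commuting_words_if_no_cancel[of "winv u" X v] u v 4 G.inv_closed[OF u]
        by (simp add: iu last_winv del: free_group_simps(1))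
      then obtain w i j where w: "w \<in> carrier ?F" "winv u = w [^]\<^bsub>?F\<^esub> (i::int)"
        "v = w [^]\<^bsub>?F\<^esub> (j::int)" by blast
      have "u = w [^]\<^bsub>?F\<^esub> (- i)"
        using w iu u by (metis G.int_pow_neg G.inv_inv)
      then show ?thesis using w by blast
    next
      case 5
      have red: "reduced u" "reduced v" using u v by simp_all
      have comm': "foldr red_cons u v = foldr red_cons v u" using comm by simp
      \<comment> \<open>If \<open>v u\<close> did not cancel, then \<open>u v\<close>, being equal
        to it, would have full length as well, contrary to the case assumption.\<close>
      have "last v = flip (hd u)"
      proof (rule ccontr)
        assume "last v \<noteq> flip (hd u)"
        then have "hd u \<noteq> flip (last v)" by auto
        then have vu: "foldr red_cons v u = v @ u"
          using red by (intro foldr_red_cons_append) (simp add: reduced_append)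
        obtain u' c v' where *: "u = u' @ c" "v = winv c @ v'" "foldr red_cons u v = u' @ v'"
          using foldr_red_cons_split[OF red] by blast
        have "length u = length u' + length c" "length v = length c + length v'" using *(1,2) by simp_all
        moreover have "length (v @ u) = length (u' @ v')" using vu comm' * by metis
        ultimately have "c = []" by simp
        then have "foldr red_cons u v = u @ v" using * by simp
        then have "reduced (u @ v)" using reduced_foldr[OF red(2), of u] by simp
        then show False using 5 by (simp add: reduced_append)
      qed
      moreover have "last u = flip (hd u)" using 5 by (metis flip_flip)
      ultimately obtain a u1 v1 where u1: "u = a # u1 @ [flip a]" and v1: "v = a # v1 @ [flip a]"
        using ends_conj[of u "hd u"] ends_conj[of v "hd u"] 5 by metis
      have red1: "reduced (a # u1 @ [flip a])" "reduced (a # v1 @ [flip a])" using red u1 v1 by simp_all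
      have X1: "fst ` set (a # u1 @ [flip a]) \<subseteq> X" "fst ` set (a # v1 @ [flip a]) \<subseteq> X"
        using u v u1 v1 by simp_all
      have x: "[a] \<in> carrier ?F" using X1 by (simp add: reduced_Cons)
      have c1: "u1 \<in> carrier ?F" "v1 \<in> carrier ?F"
        using red1 X1 by (simp_all add: reduced_Cons reduced_append)
      have ix: "inv\<^bsub>?F\<^esub> [a] = [flip a]" using inv_free_group[OF x] by simp
      have conj: "a # w @ [flip a] = [a] \<otimes>\<^bsub>?F\<^esub> w \<otimes>\<^bsub>?F\<^esub> inv\<^bsub>?F\<^esub> [a]"
        if "reduced (a # w @ [flip a])" for w
      proof -
        have "reduced ((a # w) @ [flip a])" using that by (simp only: append_Cons)
        then have "reduced (a # w)" "foldr red_cons (a # w) [flip a] = (a # w) @ [flip a]"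
          using reduced_append[of "a # w" "[flip a]"] foldr_red_cons_append by blast+
        then show ?thesis using red_cons_reduced[of a w] by (simp add: ix)
      qed
      note cu = conj[OF red1(1), folded u1] and cv = conj[OF red1(2), folded v1]
      have "u1 \<otimes>\<^bsub>?F\<^esub> v1 = v1 \<otimes>\<^bsub>?F\<^esub> u1"
      proof -
        have "[a] \<otimes>\<^bsub>?F\<^esub> (u1 \<otimes>\<^bsub>?F\<^esub> v1) \<otimes>\<^bsub>?F\<^esub> inv\<^bsub>?F\<^esub> [a] =
            [a] \<otimes>\<^bsub>?F\<^esub> (v1 \<otimes>\<^bsub>?F\<^esub> u1) \<otimes>\<^bsub>?F\<^esub> inv\<^bsub>?F\<^esub> [a]"
          unfolding hom_mult[OF G.conj_hom[OF x] c1] hom_mult[OF G.conj_hom[OF x] c1(2,1)]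
          using comm unfolding cu cv .
        then show ?thesis
          using x c1 G.inv_closed[OF x] G.m_closed[OF c1] G.m_closed[OF c1(2,1)]
          by (simp add: G.m_closed del: free_group_simps)
      qed
      moreover have "length u1 + length v1 < length u + length v" using u1 v1 by simp
      ultimately obtain w i j where w: "w \<in> carrier ?F"
        "u1 = w [^]\<^bsub>?F\<^esub> (i::int)" "v1 = w [^]\<^bsub>?F\<^esub> (j::int)"
        using less.hyps[OF _ c1] by blast
      let ?w = "[a] \<otimes>\<^bsub>?F\<^esub> w \<otimes>\<^bsub>?F\<^esub> inv\<^bsub>?F\<^esub> [a]"
      have "?w \<in> carrier ?F" using G.m_closed G.inv_closed x w(1) by blast
      moreover have "u = ?w [^]\<^bsub>?F\<^esub> i" "v = ?w [^]\<^bsub>?F\<^esub> j"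
        using cu cv w(2,3) G.conj_int_pow[OF x w(1)] by metis+
      ultimately show ?thesis by blast
    qed
  qed
  then show ?thesis unfolding commuting_powers_def by blast
qed

lemma (in group) commuting_root:
  assumes "commuting_powers G" "z \<in> carrier G" "c \<in> carrier G" "z \<otimes> c = c \<otimes> z" "c \<noteq> \<one>"
  shows "\<exists>n::nat. \<exists>k::int. n \<ge> 1 \<and> z [^] n = c [^] k"
proof -
  obtain w i j where w: "w \<in> carrier G" "z = w [^] (i::int)" "c = w [^] (j::int)"
    using assms unfolding commuting_powers_def by metis
  have "j \<noteq> 0" using w assms by auto
  \<comment> \<open>The exponent of \<open>z\<close> has to be a positive natural number, so the
    sign of \<open>j\<close> moves to the exponent of \<open>c\<close>.\<close>
  have "z [^] nat \<bar>j\<bar> = c [^] (i * sgn j)"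
    using w by (simp add: int_pow_int[symmetric] int_pow_pow)
      (metis abs_mult_sgn mult.commute mult.left_commute abs_sgn)
  then show ?thesis using \<open>j \<noteq> 0\<close> by (intro exI[of _ "nat \<bar>j\<bar>"] exI[of _ "i * sgn j"]) auto
qed

lemma iso_commuting_powers:
  assumes "group G" "group H" "f \<in> iso G H" "commuting_powers G"
  shows "commuting_powers H"
  unfolding commuting_powers_def
proof (intro ballI impI)
  fix u v
  assume uv: "u \<in> carrier H" "v \<in> carrier H" "u \<otimes>\<^bsub>H\<^esub> v = v \<otimes>\<^bsub>H\<^esub> u"
  interpret f: group_hom G H f
    using assms by (simp add: group_hom_def group_hom_axioms_def iso_imp_homomorphism)
  have bij: "bij_betw f (carrier G) (carrier H)" using assms(3) by (simp add: iso_def)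
  obtain a b where ab: "a \<in> carrier G" "b \<in> carrier G" "u = f a" "v = f b"
    using uv bij by (metis bij_betw_imp_surj_on imageE)
  then have "f (a \<otimes>\<^bsub>G\<^esub> b) = f (b \<otimes>\<^bsub>G\<^esub> a)" using uv by simp
  then have "a \<otimes>\<^bsub>G\<^esub> b = b \<otimes>\<^bsub>G\<^esub> a"
    using ab inj_onD[OF bij_betw_imp_inj_on[OF bij]] f.G.m_closed by blast
  then obtain w i j where "w \<in> carrier G" "a = w [^]\<^bsub>G\<^esub> (i::int)" "b = w [^]\<^bsub>G\<^esub> (j::int)"
    using assms(4) ab unfolding commuting_powers_def by blast
  then show "\<exists>w\<in>carrier H. \<exists>(i::int) (j::int). u = w [^]\<^bsub>H\<^esub> i \<and> v = w [^]\<^bsub>H\<^esub> j"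
    using ab f.hom_int_pow f.hom_closed by metis
qed


section \<open>Maps out of splittings\<close>

lemma presented_by_relator:
  assumes "group G" "presented_by G X R e" "r \<in> R"
  shows "word_eval G e r = \<one>\<^bsub>G\<^esub>"
proof -
  have "r \<in> normal_closure (free_group X) R" using assms(3) by (auto simp: normal_closure_def)
  then have "r \<in> kernel (free_group X) G (word_eval G e)" using assms(2) by (simp add: presented_by_def)
  then show ?thesis by (simp add: kernel_def)
qed

lemma presented_by_universal:
  assumes "group G" "group K" "presented_by G X R e" "e' \<in> X \<rightarrow> carrier K"
    and rel: "\<And>r. r \<in> R \<Longrightarrow> word_eval K e' r = \<one>\<^bsub>K\<^esub>"
  shows "\<exists>f\<in>hom G K. \<forall>x\<in>X. f (e x) = e' x"
proof -
  let ?W = "word_eval G e" and ?W' = "word_eval K e'" and ?F = "free_group X"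
  have e: "e \<in> X \<rightarrow> carrier G" and R: "R \<subseteq> carrier ?F" and epi: "?W \<in> epi ?F G"
    and ker: "kernel ?F G ?W = normal_closure ?F R"
    using assms(3) by (auto simp: presented_by_def)
  interpret W: group_hom ?F G ?W
    using word_eval_hom[OF assms(1) e] assms(1) by (simp add: group_hom_def group_hom_axioms_def group_free_group)
  interpret W': group_hom ?F K ?W'
    using word_eval_hom[OF assms(2,4)] assms(2) by (simp add: group_hom_def group_hom_axioms_def group_free_group)
  have "kernel ?F G ?W \<subseteq> kernel ?F K ?W'"
    unfolding ker normal_closure_def
    by (rule Inter_lower) (use W'.normal_kernel R rel in \<open>auto simp: kernel_def simp del: free_group_simps\<close>)
  then have eq: "?W' u = ?W' v" if "u \<in> carrier ?F" "v \<in> carrier ?F" "?W u = ?W v" for u v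
  proof -
    have "u \<otimes>\<^bsub>?F\<^esub> inv\<^bsub>?F\<^esub> v \<in> kernel ?F G ?W"
      using that unfolding kernel_def by (simp add: W.inv_closed W.m_closed del: free_group_simps)
    then have "u \<otimes>\<^bsub>?F\<^esub> inv\<^bsub>?F\<^esub> v \<in> kernel ?F K ?W'"
      using \<open>kernel ?F G ?W \<subseteq> kernel ?F K ?W'\<close> by blast
    then show ?thesis
      using that unfolding kernel_def
      by (simp add: W'.inv_solve_right' del: free_group_simps)
  qed
  define f where "f = (\<lambda>y. ?W' (SOME w. w \<in> carrier ?F \<and> ?W w = y))"
  have surj: "\<exists>w. w \<in> carrier ?F \<and> ?W w = y" if "y \<in> carrier G" for y
  proof -
    have "y \<in> ?W ` carrier ?F" using epi that by (simp add: epi_def del: free_group_simps)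
    then show ?thesis by (rule imageE) blast
  qed
  have f: "f (?W w) = ?W' w" if "w \<in> carrier ?F" for w
  proof -
    have "\<exists>v. v \<in> carrier ?F \<and> ?W v = ?W w" using that by blast
    from someI_ex[OF this] that show ?thesis unfolding f_def by (intro eq) blast+
  qed
  have "f \<in> hom G K"
  proof (rule homI)
    fix y assume "y \<in> carrier G"
    then obtain w where "w \<in> carrier ?F" "?W w = y" by (meson surj)
    then show "f y \<in> carrier K" using f[of w] W'.hom_closed[of w] by simp
  next
    fix y y' assume "y \<in> carrier G" "y' \<in> carrier G"
    then obtain w w' where w: "w \<in> carrier ?F" "w' \<in> carrier ?F" "?W w = y" "?W w' = y'"
      by (meson surj)
    show "f (y \<otimes>\<^bsub>G\<^esub> y') = f y \<otimes>\<^bsub>K\<^esub> f y'"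
      using f[OF W.G.m_closed[OF w(1) w(2)]]
      unfolding W.hom_mult[OF w(1) w(2)] W'.hom_mult[OF w(1) w(2)] f[OF w(1), symmetric] f[OF w(2), symmetric] w(3,4) .
  qed
  moreover have "f (e x) = e' x" if "x \<in> X" for x
  proof -
    have "e x \<in> carrier G" "e' x \<in> carrier K" using that e assms(4) by auto
    then show ?thesis
      using f[OF letter_in_free_group[OF that]] word_eval_letter[OF assms(1), of e x]
        word_eval_letter[OF assms(2), of e' x] by simp
  qed
  ultimately show ?thesis by blast
qed

lemma presented_by_hom_eq:
  assumes "group G" "group K" "presented_by G X R e" "f \<in> hom G K" "f' \<in> hom G K"
    and "\<And>x. x \<in> X \<Longrightarrow> f (e x) = f' (e x)" and "y \<in> carrier G"
  shows "f y = f' y"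
proof -
  have e: "e \<in> X \<rightarrow> carrier G" and "word_eval G e \<in> epi (free_group X) G"
    using assms(3) by (auto simp: presented_by_def)
  then have "y \<in> word_eval G e ` carrier (free_group X)"
    using assms(7) by (simp add: epi_def del: free_group_simps)
  then obtain w where w: "w \<in> carrier (free_group X)" "y = word_eval G e w"
    by (rule imageE) blast
  then show ?thesis
    using hom_word_eval[OF assms(1,2,4) e, of w] hom_word_eval[OF assms(1,2,5) e, of w] assms(6)
      word_eval_cong[of w "\<lambda>x. f (e x)" "\<lambda>x. f' (e x)" K] by auto
qed

lemma word_eval_relator:
  assumes K: "group K" and e: "e \<in> X \<rightarrow> carrier K"
  shows "\<lbrakk>x \<in> X; y \<in> X; z \<in> X\<rbrakk> \<Longrightarrow>
      word_eval K e (letter x \<otimes>\<^bsub>free_group X\<^esub> letter y \<otimes>\<^bsub>free_group X\<^esub> inv\<^bsub>free_group X\<^esub> letter z) =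
      e x \<otimes>\<^bsub>K\<^esub> e y \<otimes>\<^bsub>K\<^esub> inv\<^bsub>K\<^esub> e z" (is "_ \<Longrightarrow> _ \<Longrightarrow> _ \<Longrightarrow> ?A")
    and "\<lbrakk>x \<in> X; y \<in> X\<rbrakk> \<Longrightarrow>
      word_eval K e (letter x \<otimes>\<^bsub>free_group X\<^esub> inv\<^bsub>free_group X\<^esub> letter y) = e x \<otimes>\<^bsub>K\<^esub> inv\<^bsub>K\<^esub> e y"
      (is "_ \<Longrightarrow> _ \<Longrightarrow> ?B")
    and "\<lbrakk>x \<in> X; y \<in> X; z \<in> X\<rbrakk> \<Longrightarrow>
      word_eval K e (inv\<^bsub>free_group X\<^esub> letter x \<otimes>\<^bsub>free_group X\<^esub> letter y \<otimes>\<^bsub>free_group X\<^esub> letter x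
        \<otimes>\<^bsub>free_group X\<^esub> inv\<^bsub>free_group X\<^esub> letter z) =
      inv\<^bsub>K\<^esub> e x \<otimes>\<^bsub>K\<^esub> e y \<otimes>\<^bsub>K\<^esub> e x \<otimes>\<^bsub>K\<^esub> inv\<^bsub>K\<^esub> e z" (is "_ \<Longrightarrow> _ \<Longrightarrow> _ \<Longrightarrow> ?C")
proof -
  interpret W: group_hom "free_group X" K "word_eval K e"
    using word_eval_hom[OF K e] K by (simp add: group_hom_def group_hom_axioms_def group_free_group)
  have l: "letter w \<in> carrier (free_group X)" "word_eval K e (letter w) = e w" if "w \<in> X" for w
    using letter_in_free_group[OF that] word_eval_letter[of K e w, OF K] funcset_mem[OF e that] by blast+
  show ?A if "x \<in> X" "y \<in> X" "z \<in> X" using l that by (simp del: free_group_simps)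
  show ?B if "x \<in> X" "y \<in> X" using l that by (simp del: free_group_simps)
  show ?C if "x \<in> X" "y \<in> X" "z \<in> X" using l that by (simp del: free_group_simps)
qed

lemma amalgam_extend:
  assumes G: "group G" and K: "group K" and spl: "amalgam_splitting G A B C"
    and \<alpha>: "\<alpha> \<in> A \<rightarrow> carrier K" "\<And>a b. a \<in> A \<Longrightarrow> b \<in> A \<Longrightarrow> \<alpha> (a \<otimes>\<^bsub>G\<^esub> b) = \<alpha> a \<otimes>\<^bsub>K\<^esub> \<alpha> b"
    and \<beta>: "\<beta> \<in> B \<rightarrow> carrier K" "\<And>a b. a \<in> B \<Longrightarrow> b \<in> B \<Longrightarrow> \<beta> (a \<otimes>\<^bsub>G\<^esub> b) = \<beta> a \<otimes>\<^bsub>K\<^esub> \<beta> b"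
    and eq: "\<And>c. c \<in> C \<Longrightarrow> \<alpha> c = \<beta> c"
  shows "\<exists>f\<in>hom G K. (\<forall>a\<in>A. f a = \<alpha> a) \<and> (\<forall>b\<in>B. f b = \<beta> b)"
proof -
  interpret K: group K by fact
  let ?X = "A <+> B" and ?e = "case_sum \<alpha> \<beta>"
  have e: "?e \<in> ?X \<rightarrow> carrier K" using \<alpha>(1) \<beta>(1) by (auto simp: Pi_iff split: sum.splits)
  have sub: "subgroup A G" "subgroup B G" "C \<subseteq> A" "C \<subseteq> B"
    using spl by (auto simp: amalgam_splitting_def)
  note rel = word_eval_relator[OF K e]
  have A: "a \<otimes>\<^bsub>G\<^esub> b \<in> A" "\<alpha> (a \<otimes>\<^bsub>G\<^esub> b) = \<alpha> a \<otimes>\<^bsub>K\<^esub> \<alpha> b" if "a \<in> A" "b \<in> A" for a b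
    using that sub(1) \<alpha>(2) by (simp_all add: subgroup.m_closed)
  have B: "a \<otimes>\<^bsub>G\<^esub> b \<in> B" "\<beta> (a \<otimes>\<^bsub>G\<^esub> b) = \<beta> a \<otimes>\<^bsub>K\<^esub> \<beta> b" if "a \<in> B" "b \<in> B" for a b
    using that sub(2) \<beta>(2) by (simp_all add: subgroup.m_closed)
  have cl: "a \<in> A \<Longrightarrow> \<alpha> a \<in> carrier K" "b \<in> B \<Longrightarrow> \<beta> b \<in> carrier K" for a b
    using \<alpha>(1) \<beta>(1) by blast+
  have C: "c \<in> A" "c \<in> B" if "c \<in> C" for c using sub(3,4) that by blast+
  note pres = spl[unfolded amalgam_splitting_def Let_def, THEN conjunct2, THEN conjunct2, THEN conjunct2,
      THEN conjunct2, THEN conjunct2]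
  have "\<exists>f\<in>hom G K. \<forall>x\<in>?X. f (case_sum (\<lambda>a. a) (\<lambda>b. b) x) = ?e x"
    by (rule presented_by_universal[OF G K pres e])
      (auto simp: table_relators_def rel cl A B C eq InlI InrI simp del: free_group_simps)
  then obtain f where f: "f \<in> hom G K" "\<And>x. x \<in> ?X \<Longrightarrow> f (case_sum (\<lambda>a. a) (\<lambda>b. b) x) = ?e x"
    by blast
  have "f a = \<alpha> a" if "a \<in> A" for a using f(2)[OF InlI[OF that]] by simp
  moreover have "f b = \<beta> b" if "b \<in> B" for b using f(2)[OF InrI[OF that]] by simp
  ultimately show ?thesis using f(1) by blast
qed

lemma amalgam_hom_eq:
  assumes G: "group G" and K: "group K" and spl: "amalgam_splitting G A B C"
    and "f \<in> hom G K" "f' \<in> hom G K" "\<And>a. a \<in> A \<Longrightarrow> f a = f' a" "\<And>b. b \<in> B \<Longrightarrow> f b = f' b"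
    and "y \<in> carrier G"
  shows "f y = f' y"
  using spl assms(6,7)
  by (auto simp: amalgam_splitting_def Let_def intro!: presented_by_hom_eq[OF G K _ assms(4,5) _ assms(8)])

lemma hnn_extend:
  assumes G: "group G" and K: "group K" and spl: "hnn_splitting G A C C' \<phi> t"
    and \<alpha>: "\<alpha> \<in> A \<rightarrow> carrier K" "\<And>a b. a \<in> A \<Longrightarrow> b \<in> A \<Longrightarrow> \<alpha> (a \<otimes>\<^bsub>G\<^esub> b) = \<alpha> a \<otimes>\<^bsub>K\<^esub> \<alpha> b"
    and s: "s \<in> carrier K" "\<And>c. c \<in> C \<Longrightarrow> inv\<^bsub>K\<^esub> s \<otimes>\<^bsub>K\<^esub> \<alpha> c \<otimes>\<^bsub>K\<^esub> s = \<alpha> (\<phi> c)"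
  shows "\<exists>f\<in>hom G K. (\<forall>a\<in>A. f a = \<alpha> a) \<and> f t = s"
proof -
  interpret K: group K by fact
  let ?X = "insert None (Some ` A)" and ?e = "case_option s \<alpha>"
  have e: "?e \<in> ?X \<rightarrow> carrier K" using \<alpha>(1) s by (auto simp: Pi_iff)
  have sub: "subgroup A G" "C \<subseteq> A" "C' \<subseteq> A" "\<phi> \<in> iso (G\<lparr>carrier := C\<rparr>) (G\<lparr>carrier := C'\<rparr>)"
    using spl by (auto simp: hnn_splitting_def)
  have \<phi>: "\<phi> c \<in> A" if "c \<in> C" for c using sub that by (auto simp: iso_def hom_def Pi_iff)
  note rel = word_eval_relator[OF K e]
  have A: "a \<otimes>\<^bsub>G\<^esub> b \<in> A" "\<alpha> (a \<otimes>\<^bsub>G\<^esub> b) = \<alpha> a \<otimes>\<^bsub>K\<^esub> \<alpha> b" if "a \<in> A" "b \<in> A" for a b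
    using that sub(1) \<alpha>(2) by (simp_all add: subgroup.m_closed)
  have cl: "a \<in> A \<Longrightarrow> \<alpha> a \<in> carrier K" for a using \<alpha>(1) by blast
  have C: "c \<in> A" if "c \<in> C" for c using sub(2) that by blast
  note pres = spl[unfolded hnn_splitting_def Let_def, THEN conjunct2, THEN conjunct2, THEN conjunct2,
      THEN conjunct2, THEN conjunct2, THEN conjunct2, THEN conjunct2]
  have "\<exists>f\<in>hom G K. \<forall>x\<in>?X. f (case_option t (\<lambda>a. a) x) = ?e x"
    by (rule presented_by_universal[OF G K pres e])
      (auto simp: table_relators_def rel cl A \<phi> s C simp del: free_group_simps)
  then show ?thesis by auto
qed

lemma hnn_hom_eq:
  assumes G: "group G" and K: "group K" and spl: "hnn_splitting G A C C' \<phi> t"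
    and "f \<in> hom G K" "f' \<in> hom G K" "\<And>a. a \<in> A \<Longrightarrow> f a = f' a" "f t = f' t"
    and "y \<in> carrier G"
  shows "f y = f' y"
  using spl assms(6,7)
  by (auto simp: hnn_splitting_def Let_def intro!: presented_by_hom_eq[OF G K _ assms(4,5) _ assms(8)])

lemma hnn_relation:
  assumes G: "group G" and spl: "hnn_splitting G A C C' \<phi> t" and c: "c \<in> C"
  shows "inv\<^bsub>G\<^esub> t \<otimes>\<^bsub>G\<^esub> c \<otimes>\<^bsub>G\<^esub> t = \<phi> c" "\<phi> c \<in> A"
proof -
  interpret group G by fact
  let ?X = "insert None (Some ` A)" and ?e = "case_option t (\<lambda>a. a)"
  have sub: "subgroup A G" "C \<subseteq> A" "C' \<subseteq> A" "\<phi> \<in> iso (G\<lparr>carrier := C\<rparr>) (G\<lparr>carrier := C'\<rparr>)" "t \<in> carrier G"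
    using spl by (auto simp: hnn_splitting_def)
  show \<phi>: "\<phi> c \<in> A" using sub c by (auto simp: iso_def hom_def Pi_iff)
  have A: "A \<subseteq> carrier G" using sub(1) by (rule subgroup.subset)
  have e: "?e \<in> ?X \<rightarrow> carrier G" using A sub by auto
  have cX: "Some c \<in> ?X" "Some (\<phi> c) \<in> ?X" "None \<in> ?X" using c \<phi> sub by auto
  have "word_eval G ?e (inv\<^bsub>free_group ?X\<^esub> letter None \<otimes>\<^bsub>free_group ?X\<^esub> letter (Some c)
            \<otimes>\<^bsub>free_group ?X\<^esub> letter None
            \<otimes>\<^bsub>free_group ?X\<^esub> inv\<^bsub>free_group ?X\<^esub> letter (Some (\<phi> c))) = \<one>\<^bsub>G\<^esub>"
    by (rule presented_by_relator[OF G]) (use spl c in \<open>auto simp: hnn_splitting_def Let_def simp del: free_group_simps\<close>)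
  then have "inv\<^bsub>G\<^esub> t \<otimes>\<^bsub>G\<^esub> c \<otimes>\<^bsub>G\<^esub> t \<otimes>\<^bsub>G\<^esub> inv\<^bsub>G\<^esub> \<phi> c = \<one>\<^bsub>G\<^esub>"
    using word_eval_relator(3)[OF G e cX(3) cX(1) cX(2)] by simp
  then show "inv\<^bsub>G\<^esub> t \<otimes>\<^bsub>G\<^esub> c \<otimes>\<^bsub>G\<^esub> t = \<phi> c"
  proof -
    assume *: "inv\<^bsub>G\<^esub> t \<otimes>\<^bsub>G\<^esub> c \<otimes>\<^bsub>G\<^esub> t \<otimes>\<^bsub>G\<^esub> inv\<^bsub>G\<^esub> \<phi> c = \<one>\<^bsub>G\<^esub>"
    have mem: "c \<in> carrier G" "\<phi> c \<in> carrier G" using A c \<phi> sub(2) by blast+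
    show ?thesis
      using inv_solve_right[of "\<one>\<^bsub>G\<^esub>" "inv\<^bsub>G\<^esub> t \<otimes>\<^bsub>G\<^esub> c \<otimes>\<^bsub>G\<^esub> t" "\<phi> c"] * mem sub(5) by simp
  qed
qed

section \<open>Twists of a splitting as automorphisms\<close>

lemma (in group) nat_pow_fixed:
  assumes "unique_roots G" "\<tau> \<in> hom G G" "\<zeta> \<in> carrier G" "\<tau> (\<zeta> [^] n) = \<zeta> [^] n" "(n::nat) \<ge> 1"
  shows "\<tau> \<zeta> = \<zeta>"
proof -
  have "\<tau> \<zeta> \<in> carrier G" using assms(2,3) by (rule hom_in_carrier)
  moreover have "\<tau> \<zeta> [^] n = \<zeta> [^] n"
    using hom_nat_pow[OF assms(2,3), of n] assms(4) is_group by simp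
  ultimately show ?thesis using assms(1,3,5) unfolding unique_roots_def by blast
qed

lemma (in group) conj_cancel:
  assumes "x \<in> carrier G" "y \<in> carrier G"
  shows "inv x \<otimes> (x \<otimes> y \<otimes> inv x) \<otimes> x = y" "x \<otimes> (inv x \<otimes> y \<otimes> x) \<otimes> inv x = y"
  using assms by (simp_all add: m_assoc) (simp_all add: m_assoc[symmetric])

lemma (in group) amalgam_twist:
  assumes ur: "unique_roots G" and spl: "amalgam_splitting G A B C" and \<zeta>: "\<zeta> \<in> carrier G"
    and comm: "\<And>c. c \<in> C \<Longrightarrow> \<zeta> \<otimes> c = c \<otimes> \<zeta>" and root: "\<zeta> [^] n \<in> C" "(n::nat) \<ge> 1"
  shows "\<exists>\<tau>\<in>hom G G. bij_betw \<tau> (carrier G) (carrier G) \<and>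
    (\<forall>a\<in>A. \<tau> a = a) \<and> (\<forall>b\<in>B. \<tau> b = \<zeta> \<otimes> b \<otimes> inv \<zeta>)"
proof -
  have sub: "A \<subseteq> carrier G" "B \<subseteq> carrier G" "C \<subseteq> A" "subgroup C G"
    using spl by (auto simp: amalgam_splitting_def dest: subgroup.subset)
  let ?tw = "\<lambda>z \<tau>. (\<forall>a\<in>A. \<tau> a = a) \<and> (\<forall>b\<in>B. \<tau> b = z \<otimes> b \<otimes> inv z) \<and> \<tau> z = z"
  \<comment> \<open>The clause \<open>\<tau> z = z\<close> makes the twists by \<open>z\<close> and
    \<open>inv z\<close> compose to the identity. It has to be derived from the power in
    \<open>C\<close>, for no assumption places \<open>z\<close> itself in \<open>A\<close> or
    \<open>B\<close>.\<close>
  have step: "\<exists>\<tau>\<in>hom G G. ?tw z \<tau>"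
    if z: "z \<in> carrier G" "\<And>c. c \<in> C \<Longrightarrow> z \<otimes> c = c \<otimes> z" "z [^] n \<in> C" for z
  proof -
    have "\<exists>\<tau>\<in>hom G G. (\<forall>a\<in>A. \<tau> a = a) \<and> (\<forall>b\<in>B. \<tau> b = z \<otimes> b \<otimes> inv z)"
    proof (rule amalgam_extend[OF is_group is_group spl])
      show "(\<lambda>b. z \<otimes> b \<otimes> inv z) \<in> B \<rightarrow> carrier G" using sub(2) z(1) by auto
      show "z \<otimes> (a \<otimes> b) \<otimes> inv z = z \<otimes> a \<otimes> inv z \<otimes> (z \<otimes> b \<otimes> inv z)" if "a \<in> B" "b \<in> B" for a b
        using hom_mult[OF conj_hom[OF z(1)], of a b] that sub(2) by blast
      show "c = z \<otimes> c \<otimes> inv z" if "c \<in> C" for c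
      proof -
        have "c \<in> carrier G" using that sub by blast
        then show ?thesis using z(1) z(2)[OF that] by (simp add: m_assoc)
      qed
    qed (use sub in auto)
    then obtain \<tau> where \<tau>: "\<tau> \<in> hom G G" "\<forall>a\<in>A. \<tau> a = a" "\<forall>b\<in>B. \<tau> b = z \<otimes> b \<otimes> inv z"
      by blast
    moreover have "\<tau> z = z"
      using nat_pow_fixed[OF ur \<tau>(1) z(1) _ root(2)] \<tau>(2) z(3) sub(3) by blast
    ultimately show ?thesis by blast
  qed
  have inv: "inv \<zeta> \<in> carrier G" "\<And>c. c \<in> C \<Longrightarrow> inv \<zeta> \<otimes> c = c \<otimes> inv \<zeta>" "inv \<zeta> [^] n \<in> C"
    using \<zeta> comm sub inv_commute[of \<zeta>] nat_pow_inv[OF \<zeta>] root(1) subgroup.m_inv_closed[OF sub(4)]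
    by auto
  obtain \<tau> \<tau>' where \<tau>: "\<tau> \<in> hom G G" "?tw \<zeta> \<tau>" and \<tau>': "\<tau>' \<in> hom G G" "?tw (inv \<zeta>) \<tau>'"
    using step[OF \<zeta> comm root(1)] step[OF inv] by blast
  have cancel: "f (f' y) = y"
    if f: "f \<in> hom G G" "?tw z f" and f': "f' \<in> hom G G" "?tw (inv z) f'" and "z \<in> carrier G" "y \<in> carrier G" for f f' z y
  proof (rule amalgam_hom_eq[OF is_group is_group spl _ _ _ _ \<open>y \<in> carrier G\<close>])
    interpret f: group_hom G G f using f(1) by (simp add: group_hom_def group_hom_axioms_def is_group)
    show "(\<lambda>y. f (f' y)) \<in> hom G G" using Group.hom_compose[OF f'(1) f(1)] by (simp add: o_def)
    show "(\<lambda>y. y) \<in> hom G G" by (simp add: hom_def)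
    show "f (f' b) = b" if "b \<in> B" for b
      using that sub(2) \<open>z \<in> carrier G\<close> f(2) f'(2) conj_cancel(1)[OF \<open>z \<in> carrier G\<close>] by (simp add: subset_iff)
  qed (use f(2) f'(2) in auto)
  have 2: "\<tau> (\<tau>' y) = y" if "y \<in> carrier G" for y
    by (rule cancel[OF \<tau> \<tau>' \<zeta> that])
  have 1: "\<tau>' (\<tau> y) = y" if "y \<in> carrier G" for y
    by (rule cancel[OF \<tau>' \<tau>(1) _ inv(1) that]) (use \<tau>(2) \<zeta> in simp)
  have "bij_betw \<tau> (carrier G) (carrier G)"
    by (rule bij_betw_byWitness[of _ \<tau>']) (use 1 2 hom_in_carrier[OF \<tau>(1)] hom_in_carrier[OF \<tau>'(1)] in auto)
  then show ?thesis using \<tau> by blast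
qed

lemma (in group) hnn_twist:
  assumes ur: "unique_roots G" and spl: "hnn_splitting G A C C' \<phi> t" and \<zeta>: "\<zeta> \<in> carrier G"
    and comm: "\<And>c. c \<in> C \<Longrightarrow> \<zeta> \<otimes> c = c \<otimes> \<zeta>" and root: "\<zeta> [^] n \<in> C" "(n::nat) \<ge> 1"
  shows "\<exists>\<tau>\<in>hom G G. bij_betw \<tau> (carrier G) (carrier G) \<and> (\<forall>a\<in>A. \<tau> a = a) \<and> \<tau> t = \<zeta> \<otimes> t"
proof -
  have sub: "A \<subseteq> carrier G" "C \<subseteq> A" "subgroup C G" "t \<in> carrier G"
    using spl by (auto simp: hnn_splitting_def dest: subgroup.subset)
  let ?tw = "\<lambda>z \<tau>. (\<forall>a\<in>A. \<tau> a = a) \<and> \<tau> t = z \<otimes> t \<and> \<tau> z = z"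
  have step: "\<exists>\<tau>\<in>hom G G. ?tw z \<tau>"
    if z: "z \<in> carrier G" "\<And>c. c \<in> C \<Longrightarrow> z \<otimes> c = c \<otimes> z" "z [^] n \<in> C" for z
  proof -
    have "\<exists>\<tau>\<in>hom G G. (\<forall>a\<in>A. \<tau> a = a) \<and> \<tau> t = z \<otimes> t"
    proof (rule hnn_extend[OF is_group is_group spl])
      show "inv (z \<otimes> t) \<otimes> c \<otimes> (z \<otimes> t) = \<phi> c" if "c \<in> C" for c
      proof -
        have c: "c \<in> carrier G" using that sub by blast
        have "inv (z \<otimes> t) \<otimes> c \<otimes> (z \<otimes> t) = inv t \<otimes> (inv z \<otimes> (c \<otimes> z)) \<otimes> t"
          using c z(1) sub(4) by (simp add: inv_mult_group m_assoc)
        also have "\<dots> = inv t \<otimes> c \<otimes> t"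
          using c z(1) sub(4) by (simp add: z(2)[OF that, symmetric] m_assoc[symmetric])
        finally show ?thesis using hnn_relation(1)[OF is_group spl that] by simp
      qed
    qed (use sub z in auto)
    then obtain \<tau> where \<tau>: "\<tau> \<in> hom G G" "\<forall>a\<in>A. \<tau> a = a" "\<tau> t = z \<otimes> t"
      by blast
    moreover have "\<tau> z = z"
      using nat_pow_fixed[OF ur \<tau>(1) z(1) _ root(2)] \<tau>(2) z(3) sub(2) by blast
    ultimately show ?thesis by blast
  qed
  have inv: "inv \<zeta> \<in> carrier G" "\<And>c. c \<in> C \<Longrightarrow> inv \<zeta> \<otimes> c = c \<otimes> inv \<zeta>" "inv \<zeta> [^] n \<in> C"
    using \<zeta> comm sub inv_commute[of \<zeta>] nat_pow_inv[OF \<zeta>] root(1) subgroup.m_inv_closed[OF sub(3)]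
    by auto
  obtain \<tau> \<tau>' where \<tau>: "\<tau> \<in> hom G G" "?tw \<zeta> \<tau>" and \<tau>': "\<tau>' \<in> hom G G" "?tw (inv \<zeta>) \<tau>'"
    using step[OF \<zeta> comm root(1)] step[OF inv] by blast
  have cancel: "f (f' y) = y"
    if f: "f \<in> hom G G" "?tw z f" and f': "f' \<in> hom G G" "?tw (inv z) f'" and "z \<in> carrier G" "y \<in> carrier G" for f f' z y
  proof (rule hnn_hom_eq[OF is_group is_group spl _ _ _ _ \<open>y \<in> carrier G\<close>])
    interpret f: group_hom G G f using f(1) by (simp add: group_hom_def group_hom_axioms_def is_group)
    show "(\<lambda>y. f (f' y)) \<in> hom G G" using Group.hom_compose[OF f'(1) f(1)] by (simp add: o_def)
    show "(\<lambda>y. y) \<in> hom G G" by (simp add: hom_def)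
    show "f (f' t) = t" using sub(4) \<open>z \<in> carrier G\<close> f(2) f'(2) by (simp add: m_assoc[symmetric])
  qed (use f(2) f'(2) in auto)
  have 2: "\<tau> (\<tau>' y) = y" if "y \<in> carrier G" for y
    by (rule cancel[OF \<tau> \<tau>' \<zeta> that])
  have 1: "\<tau>' (\<tau> y) = y" if "y \<in> carrier G" for y
    by (rule cancel[OF \<tau>' \<tau>(1) _ inv(1) that]) (use \<tau>(2) \<zeta> in simp)
  have "bij_betw \<tau> (carrier G) (carrier G)"
    by (rule bij_betw_byWitness[of _ \<tau>']) (use 1 2 hom_in_carrier[OF \<tau>(1)] hom_in_carrier[OF \<tau>'(1)] in auto)
  then show ?thesis using \<tau> by blast
qed


section \<open>The intersection form of the boundary word\<close>

definition surf_gens :: "nat \<Rightarrow> surface_gen set" where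
  "surf_gens g = GenA ` {1..g} \<union> GenB ` {1..g}"

lemma surf_group_eq: "surf_group g = free_group (surf_gens g)"
  by (simp add: surf_group_def surf_gens_def)

lemma finite_surf_gens [simp]: "finite (surf_gens g)"
  by (simp add: surf_gens_def)

fun bar :: "surface_gen \<Rightarrow> surface_gen" where
  "bar (GenA i) = GenB i"
| "bar (GenB i) = GenA i"

fun gen_sign :: "surface_gen \<Rightarrow> int" where
  "gen_sign (GenA i) = 1"
| "gen_sign (GenB i) = -1"

lemma bar_bar [simp]: "bar (bar x) = x"
  by (cases x) auto

lemma bar_eq_iff: "bar x = y \<longleftrightarrow> x = bar y"
  by auto

lemma bar_in_surf_gens [simp]: "bar x \<in> surf_gens g \<longleftrightarrow> x \<in> surf_gens g"
  by (cases x) (auto simp: surf_gens_def)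

lemma gen_sign_square [simp]: "gen_sign x * gen_sign x = 1"
  by (cases x) auto

lemma sum_surf_gens: "(\<Sum>y\<in>surf_gens g. f y) = (\<Sum>i=1..g. f (GenA i) + f (GenB i))"
proof -
  have "(\<Sum>y\<in>surf_gens g. f y) = (\<Sum>y\<in>GenA ` {1..g}. f y) + (\<Sum>y\<in>GenB ` {1..g}. f y)"
    unfolding surf_gens_def by (rule sum.union_disjoint) auto
  then show ?thesis by (simp add: sum.reindex inj_on_def sum.distrib)
qed

lemma hom_boundary:
  assumes "group K" "f \<in> hom (surf_group g) K"
  shows "f (boundary g) = foldr (\<lambda>i w. commutator K (f (letter (GenA i))) (f (letter (GenB i))) \<otimes>\<^bsub>K\<^esub> w)
    [1..<g + 1] \<one>\<^bsub>K\<^esub>"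
proof -
  interpret G: group "surf_group g" by (rule group_surf_group)
  interpret f: group_hom "surf_group g" K f
    using assms G.is_group by (simp add: group_hom_def group_hom_axioms_def)
  let ?f = "\<lambda>i w. commutator (surf_group g) (letter (GenA i)) (letter (GenB i)) \<otimes>\<^bsub>surf_group g\<^esub> w"
  have "foldr ?f ks \<one>\<^bsub>surf_group g\<^esub> \<in> carrier (surf_group g) \<and>
      f (foldr ?f ks \<one>\<^bsub>surf_group g\<^esub>) =
      foldr (\<lambda>i w. commutator K (f (letter (GenA i))) (f (letter (GenB i))) \<otimes>\<^bsub>K\<^esub> w) ks \<one>\<^bsub>K\<^esub>"
    if "set ks \<subseteq> {1..g}" for ks
    using that by (induction ks) (auto simp: commutator_def letter_in_surf_group)
  from this[of "[1..<g + 1]"] show ?thesis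
    unfolding boundary_def by (simp add: atLeastLessThanSuc_atLeastAtMost del: upt_Suc)
qed

section \<open>Magnus coefficients of commutators in degrees one and two\<close>

lemma magnus_letter: "magnus (letter x) [y] = (if x = y then 1 else 0)"
  by (simp add: letter_def magnus_Cons)

lemma magnus_winv:
  assumes "reduced u"
  shows "magnus (winv u) [x] = - magnus u [x]"
    and "magnus (winv u) [x, y] = magnus u [x] * magnus u [y] - magnus u [x, y]"
proof -
  show *: "magnus (winv u) [x] = - magnus u [x]" for x
    using fun_cong[OF magnus_winv_left[OF assms], of "[x]"] by simp
  show "magnus (winv u) [x, y] = magnus u [x] * magnus u [y] - magnus u [x, y]"
    using fun_cong[OF magnus_winv_left[OF assms], of "[x, y]"] by (simp add: *)
qed

lemma magnus_commutator:
  assumes "u \<in> carrier (free_group Y)" "v \<in> carrier (free_group Y)"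
  shows "magnus (commutator (free_group Y) u v) [x] = 0"
    and "magnus (commutator (free_group Y) u v) [x, y] = magnus u [x] * magnus v [y] - magnus v [x] * magnus u [y]"
proof -
  have r: "reduced u" "reduced v" using assms by simp_all
  note m = commutator_def inv_free_group[OF assms(1)] inv_free_group[OF assms(2)] free_group_simps(2)
    magnus_mult1 magnus_mult2 magnus_winv[OF r(1)] magnus_winv[OF r(2)]
  show "magnus (commutator (free_group Y) u v) [x] = 0"
    unfolding m by simp
  show "magnus (commutator (free_group Y) u v) [x, y] = magnus u [x] * magnus v [y] - magnus v [x] * magnus u [y]"
    unfolding m by (simp add: algebra_simps)
qed

text \<open>Up to degree two a commutator is 1 plus the commutator of the linear parts. The linear
  coefficients vanish, so in a product of commutators the quadratic ones add up; they form the
  symplectic form pulled back along \<open>f\<close>.\<close>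

lemma magnus_hom_boundary:
  assumes f: "f \<in> hom (surf_group g) (free_group Y)"
  shows "magnus (f (boundary g)) [x, y] =
    (\<Sum>z\<in>surf_gens g. gen_sign z * magnus (f (letter z)) [x] * magnus (f (letter (bar z))) [y])"
proof -
  let ?Y = "free_group Y"
  interpret Y: group ?Y by (rule group_free_group)
  let ?a = "\<lambda>i. f (letter (GenA i))" and ?b = "\<lambda>i. f (letter (GenB i))"
  let ?P = "\<lambda>ks. foldr (\<lambda>i w. commutator ?Y (?a i) (?b i) \<otimes>\<^bsub>?Y\<^esub> w) ks \<one>\<^bsub>?Y\<^esub>"
  have cl: "?a i \<in> carrier ?Y" "?b i \<in> carrier ?Y" if "i \<in> {1..g}" for i
    using that letter_in_surf_group[OF that] hom_in_carrier[OF f] by blast+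
  have "magnus (?P ks) [y] = 0 \<and> magnus (?P ks) [x, y] =
      (\<Sum>i\<leftarrow>ks. magnus (?a i) [x] * magnus (?b i) [y] - magnus (?b i) [x] * magnus (?a i) [y])"
    if "set ks \<subseteq> {1..g}" for ks
    using that
  proof (induction ks)
    case (Cons k ks)
    then show ?case
      using magnus_commutator[OF cl, of k k] by (simp add: magnus_mult1 magnus_mult2 del: free_group_simps(1))
  qed simp
  from this[of "[1..<g + 1]"] hom_boundary[OF Y.is_group f]
  have "magnus (f (boundary g)) [x, y] =
      (\<Sum>i\<leftarrow>[1..<g + 1]. magnus (?a i) [x] * magnus (?b i) [y] - magnus (?b i) [x] * magnus (?a i) [y])"
    by (simp add: atLeastLessThanSuc_atLeastAtMost del: upt_Suc free_group_simps)
  also have "\<dots> = (\<Sum>i=1..g. magnus (?a i) [x] * magnus (?b i) [y] - magnus (?b i) [x] * magnus (?a i) [y])"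
    by (simp add: interv_sum_list_conv_sum_set_nat atLeastLessThanSuc_atLeastAtMost del: upt_Suc)
  finally show ?thesis by (simp add: sum_surf_gens)
qed

lemma magnus_hom1:
  assumes X: "finite X" and f: "f \<in> hom (free_group X) (free_group Y)" and v: "v \<in> carrier (free_group X)"
  shows "magnus (f v) [y] = (\<Sum>x\<in>X. magnus v [x] * magnus (f (letter x)) [y])"
proof -
  let ?Y = "free_group Y"
  let ?E = "\<lambda>x. f (letter x)"
  have cl: "?E x \<in> carrier ?Y" if "x \<in> X" for x
    using hom_in_carrier[OF f letter_in_free_group[OF that]] .
  have "magnus (word_eval (?Y) ?E w) [y] = (\<Sum>x\<in>X. magnus w [x] * magnus (?E x) [y])"
    if "fst ` set w \<subseteq> X" for w
    using that
  proof (induction w)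
    case (Cons l w)
    have l: "fst l \<in> X" using Cons.prems by auto
    let ?s = "if snd l then 1 else - 1 :: int"
    have "magnus (word_eval (?Y) ?E (l # w)) [y] =
        ?s * magnus (?E (fst l)) [y] + magnus (word_eval (?Y) ?E w) [y]"
      using cl[OF l] by (simp add: magnus_mult1 magnus_winv inv_free_group)
    also have "\<dots> = (\<Sum>x\<in>X. (magnus w [x] + (if x = fst l then ?s else 0)) * magnus (?E x) [y])"
      using Cons l X by (simp add: distrib_right sum.distrib if_distrib[of "\<lambda>c. c * _"] cong: if_cong)
    also have "\<dots> = (\<Sum>x\<in>X. magnus (l # w) [x] * magnus (?E x) [y])"
      by (rule sum.cong) (auto simp: magnus_Cons)
    finally show ?case .
  qed simp
  then show ?thesis using free_group_hom_eq[OF group_free_group f v] v by simp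
qed

text \<open>
  An endomorphism that fixes the boundary word preserves the symplectic form on the
  abelianization, so it is invertible there; being idempotent, it is the identity there.
\<close>

lemma retraction_fixing_boundary_inj:
  assumes f: "f \<in> hom (surf_group g) (surf_group g)" and fb: "f (boundary g) = boundary g"
    and idem: "\<And>x. x \<in> carrier (surf_group g) \<Longrightarrow> f (f x) = f x"
  shows "inj_on f (carrier (surf_group g))"
proof -
  let ?X = "surf_gens g"
  define M where "M x y = magnus (f (letter y)) [x]" for x y
  note f' = f[unfolded surf_group_eq]
  have fY: "f \<in> hom (surf_group g) (free_group ?X)" using f' by (simp add: surf_group_eq)
  have lt: "letter x \<in> carrier (free_group ?X)" if "x \<in> ?X" for x
    using letter_in_free_group[OF that] .
  have form: "(\<Sum>y\<in>?X. gen_sign y * M x y * M x' (bar y)) = (if x' = bar x then gen_sign x else 0)"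
    if "x \<in> ?X" for x x'
  proof -
    have "(\<Sum>y\<in>?X. gen_sign y * M x y * M x' (bar y)) = magnus (boundary g) [x, x']"
      using magnus_hom_boundary[OF fY, of x x'] fb by (simp add: M_def)
    also have "\<dots> = (\<Sum>y\<in>?X. gen_sign y * magnus (letter y) [x] * magnus (letter (bar y)) [x'])"
      using magnus_hom_boundary[of "\<lambda>w. w" g ?X x x'] by (simp add: hom_def surf_group_eq)
    also have "\<dots> = (\<Sum>y\<in>?X. if y = x then (if x' = bar x then gen_sign x else 0) else 0)"
      by (rule sum.cong) (auto simp: magnus_letter)
    finally show ?thesis using that by simp
  qed
  \<comment> \<open>The adjoint of \<open>M\<close> for the symplectic form. Since \<open>M\<close>
    preserves the form, the adjoint is a right inverse.\<close>
  define R where "R y z = gen_sign y * gen_sign z * M (bar z) (bar y)" for y z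
  have right_inv: "(\<Sum>y\<in>?X. M x y * R y z) = (if x = z then 1 else 0)" if "x \<in> ?X" for x z
  proof -
    have "(\<Sum>y\<in>?X. M x y * R y z) = gen_sign z * (\<Sum>y\<in>?X. gen_sign y * M x y * M (bar z) (bar y))"
      by (simp add: R_def sum_distrib_left algebra_simps)
    also have "\<dots> = (if x = z then 1 else 0)"
      using form[OF that, of "bar z"] by (auto simp: bar_eq_iff)
    finally show ?thesis .
  qed
  have idemM: "(\<Sum>w\<in>?X. M x w * M w y) = M x y" if "y \<in> ?X" for x y
    using magnus_hom1[OF finite_surf_gens f' hom_in_carrier[OF f' lt[OF that]], of x]
      idem[unfolded surf_group_eq, OF lt[OF that]]
    by (simp add: M_def mult.commute)
  have M: "M x z = (if x = z then 1 else 0)" if "x \<in> ?X" "z \<in> ?X" for x z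
  proof -
    \<comment> \<open>As matrices, \<open>M = M (M R) = (M M) R = M R = 1\<close>, the third
      equality by idempotence.\<close>
    have "M x z = (\<Sum>w\<in>?X. M x w * (\<Sum>y\<in>?X. M w y * R y z))"
      using that by (simp add: right_inv if_distrib[of "\<lambda>c. _ * c"] cong: if_cong)
    also have "\<dots> = (\<Sum>y\<in>?X. (\<Sum>w\<in>?X. M x w * M w y) * R y z)"
      unfolding sum_distrib_left sum_distrib_right by (subst sum.swap) (simp add: mult.assoc)
    also have "\<dots> = (if x = z then 1 else 0)" using idemM right_inv[OF that(1)] by simp
    finally show ?thesis .
  qed
  have "magnus (f (letter x)) [y] = (if x = y then 1 else 0)" if "x \<in> ?X" for x y
  proof (cases "y \<in> ?X")
    case True
    then show ?thesis using M[OF True that] by (simp add: M_def eq_commute)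
  next
    case False
    have "f (letter x) \<in> carrier (free_group ?X)" using hom_in_carrier[OF f' lt[OF that]] .
    then show ?thesis using magnus_support[of "f (letter x)" ?X "[y]"] False that by auto
  qed
  from inj_if_id_on_abelianization[OF finite_surf_gens f' this] show ?thesis by (simp add: surf_group_eq)
qed


section \<open>Fractional Dehn twists of admissible representations\<close>

lemma admissible_root:
  assumes F: "group F" "commuting_powers F" and h: "h \<in> hom (surf_group g) F" and adm: "admissible F g h"
    and z: "z \<in> carrier F" and C: "C = generate (surf_group g) {c}" "c \<in> carrier (surf_group g)" "c \<noteq> \<one>\<^bsub>surf_group g\<^esub>"
    and comm: "\<forall>c\<in>C. z \<otimes>\<^bsub>F\<^esub> h c = h c \<otimes>\<^bsub>F\<^esub> z"
  shows "\<exists>\<zeta>\<in>carrier (surf_group g). z = h \<zeta> \<and> (\<forall>c\<in>C. \<zeta> \<otimes>\<^bsub>surf_group g\<^esub> c = c \<otimes>\<^bsub>surf_group g\<^esub> \<zeta>) \<and>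
    (\<exists>n::nat. n \<ge> 1 \<and> \<zeta> [^]\<^bsub>surf_group g\<^esub> n \<in> C)"
proof -
  let ?H = "surf_group g"
  interpret F: group F by fact
  interpret H: group ?H by (rule group_surf_group)
  interpret h: group_hom ?H F h using h F H.is_group by (simp add: group_hom_def group_hom_axioms_def)
  have inj: "inj_on h (carrier ?H)" and prim: "primitive_subgroup (h ` carrier ?H) F"
    using adm by (auto simp: admissible_def)
  have CH: "C \<subseteq> carrier ?H" unfolding C(1) by (rule H.generate_incl) (use C(2) in simp)
  have cC: "c \<in> C" unfolding C(1) by (rule generate.incl) simp
  have "h c \<noteq> \<one>\<^bsub>F\<^esub>" using inj_onD[OF inj, of c "\<one>\<^bsub>?H\<^esub>"] C by auto
  then obtain n k where nk: "(n::nat) \<ge> 1" "z [^]\<^bsub>F\<^esub> n = h c [^]\<^bsub>F\<^esub> (k::int)"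
    using F.commuting_root[OF F(2) z, of "h c"] comm cC C(2) by auto
  have hk: "h c [^]\<^bsub>F\<^esub> k = h (c [^]\<^bsub>?H\<^esub> k)" using h.hom_int_pow[OF C(2)] by simp
  then have "z [^]\<^bsub>F\<^esub> n \<in> h ` carrier ?H" using nk(2) H.int_pow_closed[OF C(2)] by auto
  then have "z \<in> h ` carrier ?H" using prim z nk(1) unfolding primitive_subgroup_def by blast
  then obtain \<zeta> where \<zeta>: "\<zeta> \<in> carrier ?H" "z = h \<zeta>" by blast
  have "\<zeta> \<otimes>\<^bsub>?H\<^esub> d = d \<otimes>\<^bsub>?H\<^esub> \<zeta>" if "d \<in> C" for d
  proof -
    have d: "d \<in> carrier ?H" using that CH by blast
    have "h (\<zeta> \<otimes>\<^bsub>?H\<^esub> d) = h (d \<otimes>\<^bsub>?H\<^esub> \<zeta>)" using comm that \<zeta> d by simp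
    then show ?thesis using inj_onD[OF inj] \<zeta>(1) d by blast
  qed
  moreover have "\<zeta> [^]\<^bsub>?H\<^esub> n = c [^]\<^bsub>?H\<^esub> k"
  proof -
    have "h (\<zeta> [^]\<^bsub>?H\<^esub> n) = h (c [^]\<^bsub>?H\<^esub> k)" using nk(2) hk \<zeta> h.hom_nat_pow by simp
    then show ?thesis using inj_onD[OF inj] \<zeta>(1) C(2) by blast
  qed
  moreover have "c [^]\<^bsub>?H\<^esub> k \<in> C"
    unfolding C(1) H.generate_pow[OF C(2)] by blast
  ultimately show ?thesis using \<zeta> nk(1)
    by (intro bexI[OF _ \<zeta>(1)] conjI exI[of _ n]) simp_all
qed

lemma frac_twist_cases:
  assumes "frac_twist F g h h'"
  obtains (amalgam) A B C z where "amalgam_splitting (surf_group g) A B C" "cyclic_subgroup C (surf_group g)"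
      "boundary g \<in> A" "z \<in> carrier F" "\<forall>c\<in>C. z \<otimes>\<^bsub>F\<^esub> h c = h c \<otimes>\<^bsub>F\<^esub> z"
      "\<forall>a\<in>A. h' a = h a" "\<forall>b\<in>B. h' b = z \<otimes>\<^bsub>F\<^esub> h b \<otimes>\<^bsub>F\<^esub> inv\<^bsub>F\<^esub> z"
    | (hnn) A C C' \<phi> t z where "hnn_splitting (surf_group g) A C C' \<phi> t" "cyclic_subgroup C (surf_group g)"
      "cyclic_subgroup C' (surf_group g)" "boundary g \<in> A" "z \<in> carrier F"
      "\<forall>c\<in>C. z \<otimes>\<^bsub>F\<^esub> h c = h c \<otimes>\<^bsub>F\<^esub> z" "\<forall>a\<in>A. h' a = h a" "h' t = z \<otimes>\<^bsub>F\<^esub> h t"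
  using assms unfolding frac_twist_def by blast

lemma frac_twist_admissible:
  assumes F: "group F" "commuting_powers F"
    and h: "h \<in> hom (surf_group g) F" "h' \<in> hom (surf_group g) F"
    and adm: "admissible F g h" and tw: "frac_twist F g h h'"
  shows "h' ` carrier (surf_group g) = h ` carrier (surf_group g) \<and> inj_on h' (carrier (surf_group g))"
proof -
  let ?H = "surf_group g"
  interpret F: group F by fact
  interpret H: group ?H by (rule group_surf_group)
  interpret h: group_hom ?H F h using h F H.is_group by (simp add: group_hom_def group_hom_axioms_def)
  interpret h': group_hom ?H F h' using h F H.is_group by (simp add: group_hom_def group_hom_axioms_def)
  have ur: "unique_roots ?H" unfolding surf_group_eq by (rule unique_roots_free_group)
  have inj: "inj_on h (carrier ?H)" using adm by (simp add: admissible_def)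
  have twisted: ?thesis if "\<tau> \<in> hom ?H ?H" "bij_betw \<tau> (carrier ?H) (carrier ?H)"
    "\<And>y. y \<in> carrier ?H \<Longrightarrow> h' y = h (\<tau> y)" for \<tau>
  proof
    show "h' ` carrier ?H = h ` carrier ?H"
      using that(2,3) by (metis (no_types, lifting) bij_betw_imp_surj_on image_cong image_image)
    show "inj_on h' (carrier ?H)"
      using comp_inj_on[OF bij_betw_imp_inj_on[OF that(2)], of h] inj that(2,3)
      by (simp add: bij_betw_imp_surj_on inj_on_def)
  qed
  have id: "(\<lambda>y. y) \<in> hom ?H ?H" "bij_betw (\<lambda>y. y) (carrier ?H) (carrier ?H)"
    by (auto simp: hom_def bij_betw_def inj_on_def)
  from tw show ?thesis
  proof (cases rule: frac_twist_cases)
    case (amalgam A B C z)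
    note spl = amalgam(1)
    have sub: "A \<subseteq> carrier ?H" "B \<subseteq> carrier ?H" "subgroup A ?H" "C \<subseteq> A"
      using spl by (auto simp: amalgam_splitting_def dest: subgroup.subset)
    obtain c where c: "c \<in> carrier ?H" "C = generate ?H {c}"
      using amalgam(2) by (auto simp: cyclic_subgroup_def)
    show ?thesis
    proof (cases "c = \<one>\<^bsub>?H\<^esub>")
      case True
      then have C: "C = {\<one>\<^bsub>?H\<^esub>}" using c(2) H.generate_one by simp
      have "\<exists>f\<in>hom ?H ?H. (\<forall>a\<in>A. f a = a) \<and> (\<forall>b\<in>B. f b = \<one>\<^bsub>?H\<^esub>)"
        by (rule amalgam_extend[OF H.is_group H.is_group spl]) (use sub C in auto)
      then obtain f where f: "f \<in> hom ?H ?H" "\<And>a. a \<in> A \<Longrightarrow> f a = a" "\<And>b. b \<in> B \<Longrightarrow> f b = \<one>\<^bsub>?H\<^esub>"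
        by blast
      interpret f: group_hom ?H ?H f using f(1) H.is_group by (simp add: group_hom_def group_hom_axioms_def)
      have ff: "f (f y) = f y" if "y \<in> carrier ?H" for y
        by (rule amalgam_hom_eq[OF H.is_group H.is_group spl _ f(1) _ _ that])
          (use Group.hom_compose[OF f(1) f(1)] f in \<open>auto simp: o_def\<close>)
      have "inj_on f (carrier ?H)"
        by (rule retraction_fixing_boundary_inj[OF f(1)]) (use f amalgam(3) ff in auto)
      then have B: "b = \<one>\<^bsub>?H\<^esub>" if "b \<in> B" for b
        using f(3)[OF that] that sub(2) inj_onD[of f "carrier ?H" b "\<one>\<^bsub>?H\<^esub>"] f.hom_one by auto
      show ?thesis
      proof (rule twisted[OF id])
        fix y assume y: "y \<in> carrier ?H"
        show "h' y = h y"
        proof (rule amalgam_hom_eq[OF H.is_group F(1) spl h(2,1) _ _ y])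
          show "h' b = h b" if "b \<in> B" for b using B[OF that] by simp
        qed (use amalgam in auto)
      qed
    next
      case False
      obtain \<zeta> n where \<zeta>: "\<zeta> \<in> carrier ?H" "z = h \<zeta>" "(n::nat) \<ge> 1" "\<zeta> [^]\<^bsub>?H\<^esub> n \<in> C"
        "\<And>c. c \<in> C \<Longrightarrow> \<zeta> \<otimes>\<^bsub>?H\<^esub> c = c \<otimes>\<^bsub>?H\<^esub> \<zeta>"
        using admissible_root[OF F h(1) adm amalgam(4) c(2,1) False amalgam(5)] by blast
      obtain \<tau> where \<tau>: "\<tau> \<in> hom ?H ?H" "bij_betw \<tau> (carrier ?H) (carrier ?H)" "\<And>a. a \<in> A \<Longrightarrow> \<tau> a = a"
        "\<And>b. b \<in> B \<Longrightarrow> \<tau> b = \<zeta> \<otimes>\<^bsub>?H\<^esub> b \<otimes>\<^bsub>?H\<^esub> inv\<^bsub>?H\<^esub> \<zeta>"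
        using H.amalgam_twist[OF ur spl \<zeta>(1) \<zeta>(5,4,3)] by blast
      show ?thesis
      proof (rule twisted[OF \<tau>(1,2)])
        fix y assume y: "y \<in> carrier ?H"
        show "h' y = h (\<tau> y)"
        proof (rule amalgam_hom_eq[OF H.is_group F(1) spl h(2) _ _ _ y])
          show "(\<lambda>y. h (\<tau> y)) \<in> hom ?H F" using Group.hom_compose[OF \<tau>(1) h(1)] by (simp add: o_def)
          show "h' b = h (\<tau> b)" if "b \<in> B" for b
            using that \<tau>(4)[OF that] amalgam(7) \<zeta>(1,2) sub(2) by (simp add: subset_iff)
        qed (use amalgam \<tau> in auto)
      qed
    qed
  next
    case (hnn A C C' \<phi> t z)
    note spl = hnn(1)
    have sub: "A \<subseteq> carrier ?H" "t \<in> carrier ?H" "subgroup A ?H" "C \<subseteq> A"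
      using spl by (auto simp: hnn_splitting_def dest: subgroup.subset)
    obtain c where c: "c \<in> carrier ?H" "C = generate ?H {c}"
      using hnn(2) by (auto simp: cyclic_subgroup_def)
    show ?thesis
    proof (cases "c = \<one>\<^bsub>?H\<^esub>")
      case True
      then have C: "C = {\<one>\<^bsub>?H\<^esub>}" using c(2) H.generate_one by simp
      have "\<phi> \<one>\<^bsub>?H\<^esub> = \<one>\<^bsub>?H\<^esub>"
        using hnn_relation(1)[OF H.is_group spl, of "\<one>\<^bsub>?H\<^esub>"] C sub(2) by simp
      then have "\<exists>f\<in>hom ?H ?H. (\<forall>a\<in>A. f a = a) \<and> f t = \<one>\<^bsub>?H\<^esub>"
        by (intro hnn_extend[OF H.is_group H.is_group spl]) (use sub C in auto)
      then obtain f where f: "f \<in> hom ?H ?H" "\<And>a. a \<in> A \<Longrightarrow> f a = a" "f t = \<one>\<^bsub>?H\<^esub>"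
        by blast
      interpret f: group_hom ?H ?H f using f(1) H.is_group by (simp add: group_hom_def group_hom_axioms_def)
      have ff: "f (f y) = f y" if "y \<in> carrier ?H" for y
        by (rule hnn_hom_eq[OF H.is_group H.is_group spl _ f(1) _ _ that])
          (use Group.hom_compose[OF f(1) f(1)] f in \<open>auto simp: o_def\<close>)
      have "inj_on f (carrier ?H)"
        by (rule retraction_fixing_boundary_inj[OF f(1)]) (use f hnn(4) ff in auto)
      then have t: "t = \<one>\<^bsub>?H\<^esub>"
        using f(3) sub(2) inj_onD[of f "carrier ?H" t "\<one>\<^bsub>?H\<^esub>"] f.hom_one by auto
      show ?thesis
      proof (rule twisted[OF id])
        fix y assume y: "y \<in> carrier ?H"
        show "h' y = h y"
          by (rule hnn_hom_eq[OF H.is_group F(1) spl h(2,1) _ _ y]) (use hnn(7) t in auto)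
      qed
    next
      case False
      obtain \<zeta> n where \<zeta>: "\<zeta> \<in> carrier ?H" "z = h \<zeta>" "(n::nat) \<ge> 1" "\<zeta> [^]\<^bsub>?H\<^esub> n \<in> C"
        "\<And>c. c \<in> C \<Longrightarrow> \<zeta> \<otimes>\<^bsub>?H\<^esub> c = c \<otimes>\<^bsub>?H\<^esub> \<zeta>"
        using admissible_root[OF F h(1) adm hnn(5) c(2,1) False hnn(6)] by blast
      obtain \<tau> where \<tau>: "\<tau> \<in> hom ?H ?H" "bij_betw \<tau> (carrier ?H) (carrier ?H)" "\<And>a. a \<in> A \<Longrightarrow> \<tau> a = a"
        "\<tau> t = \<zeta> \<otimes>\<^bsub>?H\<^esub> t"
        using H.hnn_twist[OF ur spl \<zeta>(1) \<zeta>(5,4,3)] by blast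
      show ?thesis
      proof (rule twisted[OF \<tau>(1,2)])
        fix y assume y: "y \<in> carrier ?H"
        show "h' y = h (\<tau> y)"
        proof (rule hnn_hom_eq[OF H.is_group F(1) spl h(2) _ _ _ y])
          show "(\<lambda>y. h (\<tau> y)) \<in> hom ?H F" using Group.hom_compose[OF \<tau>(1) h(1)] by (simp add: o_def)
          show "h' t = h (\<tau> t)" using \<tau>(4) hnn(8) \<zeta>(1,2) sub(2) by simp
        qed (use hnn \<tau> in auto)
      qed
    qed
  qed
qed

text \<open>The generated equivalence also runs through twists backwards. Since \<open>h'\<close>
  agrees with \<open>h\<close> on \<open>C\<close>, the inverse of \<open>z\<close> centralizes
  \<open>h' C\<close> and its twist undoes the first one.\<close>

lemma frac_twist_sym:
  assumes F: "group F" and h: "h \<in> hom (surf_group g) F" "h' \<in> hom (surf_group g) F"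
    and tw: "frac_twist F g h h'"
  shows "frac_twist F g h' h"
proof -
  let ?H = "surf_group g"
  interpret F: group F by fact
  interpret H: group ?H by (rule group_surf_group)
  interpret h: group_hom ?H F h using h F H.is_group by (simp add: group_hom_def group_hom_axioms_def)
  from tw show ?thesis
  proof (cases rule: frac_twist_cases)
    case (amalgam A B C z)
    have sub: "A \<subseteq> carrier ?H" "B \<subseteq> carrier ?H" "C \<subseteq> A"
      using amalgam(1) by (auto simp: amalgam_splitting_def dest: subgroup.subset)
    have "\<forall>c\<in>C. inv\<^bsub>F\<^esub> z \<otimes>\<^bsub>F\<^esub> h' c = h' c \<otimes>\<^bsub>F\<^esub> inv\<^bsub>F\<^esub> z"
      using amalgam(4-6) sub F.inv_commute[OF amalgam(4)] by (metis h.hom_closed subsetD)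
    moreover have "\<forall>b\<in>B. h b = inv\<^bsub>F\<^esub> z \<otimes>\<^bsub>F\<^esub> h' b \<otimes>\<^bsub>F\<^esub> inv\<^bsub>F\<^esub> (inv\<^bsub>F\<^esub> z)"
      using amalgam(4,7) sub(2) F.conj_cancel(1)[OF amalgam(4)] by (simp add: subset_iff)
    moreover have "\<forall>a\<in>A. h a = h' a" "inv\<^bsub>F\<^esub> z \<in> carrier F" using amalgam(4,6) by simp_all
    ultimately show ?thesis using amalgam(1-3) unfolding frac_twist_def by blast
  next
    case (hnn A C C' \<phi> t z)
    have sub: "A \<subseteq> carrier ?H" "t \<in> carrier ?H" "C \<subseteq> A"
      using hnn(1) by (auto simp: hnn_splitting_def dest: subgroup.subset)
    have "\<forall>c\<in>C. inv\<^bsub>F\<^esub> z \<otimes>\<^bsub>F\<^esub> h' c = h' c \<otimes>\<^bsub>F\<^esub> inv\<^bsub>F\<^esub> z"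
      using hnn(5-7) sub F.inv_commute[OF hnn(5)] by (metis h.hom_closed subsetD)
    moreover have "h t = inv\<^bsub>F\<^esub> z \<otimes>\<^bsub>F\<^esub> h' t"
      using hnn(5,8) sub(2) by (simp add: F.m_assoc[symmetric])
    moreover have "\<forall>a\<in>A. h a = h' a" "inv\<^bsub>F\<^esub> z \<in> carrier F" using hnn(5,7) by simp_all
    ultimately show ?thesis using hnn(1-4) unfolding frac_twist_def by blast
  qed
qed

text \<open>Primitivity concerns the image alone, so each twist passes admissibility on to the next
  representation of the chain.\<close>

lemma twist_equiv_admissible:
  assumes F: "group F" "commuting_powers F" and adm: "admissible F g h" and eq: "(h, h') \<in> twist_equiv F g x"
  shows "h' ` carrier (surf_group g) = h ` carrier (surf_group g) \<and> admissible F g h'"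
proof -
  have "equivclp (\<lambda>k k'. k \<in> genus_reps F g x \<and> k' \<in> genus_reps F g x \<and> frac_twist F g k k') h h'"
    using eq by (simp add: twist_equiv_def)
  then show ?thesis
  proof (induction rule: equivclp_induct)
    case (step k k')
    then have k: "k \<in> hom (surf_group g) F" "k' \<in> hom (surf_group g) F" "admissible F g k"
      and "frac_twist F g k k'"
      using frac_twist_sym[OF F(1)] by (auto simp: genus_reps_def)
    then show ?case using step.IH frac_twist_admissible[OF F k] by (simp add: admissible_def)
  qed (use adm in simp)
qed


section \<open>The upper bounds\<close>

lemma ecard_mono: "A \<subseteq> B \<Longrightarrow> ecard A \<le> ecard B"
  by (auto simp: ecard_def card_mono finite_subset)

lemma ecard_image_le: "ecard (f ` A) \<le> ecard A"
  by (auto simp: ecard_def card_image_le)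

text \<open>Choosing a member of each class and taking its image reaches every subgroup counted by
  \<open>rep_num'\<close>, because all members of the class of an admissible representation share
  their image.\<close>

lemma rep_num'_le_rep_num:
  assumes F: "group F" "commuting_powers F"
  shows "rep_num' F x \<le> rep_num F x"
proof -
  define g where "g = a_genus F x"
  let ?E = "twist_equiv F g x" and ?c = "carrier (surf_group g)"
  let ?K = "{?E `` {h} | h. h \<in> genus_reps F g x \<and> twist_injective F g x h}"
  have "h ` ?c \<in> (\<lambda>c. (SOME k. k \<in> c) ` ?c) ` ?K" if h: "h \<in> genus_reps F g x" "admissible F g h" for h
  proof (rule image_eqI)
    have "h \<in> ?E `` {h}" using equiv_class_self[OF equiv_twist_equiv h(1)] .
    then have "(SOME k. k \<in> ?E `` {h}) \<in> ?E `` {h}"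
      by (rule someI[of "\<lambda>k. k \<in> ?E `` {h}"])
    then show "h ` ?c = (SOME k. k \<in> ?E `` {h}) ` ?c"
      using twist_equiv_admissible[OF F h(2)] by blast
    have "twist_injective F g x h"
      using twist_equiv_admissible[OF F h(2)] by (auto simp: twist_injective_def admissible_def)
    then show "?E `` {h} \<in> ?K" using h(1) by blast
  qed
  then have "{h ` ?c | h. h \<in> genus_reps F g x \<and> admissible F g h} \<subseteq> (\<lambda>c. (SOME k. k \<in> c) ` ?c) ` ?K"
    by blast
  from order_trans[OF ecard_mono[OF this] ecard_image_le] show ?thesis
    unfolding rep_num_def rep_num'_def Let_def g_def[symmetric] .
qed

lemma fhat'_le_fhat:
  assumes "group F" "commuting_powers F"
  shows "fhat' F g \<le> fhat F g"
  unfolding fhat_def fhat'_def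
  by (rule Sup_mono) (use rep_num'_le_rep_num[OF assms] in blast)

lemma fhat_le_solid_bound:
  assumes F: "group F" and N: "solid_bound F g N"
  shows "fhat F g \<le> enat N"
  unfolding fhat_def
proof (rule Sup_least, clarify)
  fix x assume x: "g = a_genus F x"
  let ?E = "twist_equiv F g x"
  let ?K = "{?E `` {h} | h. h \<in> genus_reps F g x \<and> twist_injective F g x h}"
  obtain Q where Q: "\<forall>Lq\<in>Q. proper_quotient g Lq"
    "\<forall>f\<in>hom (surf_group g\<lparr>carrier := boundary_group g\<rparr>) F.
           ecard {twist_equiv F g (f (boundary g)) `` {h} | h.
                    h \<in> extensions F g f \<and>
                    (\<forall>h'\<in>twist_equiv F g (f (boundary g)) `` {h}.
                       \<forall>Lq\<in>Q. \<not> factors_through F g h' Lq)} \<le> enat N"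
    using N unfolding solid_bound_def by blast
  have "ecard ?K \<le> enat N"
  proof (cases "genus_reps F g x = {}")
    case True
    then show ?thesis by (simp add: ecard_def zero_enat_def[symmetric])
  next
    case False
    then obtain f where f: "f \<in> hom (surf_group g) F" "f (boundary g) = x" by (auto simp: genus_reps_def)
    interpret H: group "surf_group g" by (rule group_surf_group)
    have "boundary_group g \<subseteq> carrier (surf_group g)"
      unfolding boundary_group_def by (rule H.generate_incl) (simp add: boundary_in_surf_group)
    then have f': "f \<in> hom (surf_group g\<lparr>carrier := boundary_group g\<rparr>) F"
      using f(1) by (auto simp: hom_def Pi_iff subset_iff)
    have ext: "extensions F g f = genus_reps F g x"
      using extensions_eq_genus_reps[OF F f'] f(2) by simp
    have "\<not> factors_through F g h Lq" if "inj_on h (carrier (surf_group g))" "Lq \<in> Q" for h Lq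
    proof
      assume "factors_through F g h Lq"
      then obtain k where k: "\<forall>w\<in>carrier (surf_group g). h w = k (snd Lq w)"
        unfolding factors_through_def by blast
      have "inj_on (snd Lq) (carrier (surf_group g))"
        using that(1) k unfolding inj_on_def by metis
      then show False using Q(1) that(2) by (auto simp: proper_quotient_def)
    qed
    then have "?K \<subseteq> {?E `` {h} | h. h \<in> extensions F g f \<and>
        (\<forall>h'\<in>?E `` {h}. \<forall>Lq\<in>Q. \<not> factors_through F g h' Lq)}"
      unfolding ext twist_injective_def by blast
    from order_trans[OF ecard_mono[OF this]] show ?thesis using bspec[OF Q(2) f'] f(2) by simp
  qed
  then show "rep_num F x \<le> enat N" unfolding rep_num_def Let_def x[symmetric] .
qed


section \<open>A family of subgroups sharing a boundary word\<close>

text \<open>Unlike \<open>word_eval\<close>, this mentions no group: one map serves all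
  \<open>g\<close>, and concrete words are evaluated by rewriting.\<close>

definition subst_word :: "('x \<Rightarrow> 'y word) \<Rightarrow> 'x word \<Rightarrow> 'y word" where
  "subst_word e w = foldr (\<lambda>l. foldr red_cons (if snd l then e (fst l) else winv (e (fst l)))) w []"

lemma word_eval_free_group:
  assumes "e \<in> X \<rightarrow> carrier (free_group Y)" "fst ` set w \<subseteq> X"
  shows "word_eval (free_group Y) e w = subst_word e w"
  using assms(2)
proof (induction w)
  case (Cons l w)
  have "e (fst l) \<in> carrier (free_group Y)" using funcset_mem[OF assms(1), of "fst l"] Cons.prems by simp
  then show ?case using Cons by (simp add: subst_word_def inv_free_group)
qed (simp add: subst_word_def)

lemma subst_word_hom:
  assumes "e \<in> X \<rightarrow> carrier (free_group Y)"
  shows "subst_word e \<in> hom (free_group X) (free_group Y)"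
proof -
  have "word_eval (free_group Y) e \<in> hom (free_group X) (free_group Y)"
    by (rule word_eval_hom[OF group_free_group assms])
  moreover have "word_eval (free_group Y) e w = subst_word e w" if "w \<in> carrier (free_group X)" for w
    using word_eval_free_group[OF assms] that by simp
  ultimately show ?thesis
    using group.is_monoid[OF group_free_group, THEN monoid.m_closed, of _ X]
    by (simp add: hom_def Pi_iff del: free_group_simps)
qed

lemma subst_word_letter: "reduced (e x) \<Longrightarrow> subst_word e (letter x) = e x"
  by (simp add: subst_word_def letter_def foldr_reduced_Nil)

text \<open>
  In the free group on \<open>p, q\<close> the commutator of \<open>p U p\<inverse>\<close> and \<open>p\<inverse>\<close>, where \<open>U = q p q\<inverse> p q\<close>, is
  inverted by the involution \<open>p \<mapsto> q p q\<inverse>, q \<mapsto> q\<inverse>\<close>. Hence \<open>\<langle>p, U\<rangle>\<close> and its image under the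
  involution are two subgroups with this element as boundary word. \<open>twist_gens \<epsilon>\<close> applies the
  involution in the handles of \<open>\<epsilon>\<close>, and \<open>swap_gens \<epsilon>\<close> restores the orientation there.
\<close>

fun base_gens :: "surface_gen \<Rightarrow> surface_word" where
  "base_gens (GenA i) =
     [(GenA i, True), (GenB i, True), (GenA i, True), (GenB i, False), (GenA i, True), (GenB i, True), (GenA i, False)]"
| "base_gens (GenB i) = [(GenA i, False)]"

fun twist_gens :: "nat set \<Rightarrow> surface_gen \<Rightarrow> surface_word" where
  "twist_gens \<epsilon> (GenA i) = (if i \<in> \<epsilon> then [(GenB i, True), (GenA i, True), (GenB i, False)] else letter (GenA i))"
| "twist_gens \<epsilon> (GenB i) = [(GenB i, i \<notin> \<epsilon>)]"

fun swap_gens :: "nat set \<Rightarrow> surface_gen \<Rightarrow> surface_word" where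
  "swap_gens \<epsilon> (GenA i) = letter (if i \<in> \<epsilon> then GenB i else GenA i)"
| "swap_gens \<epsilon> (GenB i) = letter (if i \<in> \<epsilon> then GenA i else GenB i)"

text \<open>On the abelianization \<open>base_gens\<close> is p to 2p + q and q to -p, and
  \<open>co_gens\<close> is its inverse there. The composite is thus covered by the injectivity
  criterion, and its linear Magnus coefficients are standard.\<close>

fun co_gens :: "surface_gen \<Rightarrow> surface_word" where
  "co_gens (GenA i) = [(GenB i, False)]"
| "co_gens (GenB i) = [(GenA i, True), (GenB i, True), (GenB i, True)]"

definition twisted_rep :: "nat set \<Rightarrow> surface_word \<Rightarrow> surface_word" where
  "twisted_rep \<epsilon> w = subst_word (twist_gens \<epsilon>) (subst_word base_gens (subst_word (swap_gens \<epsilon>) w))"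

lemma gens_closed:
  "base_gens \<in> surf_gens g \<rightarrow> carrier (surf_group g)"
  "twist_gens \<epsilon> \<in> surf_gens g \<rightarrow> carrier (surf_group g)"
  "swap_gens \<epsilon> \<in> surf_gens g \<rightarrow> carrier (surf_group g)"
  "co_gens \<in> surf_gens g \<rightarrow> carrier (surf_group g)"
  by (auto simp: surf_group_def surf_gens_def letter_def reduced_Cons flip_def)

lemmas gens_homs =
  gens_closed(1)[unfolded surf_group_eq, THEN subst_word_hom, folded surf_group_eq]
  gens_closed(2)[unfolded surf_group_eq, THEN subst_word_hom, folded surf_group_eq]
  gens_closed(3)[unfolded surf_group_eq, THEN subst_word_hom, folded surf_group_eq]
  gens_closed(4)[unfolded surf_group_eq, THEN subst_word_hom, folded surf_group_eq]

lemma surf_letter: "x \<in> surf_gens g \<Longrightarrow> letter x \<in> carrier (surf_group g)"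
  unfolding surf_group_eq by (rule letter_in_free_group)

lemma surf_hom_eqI:
  assumes "group K" "f \<in> hom (surf_group g) K" "f' \<in> hom (surf_group g) K"
    and "\<And>x. x \<in> surf_gens g \<Longrightarrow> f (letter x) = f' (letter x)" and w: "w \<in> carrier (surf_group g)"
  shows "f w = f' w"
  using free_group_hom_eq[OF assms(1), of f "surf_gens g" w] free_group_hom_eq[OF assms(1), of f' "surf_gens g" w]
    word_eval_cong[of w "\<lambda>x. f (letter x)" "\<lambda>x. f' (letter x)" K] assms
  by (auto simp: surf_group_eq)

lemma id_hom: "(\<lambda>w. w) \<in> hom G G"
  by (simp add: hom_def)

lemma comp_hom: "f \<in> hom G H \<Longrightarrow> f' \<in> hom H K \<Longrightarrow> (\<lambda>w. f' (f w)) \<in> hom G K"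
  using Group.hom_compose[of f G H f' K] by (simp add: o_def)

lemma subst_letter_simps [simp]:
  "subst_word base_gens (letter x) = base_gens x"
  "subst_word (twist_gens \<epsilon>) (letter x) = twist_gens \<epsilon> x"
  "subst_word (swap_gens \<epsilon>) (letter x) = swap_gens \<epsilon> x"
  "subst_word co_gens (letter x) = co_gens x"
proof -
  have "reduced (base_gens x) \<and> reduced (twist_gens \<epsilon> x) \<and> reduced (swap_gens \<epsilon> x) \<and> reduced (co_gens x)"
    by (cases x) (simp_all add: letter_def reduced_Cons flip_def)
  then show "subst_word base_gens (letter x) = base_gens x"
    "subst_word (twist_gens \<epsilon>) (letter x) = twist_gens \<epsilon> x"
    "subst_word (swap_gens \<epsilon>) (letter x) = swap_gens \<epsilon> x"
    "subst_word co_gens (letter x) = co_gens x"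
    by (simp_all add: subst_word_letter)
qed

lemma twist_twist:
  assumes "w \<in> carrier (surf_group g)"
  shows "subst_word (twist_gens \<epsilon>) (subst_word (twist_gens \<epsilon>) w) = w"
proof (rule surf_hom_eqI[OF group_surf_group comp_hom[OF gens_homs(2,2)] id_hom _ assms])
  fix x show "subst_word (twist_gens \<epsilon>) (subst_word (twist_gens \<epsilon>) (letter x)) = letter x"
    by (cases x) (auto simp: subst_word_def letter_def flip_def)
qed

lemma swap_swap:
  assumes "w \<in> carrier (surf_group g)"
  shows "subst_word (swap_gens \<epsilon>) (subst_word (swap_gens \<epsilon>) w) = w"
proof (rule surf_hom_eqI[OF group_surf_group comp_hom[OF gens_homs(3,3)] id_hom _ assms])
  fix x show "subst_word (swap_gens \<epsilon>) (subst_word (swap_gens \<epsilon>) (letter x)) = letter x"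
    by (cases x) (auto simp: subst_word_def letter_def flip_def)
qed

lemma twisted_rep_hom: "twisted_rep \<epsilon> \<in> hom (surf_group g) (surf_group g)"
  using comp_hom[OF comp_hom[OF gens_homs(3,1)] gens_homs(2)] by (simp add: twisted_rep_def[abs_def])

lemma co_base_abelianization:
  "magnus (subst_word co_gens (subst_word base_gens (letter x))) [y] = (if x = y then 1 else 0)"
  by (cases x) (auto simp: subst_word_def letter_def flip_def magnus_Cons)

lemma base_inj: "inj_on (subst_word base_gens) (carrier (surf_group g))"
proof -
  have "inj_on (\<lambda>w. subst_word co_gens (subst_word base_gens w)) (carrier (surf_group g))"
    unfolding surf_group_eq
    by (rule inj_if_id_on_abelianization[OF finite_surf_gens
          comp_hom[OF gens_homs(1,4), unfolded surf_group_eq] co_base_abelianization])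
  then show ?thesis by (auto simp: inj_on_def)
qed

lemma twisted_rep_inj: "inj_on (twisted_rep \<epsilon>) (carrier (surf_group g))"
proof (rule inj_onI)
  let ?T = "surf_group g"
  fix u v assume uv: "u \<in> carrier ?T" "v \<in> carrier ?T" "twisted_rep \<epsilon> u = twisted_rep \<epsilon> v"
  note cl = hom_in_carrier[OF gens_homs(1)] hom_in_carrier[OF gens_homs(3)]
  let ?s = "subst_word (swap_gens \<epsilon>)"
  have "subst_word base_gens (?s u) = subst_word base_gens (?s v)"
    using arg_cong[OF uv(3)[unfolded twisted_rep_def], of "subst_word (twist_gens \<epsilon>)"]
      twist_twist[OF cl(1)[OF cl(2)]] uv(1,2) by simp
  then have "?s u = ?s v" using inj_onD[OF base_inj _ cl(2)[OF uv(1)] cl(2)[OF uv(2)]] by blast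
  from arg_cong[OF this, of ?s] show "u = v" using swap_swap uv(1,2) by simp
qed

text \<open>In a handle of \<open>\<epsilon>\<close>, exchanging the two generators inverts the
  commutator, and the involution inverts it once more.\<close>

lemma twisted_rep_boundary: "twisted_rep \<epsilon> (boundary g) = subst_word base_gens (boundary g)"
proof -
  let ?T = "surf_group g"
  have "commutator ?T (twisted_rep \<epsilon> (letter (GenA i))) (twisted_rep \<epsilon> (letter (GenB i))) =
      commutator ?T (subst_word base_gens (letter (GenA i))) (subst_word base_gens (letter (GenB i)))"
    if "i \<in> {1..g}" for i
  proof -
    have c: "commutator ?T u v = foldr red_cons (foldr red_cons (foldr red_cons u v) (winv u)) (winv v)"
      if "u \<in> carrier ?T" "v \<in> carrier ?T" for u v
      using that inv_free_group[of u "surf_gens g"] inv_free_group[of v "surf_gens g"]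
      by (simp add: commutator_def surf_group_eq)
    note l = letter_in_surf_group[OF that, THEN conjunct1] letter_in_surf_group[OF that, THEN conjunct2]
    show ?thesis
      unfolding c[OF hom_in_carrier[OF twisted_rep_hom l(1)] hom_in_carrier[OF twisted_rep_hom l(2)]]
        c[OF hom_in_carrier[OF gens_homs(1) l(1)] hom_in_carrier[OF gens_homs(1) l(2)]]
      by (auto simp: twisted_rep_def subst_word_def letter_def flip_def)
  qed
  then show ?thesis
    unfolding hom_boundary[OF group_surf_group twisted_rep_hom] hom_boundary[OF group_surf_group gens_homs(1)]
    by (intro foldr_cong) auto
qed

text \<open>
  The folded graph of the subgroup \<open>\<langle>p, U\<rangle>\<close>, one copy for each handle, joined at \<open>V0\<close>.
\<close>

datatype vertex = V0 | V1 nat | V2 nat | V3 nat | V4 nat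

fun step :: "surface_gen \<times> bool \<Rightarrow> vertex \<Rightarrow> vertex option" where
  "step (GenA i, True) V0 = Some V0"
| "step (GenA i, True) (V1 j) = (if i = j then Some (V2 i) else None)"
| "step (GenA i, True) (V2 j) = None"
| "step (GenA i, True) (V3 j) = (if i = j then Some (V4 i) else None)"
| "step (GenA i, True) (V4 j) = None"
| "step (GenA i, False) V0 = Some V0"
| "step (GenA i, False) (V1 j) = None"
| "step (GenA i, False) (V2 j) = (if i = j then Some (V1 i) else None)"
| "step (GenA i, False) (V3 j) = None"
| "step (GenA i, False) (V4 j) = (if i = j then Some (V3 i) else None)"
| "step (GenB i, True) V0 = Some (V1 i)"
| "step (GenB i, True) (V1 j) = None"
| "step (GenB i, True) (V2 j) = None"
| "step (GenB i, True) (V3 j) = (if i = j then Some (V2 i) else None)"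
| "step (GenB i, True) (V4 j) = (if i = j then Some V0 else None)"
| "step (GenB i, False) V0 = Some (V4 i)"
| "step (GenB i, False) (V1 j) = (if i = j then Some V0 else None)"
| "step (GenB i, False) (V2 j) = (if i = j then Some (V3 i) else None)"
| "step (GenB i, False) (V3 j) = None"
| "step (GenB i, False) (V4 j) = None"

lemma letter_cases:
  obtains (AT) i where "l = (GenA i, True)" | (AF) i where "l = (GenA i, False)"
    | (BT) i where "l = (GenB i, True)" | (BF) i where "l = (GenB i, False)"
  by (metis (full_types) surface_gen.exhaust surj_pair)

section \<open>Reading words in the folded graph\<close>

lemma step_flip: "step l v = Some v' \<Longrightarrow> step (flip l) v' = Some v"
  by (cases l rule: letter_cases; cases v) (auto simp: flip_def split: if_splits)

fun path :: "surface_word \<Rightarrow> vertex \<Rightarrow> vertex option" where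
  "path [] v = Some v"
| "path (l # w) v = Option.bind (step l v) (path w)"

lemma path_append: "path (u @ w) v = Option.bind (path u v) (path w)"
  by (induction u arbitrary: v) (auto split: bind_splits)

lemma path_winv: "path w v = Some v' \<Longrightarrow> path (winv w) v' = Some v"
  by (induction w arbitrary: v) (auto simp: path_append step_flip split: bind_splits)

lemma path_red_cons: "path (l # w) v = Some v' \<Longrightarrow> path (red_cons l w) v = Some v'"
proof (cases w)
  case (Cons m w')
  assume p: "path (l # w) v = Some v'"
  show ?thesis
  proof (cases "m = flip l")
    case True
    then show ?thesis using p Cons step_flip[of l v]
      by (auto simp: red_cons_Cons split: bind_splits simp del: red_cons.simps(2))
  qed (use p Cons in \<open>simp add: red_cons_Cons del: red_cons.simps(2)\<close>)
qed simp

lemma path_mult: "path u v = Some v1 \<Longrightarrow> path w v1 = Some v2 \<Longrightarrow> path (foldr red_cons u w) v = Some v2"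
proof (induction u arbitrary: v)
  case (Cons l u)
  then obtain v' where "step l v = Some v'" "path u v' = Some v1" by (auto split: bind_splits)
  with Cons show ?case using path_red_cons[of l "foldr red_cons u w" v v2] by simp
qed simp

lemma path_base: "path (subst_word base_gens w) V0 = Some V0"
proof (induction w)
  case (Cons l w)
  have p: "path (base_gens x) V0 = Some V0" for x by (cases x) auto
  have "path (if snd l then base_gens (fst l) else winv (base_gens (fst l))) V0 = Some V0"
    using p path_winv[OF p] by simp
  from path_mult[OF this Cons] show ?case by (simp add: subst_word_def)
qed (simp add: subst_word_def)

abbreviation base_subgroup :: "nat \<Rightarrow> surface_word set" where
  "base_subgroup g \<equiv> subst_word base_gens ` carrier (surf_group g)"

lemma base_subgroup: "subgroup (base_subgroup g) (surf_group g)"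
proof -
  interpret group_hom "surf_group g" "surf_group g" "subst_word base_gens"
    using gens_homs(1) by (simp add: group_hom_def group_hom_axioms_def group_surf_group)
  show ?thesis by (rule img_is_subgroup)
qed

text \<open>Labels of the paths from \<open>V0\<close> in a spanning tree; they serve as Schreier
  representatives of the vertices.\<close>

fun to_vertex :: "vertex \<Rightarrow> surface_word" where
  "to_vertex V0 = []"
| "to_vertex (V1 i) = [(GenB i, True)]"
| "to_vertex (V2 i) = [(GenB i, True), (GenA i, True)]"
| "to_vertex (V3 i) = [(GenB i, True), (GenA i, True), (GenB i, False)]"
| "to_vertex (V4 i) = [(GenB i, True), (GenA i, True), (GenB i, False), (GenA i, True)]"

lemma base_subgroup_generators:
  assumes "i \<in> {1..g}"
  shows "[(GenA i, True)] \<in> base_subgroup g"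
    and "[(GenB i, True), (GenA i, True), (GenB i, False), (GenA i, True), (GenB i, True)] \<in> base_subgroup g"
proof -
  let ?T = "surf_group g"
  interpret R: subgroup "base_subgroup g" ?T by (rule base_subgroup)
  interpret T: group ?T by (rule group_surf_group)
  have l: "letter (GenA i) \<in> carrier ?T" "letter (GenB i) \<in> carrier ?T"
    using letter_in_surf_group[OF assms] by auto
  have P: "[(GenA i, False)] \<in> base_subgroup g"
    using imageI[OF l(2), of "subst_word base_gens"] by simp
  have c: "[(GenA i, False)] \<in> carrier (free_group (surf_gens g))"
    using R.subset P unfolding surf_group_eq by blast
  have "inv\<^bsub>?T\<^esub> [(GenA i, False)] \<in> base_subgroup g" by (rule R.m_inv_closed[OF P])
  then show A: "[(GenA i, True)] \<in> base_subgroup g"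
    using inv_free_group[OF c] by (simp add: surf_group_eq flip_def)
  have "base_gens (GenA i) \<in> base_subgroup g"
    using imageI[OF l(1), of "subst_word base_gens"] by simp
  from R.m_closed[OF R.m_closed[OF P this] A]
  show "[(GenB i, True), (GenA i, True), (GenB i, False), (GenA i, True), (GenB i, True)] \<in> base_subgroup g"
    by (simp add: surf_group_eq)
qed

lemma to_vertex_closed:
  assumes "step l v = Some v'" "fst l \<in> surf_gens g"
  shows "to_vertex v' \<in> carrier (surf_group g)" "to_vertex v \<in> carrier (surf_group g)"
  using assms
  by (cases l rule: letter_cases; cases v;
      force simp: surf_group_def surf_gens_def reduced_Cons flip_def split: if_splits)+

text \<open>Along the spanning tree this Schreier generator is trivial. Each handle has two further
  edges, the loop at \<open>V0\<close> and the edge from \<open>V4\<close> back to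
  \<open>V0\<close>, which give p and U; reversed edges give inverses.\<close>

lemma step_in_base_subgroup:
  assumes l: "step l v = Some v'" "fst l \<in> surf_gens g"
  shows "to_vertex v \<otimes>\<^bsub>surf_group g\<^esub> [l] \<otimes>\<^bsub>surf_group g\<^esub> inv\<^bsub>surf_group g\<^esub> to_vertex v' \<in> base_subgroup g"
proof -
  let ?T = "surf_group g"
  interpret R: subgroup "base_subgroup g" ?T by (rule base_subgroup)
  interpret T: group ?T by (rule group_surf_group)
  have one: "[] \<in> base_subgroup g" using R.one_closed by (simp add: surf_group_eq)
  have pos: "to_vertex v \<otimes>\<^bsub>?T\<^esub> [l] \<otimes>\<^bsub>?T\<^esub> inv\<^bsub>?T\<^esub> to_vertex v' \<in> base_subgroup g"
    if l: "step l v = Some v'" "fst l \<in> surf_gens g" "snd l" for l v v'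
  proof -
    have c: "to_vertex v' \<in> carrier (free_group (surf_gens g))"
      using to_vertex_closed[OF l(1,2)] unfolding surf_group_eq by blast
    show ?thesis
      unfolding surf_group_eq[of g] inv_free_group[OF c] free_group_simps(2)
      using l one base_subgroup_generators[of _ g]
      by (cases l rule: letter_cases; cases v)
        (auto simp: surf_gens_def surf_group_eq flip_def split: if_splits)
  qed
  show ?thesis
  proof (cases "snd l")
    case False
    note p = pos[OF step_flip[OF l(1)]]
    have fl: "fst (flip l) \<in> surf_gens g" "snd (flip l)" using l(2) False by (simp_all add: flip_def)
    have lc: "[l] \<in> carrier ?T" using l(2) by (simp add: surf_group_eq reduced_Cons)
    have inv_l: "inv\<^bsub>?T\<^esub> [l] = [flip l]"
      using inv_free_group[of "[l]" "surf_gens g"] lc by (simp add: surf_group_eq)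
    have "inv\<^bsub>?T\<^esub> (to_vertex v' \<otimes>\<^bsub>?T\<^esub> [flip l] \<otimes>\<^bsub>?T\<^esub> inv\<^bsub>?T\<^esub> to_vertex v) =
        to_vertex v \<otimes>\<^bsub>?T\<^esub> [l] \<otimes>\<^bsub>?T\<^esub> inv\<^bsub>?T\<^esub> to_vertex v'"
      using to_vertex_closed[OF l] lc by (simp add: inv_l[symmetric] T.inv_mult_group T.m_assoc)
    then show ?thesis using R.m_inv_closed[OF p[OF fl]] by simp
  qed (use pos l in blast)
qed

text \<open>The Schreier generators of consecutive edges telescope.\<close>

lemma path_in_base_subgroup:
  assumes "reduced w" "fst ` set w \<subseteq> surf_gens g" "to_vertex v \<in> carrier (surf_group g)" "path w v = Some v'"
  shows "to_vertex v \<otimes>\<^bsub>surf_group g\<^esub> w \<otimes>\<^bsub>surf_group g\<^esub> inv\<^bsub>surf_group g\<^esub> to_vertex v' \<in> base_subgroup g"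
  using assms
proof (induction w arbitrary: v)
  case Nil
  let ?T = "surf_group g"
  interpret T: group ?T by (rule group_surf_group)
  interpret R: subgroup "base_subgroup g" ?T by (rule base_subgroup)
  have one: "\<one>\<^bsub>?T\<^esub> = []" by (simp add: surf_group_eq)
  have "to_vertex v \<otimes>\<^bsub>?T\<^esub> \<one>\<^bsub>?T\<^esub> \<otimes>\<^bsub>?T\<^esub> inv\<^bsub>?T\<^esub> to_vertex v = \<one>\<^bsub>?T\<^esub>"
    using Nil.prems(3) by simp
  then show ?case using Nil.prems(4) R.one_closed unfolding one by simp
next
  case (Cons l w)
  let ?T = "surf_group g"
  interpret T: group ?T by (rule group_surf_group)
  interpret R: subgroup "base_subgroup g" ?T by (rule base_subgroup)
  obtain u where u: "step l v = Some u" "path w u = Some v'"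
    using Cons.prems(4) by (auto split: bind_splits)
  have l: "fst l \<in> surf_gens g" using Cons.prems(2) by simp
  have w: "w \<in> carrier ?T" "[l] \<in> carrier ?T"
    using Cons.prems(1,2) by (auto simp: surf_group_eq reduced_Cons)
  have lw: "l # w = [l] \<otimes>\<^bsub>?T\<^esub> w"
    using red_cons_reduced[OF Cons.prems(1)] by (simp add: surf_group_eq)
  have v': "to_vertex v' \<in> carrier ?T"
    using Cons.prems(2) u(2) to_vertex_closed(1)[OF u(1) l]
  proof (induction w arbitrary: u)
    case (Cons m w)
    then obtain y where "step m u = Some y" "path w y = Some v'" by (auto split: bind_splits)
    then show ?case using Cons.IH[of y] Cons.prems to_vertex_closed(1)[of m u y g] by auto
  qed simp
  have "to_vertex u \<otimes>\<^bsub>?T\<^esub> w \<otimes>\<^bsub>?T\<^esub> inv\<^bsub>?T\<^esub> to_vertex v' \<in> base_subgroup g"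
    using Cons.prems u to_vertex_closed(1)[OF u(1) l] by (intro Cons.IH) (auto simp: reduced_Cons)
  from R.m_closed[OF step_in_base_subgroup[OF u(1) l] this]
  show ?case
    using to_vertex_closed[OF u(1) l] w v' by (simp add: lw T.m_assoc) (simp add: T.m_assoc[symmetric])
qed

lemma in_base_subgroup_iff:
  "w \<in> base_subgroup g \<longleftrightarrow> w \<in> carrier (surf_group g) \<and> path w V0 = Some V0"
proof
  assume "w \<in> base_subgroup g"
  then show "w \<in> carrier (surf_group g) \<and> path w V0 = Some V0"
    using subgroup.subset[OF base_subgroup] path_base by blast
next
  interpret T: group "surf_group g" by (rule group_surf_group)
  assume w: "w \<in> carrier (surf_group g) \<and> path w V0 = Some V0"
  have one: "to_vertex V0 = \<one>\<^bsub>surf_group g\<^esub>" by (simp add: surf_group_eq)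
  have red: "reduced w" "fst ` set w \<subseteq> surf_gens g" using w by (simp_all add: surf_group_eq)
  have "to_vertex V0 \<in> carrier (surf_group g)" unfolding one by (rule T.one_closed)
  from path_in_base_subgroup[OF red this conjunct2[OF w]]
  show "w \<in> base_subgroup g" unfolding one using w by (simp del: to_vertex.simps)
qed

text \<open>
  Reading one word simultaneously from two distinct vertices is a walk in the graph of pairs,
  which is a forest: every pair has at most one neighbour of smaller \<open>depth\<close>, reached by the
  letter \<open>descent\<close> (a dummy letter if there is no such neighbour).
\<close>

fun depth :: "vertex \<Rightarrow> vertex \<Rightarrow> nat" where
  "depth V0 (V3 i) = 1"
| "depth (V3 i) V0 = 1"
| "depth (V2 i) (V4 j) = 1"
| "depth (V4 j) (V2 i) = 1"
| "depth V0 (V4 i) = 2"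
| "depth (V4 i) V0 = 2"
| "depth V0 (V1 i) = 3"
| "depth (V1 i) V0 = 3"
| "depth V0 (V2 i) = 4"
| "depth (V2 i) V0 = 4"
| "depth (V3 i) (V4 j) = 5"
| "depth (V4 j) (V3 i) = 5"
| "depth _ _ = 0"

fun descent :: "vertex \<Rightarrow> vertex \<Rightarrow> surface_gen \<times> bool" where
  "descent V0 (V3 i) = (GenB i, True)"
| "descent (V3 i) V0 = (GenB i, True)"
| "descent (V2 i) (V4 j) = (GenA i, False)"
| "descent (V4 j) (V2 i) = (GenA i, False)"
| "descent V0 (V4 i) = (GenA i, False)"
| "descent (V4 i) V0 = (GenA i, False)"
| "descent V0 (V1 i) = (GenB i, False)"
| "descent (V1 i) V0 = (GenB i, False)"
| "descent V0 (V2 i) = (GenA i, False)"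
| "descent (V2 i) V0 = (GenA i, False)"
| "descent (V3 i) (V4 j) = (GenB i, True)"
| "descent (V4 j) (V3 i) = (GenB i, True)"
| "descent _ _ = (GenA 0, True)"

lemma depth_step:
  assumes "v \<noteq> v'" "step l v = Some u" "step l v' = Some u'"
  shows "depth u u' \<noteq> depth v v' \<and> (depth u u' < depth v v' \<longrightarrow> l = descent v v')"
  using assms
  by (cases l rule: letter_cases; cases v; cases v') (auto split: if_splits)

lemma depth_step_ne:
  "v \<noteq> v' \<Longrightarrow> step l v = Some u \<Longrightarrow> step l v' = Some u' \<Longrightarrow> depth u u' \<noteq> depth v v'"
  using depth_step by blast

lemma depth_lower_unique:
  assumes "v \<noteq> v'" "step l v = Some u" "step l v' = Some u'" "depth u u' < depth v v'"
    and "step m v = Some y" "step m v' = Some y'" "depth y y' < depth v v'"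
  shows "l = m"
  using depth_step[OF assms(1-3)] depth_step[OF assms(1,5,6)] assms(4,7) by simp

text \<open>After an upward step the only descent is the letter just read, backwards, and a reduced
  word cannot take it. So the walk keeps rising.\<close>

lemma depth_path:
  assumes "reduced (l # w)" "v \<noteq> v'" "step l v = Some u" "step l v' = Some u'" "depth v v' < depth u u'"
    and "path w u = Some x" "path w u' = Some x'"
  shows "depth u u' \<le> depth x x'"
  using assms
proof (induction w arbitrary: l v v' u u')
  case (Cons m w)
  then obtain y y' where y: "step m u = Some y" "step m u' = Some y'" "path w y = Some x" "path w y' = Some x'"
    by (auto split: bind_splits)
  have ne: "u \<noteq> u'" using step_flip[OF Cons.prems(3)] step_flip[OF Cons.prems(4)] Cons.prems(2) by auto
  have "\<not> depth y y' < depth u u'"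
    using depth_lower_unique[OF ne y(1,2) _ step_flip[OF Cons.prems(3)] step_flip[OF Cons.prems(4)] Cons.prems(5)]
      Cons.prems(1) by (auto simp: reduced_Cons)
  moreover have "depth y y' \<noteq> depth u u'" by (rule depth_step_ne[OF ne y(1,2)])
  ultimately have up: "depth u u' < depth y y'" by simp
  have "reduced (m # w)" using Cons.prems(1) by (simp add: reduced_Cons[of l])
  from Cons.IH[OF this ne y(1,2) up y(3,4)] up show ?case by simp
qed simp

text \<open>A walk that starts upwards never returns. If the first step goes down, the inverse walk
  from the pair reached by that step starts upwards; it is reduced because \<open>d\<close> is
  cyclically reduced.\<close>

lemma no_closed_pair_walk:
  assumes "d \<noteq> []" "reduced (d @ d)" "path d v = Some v" "path d v' = Some v'"
  shows "v = v'"
proof (rule ccontr)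
  assume ne: "v \<noteq> v'"
  obtain l w where d: "d = l # w" using assms(1) by (cases d) auto
  obtain u u' where u: "step l v = Some u" "step l v' = Some u'" "path w u = Some v" "path w u' = Some v'"
    using assms(3,4) d by (auto split: bind_splits)
  have ne': "u \<noteq> u'" using step_flip[OF u(1)] step_flip[OF u(2)] ne by auto
  have r: "reduced (l # w)" using assms(2) d by (simp only: reduced_append)
  have "reduced (w @ [l])" using assms(2) d by (auto simp: reduced_append reduced_Cons)
  then have "reduced (winv (w @ [l]))" by (simp only: reduced_winv)
  then have r': "reduced (flip l # winv w)" by simp
  consider "depth v v' < depth u u'" | "depth u u' < depth v v'"
    using depth_step_ne[OF ne u(1,2)] by linarith
  then show False
  proof cases
    case 1
    then show False using depth_path[OF r ne u(1,2) 1 u(3,4)] by simp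
  next
    case 2
    then show False
      using depth_path[OF r' ne' step_flip[OF u(1)] step_flip[OF u(2)] 2 path_winv[OF u(3)] path_winv[OF u(4)]]
      by simp
  qed
qed

section \<open>Cyclically reduced words and primitivity\<close>

lemma cyclic_reduction:
  assumes "reduced t" "t \<noteq> []"
  shows "\<exists>c d. t = c @ d @ winv c \<and> d \<noteq> [] \<and> reduced (d @ d)"
  using assms
proof (induction "length t" arbitrary: t rule: less_induct)
  case less
  show ?case
  proof (cases "hd t = flip (last t)")
    case False
    then have "reduced (t @ t)" using less.prems by (simp add: reduced_append)
    then show ?thesis using less.prems by (intro exI[of _ "[]"] exI[of _ t]) simp
  next
    case True
    then obtain t' where t: "t = hd t # t' @ [flip (hd t)]"
      using ends_conj[OF less.prems(2), of "hd t"] by (metis flip_flip)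
    obtain a where a: "t = a # t' @ [flip a]" using t by blast
    have "t' \<noteq> []" using less.prems(1) a by (auto simp: reduced_Cons)
    moreover have "reduced t'" using less.prems(1) a by (simp add: reduced_Cons reduced_append)
    ultimately obtain c d where "t' = c @ d @ winv c" "d \<noteq> []" "reduced (d @ d)"
      using less.hyps[of t'] a by auto
    then show ?thesis using a by (intro exI[of _ "a # c"] exI[of _ d]) simp
  qed
qed

lemma reduced_powers:
  assumes "d \<noteq> []" "reduced (d @ d)" "reduced (c @ d @ c')"
  shows "reduced (c @ concat (replicate (Suc n) d) @ c')"
proof -
  have "reduced (concat (replicate (Suc n) d) @ c') \<and> hd (concat (replicate (Suc n) d) @ c') = hd d"
  proof (induction n)
    case 0
    then show ?case using assms by (simp add: reduced_append)
  next
    case (Suc n)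
    then show ?case using assms(1,2) by (auto simp: reduced_append)
  qed
  then show ?thesis using assms(1,3) by (auto simp: reduced_append)
qed

lemma conj_pow:
  assumes "d \<noteq> []" "reduced (d @ d)" "c @ d @ winv c \<in> carrier (free_group X)"
  shows "(c @ d @ winv c) [^]\<^bsub>free_group X\<^esub> Suc n = c @ concat (replicate (Suc n) d) @ winv c"
proof -
  have r: "reduced (c @ concat (replicate (Suc n) d) @ winv c)" for n
    using reduced_powers[OF assms(1,2), of c "winv c"] assms(3) by simp
  show ?thesis
    unfolding free_group_pow[OF assms(3)]
  proof (induction n)
    case 0
    then show ?case using assms(3) foldr_reduced_Nil[of "c @ d @ winv c"] by simp
  next
    case (Suc n)
    let ?D = "concat (replicate (Suc n) d) @ winv c"
    have rD: "reduced ?D" "reduced (c @ ?D)" using r[of n] by (simp_all add: reduced_append)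
    have "foldr red_cons (winv c) (c @ ?D) = ?D"
      using foldr_inverse[OF rD(1), of c] foldr_red_cons_append[OF rD(2)] by (simp add: winv_def)
    moreover have "foldr red_cons (c @ d) ?D = (c @ d) @ ?D"
      by (rule foldr_red_cons_append) (use r[of "Suc n"] in simp)
    ultimately have "foldr red_cons (c @ d @ winv c) (c @ ?D) = (c @ d) @ ?D" by simp
    then show ?case using Suc by simp
  qed
qed

text \<open>Write t as a conjugate by \<open>c\<close> of a cyclically reduced \<open>d\<close>, and
  let \<open>c\<close> lead from \<open>V0\<close> to \<open>v\<close> and \<open>d\<close> from
  \<open>v\<close> to \<open>u\<close>. The power of \<open>d\<close> closes up at \<open>v\<close>,
  hence also at \<open>u\<close>, and two closed paths with such a label coincide. So
  \<open>u = v\<close>, and t itself closes up at \<open>V0\<close>.\<close>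

lemma base_subgroup_primitive: "primitive_subgroup (base_subgroup g) (surf_group g)"
  unfolding primitive_subgroup_def
proof (intro conjI ballI allI impI base_subgroup)
  let ?T = "surf_group g"
  fix t and n :: nat
  assume t: "t \<in> carrier ?T" and n: "1 \<le> n" and tn: "t [^]\<^bsub>?T\<^esub> n \<in> base_subgroup g"
  show "t \<in> base_subgroup g"
  proof (cases "t = []")
    case True
    then show ?thesis using t by (simp add: in_base_subgroup_iff)
  next
    case False
    have "reduced t" using t by (simp add: surf_group_eq)
    then obtain c d where cd: "t = c @ d @ winv c" "d \<noteq> []" "reduced (d @ d)"
      using cyclic_reduction False by blast
    obtain k where k: "n = Suc k" using n by (cases n) auto
    let ?D = "concat (replicate n d)"
    have "t [^]\<^bsub>?T\<^esub> n = c @ ?D @ winv c"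
      using conj_pow[OF cd(2,3), of c "surf_gens g" k] t k cd(1) by (simp only: surf_group_eq)
    then have "path (c @ ?D @ winv c) V0 = Some V0" using tn by (simp add: in_base_subgroup_iff)
    then obtain v v' where v: "path c V0 = Some v" "path ?D v = Some v'" "path (winv c) v' = Some V0"
      by (auto simp: path_append split: bind_splits)
    have "v' = v" using path_winv[OF v(3)] v(1) by simp
    have D: "d @ ?D = ?D @ d" by (induction n) auto
    have Dk: "?D = d @ concat (replicate k d)" using k by simp
    obtain u where u: "path d v = Some u"
      using v(2) unfolding Dk path_append by (cases "path d v") auto
    have "path (d @ ?D) v = path (?D @ d) v" using D by simp
    then have "path ?D u = Some u" using u v(2) \<open>v' = v\<close> by (simp add: path_append)
    moreover have "reduced (?D @ ?D)"
    proof -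
      have "?D @ ?D = concat (replicate (n + n) d)" by (simp only: replicate_add concat_append)
      moreover have "n + n = Suc (k + n)" using k by simp
      moreover have "reduced d" using cd(3) by (simp only: reduced_append)
      ultimately show ?thesis using reduced_powers[OF cd(2,3), of "[]" "[]" "k + n"] by (simp only: append_Nil append_Nil2)
    qed
    moreover have "?D \<noteq> []" using cd(2) k by simp
    ultimately have "u = v" using no_closed_pair_walk[of ?D u v] v(2) \<open>v' = v\<close> by blast
    then have "path t V0 = Some V0"
      using cd(1) v \<open>v' = v\<close> u by (simp add: path_append)
    then show ?thesis using t by (simp add: in_base_subgroup_iff)
  qed
qed

lemma twisted_rep_image:
  "twisted_rep \<epsilon> ` carrier (surf_group g) = subst_word (twist_gens \<epsilon>) ` base_subgroup g"
proof -
  let ?T = "surf_group g"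
  have swap: "subst_word (swap_gens \<epsilon>) ` carrier ?T = carrier ?T"
  proof
    show "subst_word (swap_gens \<epsilon>) ` carrier ?T \<subseteq> carrier ?T"
      using hom_in_carrier[OF gens_homs(3)] by blast
    show "carrier ?T \<subseteq> subst_word (swap_gens \<epsilon>) ` carrier ?T"
      using swap_swap hom_in_carrier[OF gens_homs(3)] by (metis image_eqI subsetI)
  qed
  have "twisted_rep \<epsilon> ` carrier ?T = subst_word (twist_gens \<epsilon>) `
      subst_word base_gens ` subst_word (swap_gens \<epsilon>) ` carrier ?T"
    by (simp only: twisted_rep_def[abs_def] image_image)
  then show ?thesis by (simp only: swap)
qed

lemma twisted_rep_primitive: "primitive_subgroup (twisted_rep \<epsilon> ` carrier (surf_group g)) (surf_group g)"
proof -
  let ?T = "surf_group g"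
  interpret T: group ?T by (rule group_surf_group)
  interpret h: group_hom ?T ?T "twisted_rep \<epsilon>"
    using twisted_rep_hom by (simp add: group_hom_def group_hom_axioms_def T.is_group)
  let ?s = "subst_word (twist_gens \<epsilon>)"
  show ?thesis
    unfolding primitive_subgroup_def
  proof (intro conjI ballI allI impI)
    show "subgroup (twisted_rep \<epsilon> ` carrier ?T) (?T)" by (rule h.img_is_subgroup)
    fix t and n :: nat
    assume t: "t \<in> carrier ?T" "1 \<le> n"
      and "t [^]\<^bsub>?T\<^esub> n \<in> twisted_rep \<epsilon> ` carrier ?T"
    then obtain r where r: "r \<in> base_subgroup g" "t [^]\<^bsub>?T\<^esub> n = ?s r"
      unfolding twisted_rep_image by blast
    have "r \<in> carrier ?T" using r(1) subgroup.subset[OF base_subgroup] by blast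
    then have "?s t [^]\<^bsub>?T\<^esub> n = r"
      using Group.hom_nat_pow[OF gens_homs(2) t(1) T.is_group T.is_group, of \<epsilon> n] r(2) twist_twist by simp
    then have "?s t \<in> base_subgroup g"
      using base_subgroup_primitive[of g] r(1) t(2) hom_in_carrier[OF gens_homs(2) t(1)]
      unfolding primitive_subgroup_def by blast
    then show "t \<in> twisted_rep \<epsilon> ` carrier ?T"
      unfolding twisted_rep_image using twist_twist[OF t(1)] by (metis image_eqI)
  qed
qed

text \<open>In a handle twisted on one side only, the twisted subgroup contains q p q^-1. The other
  twist fixes this word, so it would have to lie in \<open>base_subgroup g\<close>, but its path
  from \<open>V0\<close> ends in \<open>V3 i\<close>.\<close>

lemma twisted_rep_images_distinct:
  assumes "\<epsilon> \<subseteq> {1..g}" "\<epsilon>' \<subseteq> {1..g}" "\<epsilon> \<noteq> \<epsilon>'"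
  shows "twisted_rep \<epsilon> ` carrier (surf_group g) \<noteq> twisted_rep \<epsilon>' ` carrier (surf_group g)"
proof -
  have *: "subst_word (twist_gens \<epsilon>) ` base_subgroup g \<noteq> subst_word (twist_gens \<epsilon>') ` base_subgroup g"
    if i: "i \<in> {1..g}" "i \<in> \<epsilon>" "i \<notin> \<epsilon>'" for \<epsilon> \<epsilon>' i
  proof
    let ?b = "[(GenB i, True), (GenA i, True), (GenB i, False)]"
    assume eq: "subst_word (twist_gens \<epsilon>) ` base_subgroup g = subst_word (twist_gens \<epsilon>') ` base_subgroup g"
    have "subst_word (twist_gens \<epsilon>) (letter (GenA i)) \<in> subst_word (twist_gens \<epsilon>) ` base_subgroup g"
      using base_subgroup_generators(1)[OF i(1)] by (intro imageI) (simp add: letter_def)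
    then have "?b \<in> subst_word (twist_gens \<epsilon>') ` base_subgroup g" using i eq by simp
    then obtain r where r: "r \<in> base_subgroup g" "?b = subst_word (twist_gens \<epsilon>') r" by blast
    have "r = subst_word (twist_gens \<epsilon>') ?b"
    proof -
      have "r \<in> carrier (surf_group g)" using r(1) subgroup.subset[OF base_subgroup] by blast
      then show ?thesis using twist_twist r(2) by simp
    qed
    also have "\<dots> = ?b" using i by (simp add: subst_word_def letter_def flip_def)
    finally show False using r(1) by (simp add: in_base_subgroup_iff)
  qed
  from assms(3) obtain i where "i \<in> \<epsilon> \<and> i \<notin> \<epsilon>' \<or> i \<in> \<epsilon>' \<and> i \<notin> \<epsilon>" by blast
  then show ?thesis
    unfolding twisted_rep_image using *[of i \<epsilon> \<epsilon>'] *[of i \<epsilon>' \<epsilon>] assms(1,2) by auto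
qed


section \<open>Counting syllables\<close>

text \<open>
  \<open>syllable_map G \<chi> a\<close> replaces every maximal power \<open>a\<^sup>n\<close> of a word by \<open>\<chi> n\<close> and forgets the
  other letters. It fails to be multiplicative only because of the powers of \<open>a\<close> at the place
  where two words meet, so it is multiplicative on given words as soon as \<open>\<chi>\<close> is trivial at
  finitely many exponents.
\<close>

fun lead_exp :: "'x \<Rightarrow> 'x word \<Rightarrow> int" where
  "lead_exp a [] = 0"
| "lead_exp a (l # w) = (if fst l = a then (if snd l then 1 else - 1) + lead_exp a w else 0)"

fun syllable_tail :: "('g, 'm) monoid_scheme \<Rightarrow> (int \<Rightarrow> 'g) \<Rightarrow> 'x \<Rightarrow> 'x word \<Rightarrow> 'g" where
  "syllable_tail G \<chi> a [] = \<one>\<^bsub>G\<^esub>"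
| "syllable_tail G \<chi> a (l # w) = (if fst l = a then syllable_tail G \<chi> a w
     else \<chi> (lead_exp a w) \<otimes>\<^bsub>G\<^esub> syllable_tail G \<chi> a w)"

definition syllable_map :: "('g, 'm) monoid_scheme \<Rightarrow> (int \<Rightarrow> 'g) \<Rightarrow> 'x \<Rightarrow> 'x word \<Rightarrow> 'g" where
  "syllable_map G \<chi> a w = \<chi> (lead_exp a w) \<otimes>\<^bsub>G\<^esub> syllable_tail G \<chi> a w"

text \<open>Oddness makes \<open>syllable_map\<close> respect inverses, and
  \<open>\<chi> 0 = \<one>\<close> discards the empty syllables between other letters.\<close>

definition odd_map :: "('g, 'm) monoid_scheme \<Rightarrow> (int \<Rightarrow> 'g) \<Rightarrow> bool" where
  "odd_map G \<chi> \<longleftrightarrow> (\<forall>n. \<chi> n \<in> carrier G) \<and> \<chi> 0 = \<one>\<^bsub>G\<^esub> \<and> (\<forall>n. \<chi> (- n) = inv\<^bsub>G\<^esub> \<chi> n)"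

context group
begin

lemma syllable_tail_closed: "odd_map G \<chi> \<Longrightarrow> syllable_tail G \<chi> a w \<in> carrier G"
  by (induction w) (auto simp: odd_map_def)

lemma syllable_map_closed: "odd_map G \<chi> \<Longrightarrow> syllable_map G \<chi> a w \<in> carrier G"
  using syllable_tail_closed[of \<chi> a w] by (auto simp: odd_map_def syllable_map_def)

text \<open>Only the syllable at the junction is shared by both words. The exponent with which
  \<open>u\<close> ends is \<open>- lead_exp a (winv u)\<close>.\<close>

lemma syllable_map_append:
  assumes \<chi>: "odd_map G \<chi>"
  shows "syllable_map G \<chi> a (u @ v) =
    inv (syllable_tail G \<chi> a (winv u)) \<otimes> \<chi> (lead_exp a v - lead_exp a (winv u)) \<otimes> syllable_tail G \<chi> a v"
proof (induction u arbitrary: v rule: rev_induct)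
  case Nil
  have "\<chi> (lead_exp a v) \<in> carrier G" using \<chi> by (simp add: odd_map_def)
  then show ?case by (simp add: syllable_map_def)
next
  case (snoc l u)
  note cl = syllable_tail_closed[OF \<chi>, of a]
  have c: "\<chi> n \<in> carrier G" "\<chi> 0 = \<one>" "\<chi> (- n) = inv \<chi> n" for n using \<chi> by (auto simp: odd_map_def)
  show ?case
  proof (cases "fst l = a")
    case True
    then show ?thesis using snoc[of "l # v"] by (simp add: flip_def algebra_simps)
  next
    case False
    then show ?thesis
      using snoc[of "l # v"] cl c(1) c(3)[of "lead_exp a (winv u)"] by (simp add: inv_mult_group m_assoc)
  qed
qed

lemma syllable_map_winv:
  assumes \<chi>: "odd_map G \<chi>"
  shows "syllable_map G \<chi> a (winv u) = inv (syllable_map G \<chi> a u)"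
proof -
  note cl = syllable_tail_closed[OF \<chi>, of a]
  have c: "\<chi> n \<in> carrier G" "\<chi> (- n) = inv \<chi> n" for n using \<chi> by (auto simp: odd_map_def)
  have "syllable_map G \<chi> a u = inv (syllable_tail G \<chi> a (winv u)) \<otimes> \<chi> (- lead_exp a (winv u))"
    using syllable_map_append[OF \<chi>, of a u "[]"] cl c(1) by simp
  also have "\<dots> = inv (syllable_map G \<chi> a (winv u))"
    using cl c by (simp add: syllable_map_def inv_mult_group)
  finally show ?thesis using syllable_map_closed[OF \<chi>, of a "winv u"] by simp
qed

text \<open>The exceptional exponents belong to the junctions in \<open>u' @ c\<close>,
  \<open>winv c @ v'\<close> and \<open>u' @ v'\<close>. They depend on the words alone, so one set
  serves all \<open>\<chi>\<close>.\<close>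

lemma syllable_map_mult:
  assumes "reduced u" "reduced v"
  shows "\<exists>D. finite D \<and> card D \<le> 3 \<and> (\<forall>\<chi>. odd_map G \<chi> \<longrightarrow> (\<forall>n\<in>D. \<chi> n = \<one>) \<longrightarrow>
    syllable_map G \<chi> a (foldr red_cons u v) = syllable_map G \<chi> a u \<otimes> syllable_map G \<chi> a v)"
proof -
  obtain u' c v' where uv: "u = u' @ c" "v = winv c @ v'" "foldr red_cons u v = u' @ v'"
    using foldr_red_cons_split[OF assms] by blast
  let ?x = "lead_exp a c - lead_exp a (winv u')" and ?y = "lead_exp a v' - lead_exp a c"
  let ?D = "{?x, ?y, ?x + ?y}"
  have "syllable_map G \<chi> a (foldr red_cons u v) = syllable_map G \<chi> a u \<otimes> syllable_map G \<chi> a v"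
    if \<chi>: "odd_map G \<chi>" and D: "\<forall>n\<in>?D. \<chi> n = \<one>" for \<chi>
  proof -
    note cl = syllable_tail_closed[OF \<chi>, of a]
    have "?x + ?y = lead_exp a v' - lead_exp a (winv u')" by simp
    then have xy: "\<chi> ?x = \<one>" "\<chi> ?y = \<one>" "\<chi> (lead_exp a v' - lead_exp a (winv u')) = \<one>"
      using D by (metis insertCI)+
    show ?thesis
      unfolding uv(3) unfolding uv(1,2)
      using cl xy by (simp add: syllable_map_append[OF \<chi>] m_assoc) (simp add: m_assoc[symmetric])
  qed
  moreover have "card ?D \<le> 3"
    using card_insert_le_m1[of 3 "{?y, ?x + ?y}" ?x] card_insert_le_m1[of 2 "{?x + ?y}" ?y] by simp
  ultimately show ?thesis by (intro exI[of _ ?D]) auto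
qed

text \<open>Every letter of \<open>w\<close> costs one multiplication, hence at most three
  exponents, however long the words \<open>e x\<close> are. Inverse letters cost nothing more, by
  oddness.\<close>

lemma syllable_map_word_eval:
  assumes e: "e \<in> X \<rightarrow> carrier (free_group S)" and w: "fst ` set w \<subseteq> X"
  shows "\<exists>D. finite D \<and> card D \<le> 3 * length w \<and> (\<forall>\<chi>. odd_map G \<chi> \<longrightarrow> (\<forall>n\<in>D. \<chi> n = \<one>) \<longrightarrow>
    syllable_map G \<chi> a (word_eval (free_group S) e w) = word_eval G (\<lambda>x. syllable_map G \<chi> a (e x)) w)"
  using w
proof (induction w)
  case Nil
  have "syllable_map G \<chi> a [] = \<one>" if "odd_map G \<chi>" for \<chi>
    using that by (simp add: syllable_map_def odd_map_def)
  then show ?case by (intro exI[of _ "{}"]) simp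
next
  case (Cons l w)
  let ?w = "word_eval (free_group S) e w"
  let ?l = "if snd l then e (fst l) else winv (e (fst l))"
  have el: "e (fst l) \<in> carrier (free_group S)" using funcset_mem[OF e, of "fst l"] Cons.prems by simp
  have eval: "word_eval (free_group S) e (l # w) = foldr red_cons ?l ?w"
    using inv_free_group[OF el] by simp
  have red: "reduced ?l" "reduced ?w"
    using el word_eval_closed[OF group_free_group e, of w] Cons.prems by auto
  obtain D where D: "finite D" "card D \<le> 3 * length w"
    "\<And>\<chi>. odd_map G \<chi> \<Longrightarrow> \<forall>n\<in>D. \<chi> n = \<one> \<Longrightarrow>
      syllable_map G \<chi> a ?w = word_eval G (\<lambda>x. syllable_map G \<chi> a (e x)) w"
    using Cons by auto
  obtain D' where D': "finite D'" "card D' \<le> 3"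
    "\<And>\<chi>. odd_map G \<chi> \<Longrightarrow> \<forall>n\<in>D'. \<chi> n = \<one> \<Longrightarrow>
      syllable_map G \<chi> a (foldr red_cons ?l ?w) = syllable_map G \<chi> a ?l \<otimes> syllable_map G \<chi> a ?w"
    using syllable_map_mult[OF red, of a] by blast
  have "syllable_map G \<chi> a (word_eval (free_group S) e (l # w)) =
      word_eval G (\<lambda>x. syllable_map G \<chi> a (e x)) (l # w)"
    if "odd_map G \<chi>" "\<forall>n\<in>D \<union> D'. \<chi> n = \<one>" for \<chi>
    unfolding eval using D(3)[OF that(1)] D'(3)[OF that(1)] that by (simp add: syllable_map_winv)
  moreover have "card (D \<union> D') \<le> 3 * length (l # w)"
    using card_Un_le[of D D'] D(2) D'(2) by simp
  ultimately show ?case using D(1) D'(1) by (intro exI[of _ "D \<union> D'"]) blast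
qed

end


section \<open>Embedding a free group of large rank\<close>

text \<open>
  \<open>marker a b M s\<close> is the product of the conjugates \<open>a\<^sup>h b a\<^sup>-\<^sup>h\<close> of \<open>b\<close> for increasing heights \<open>h\<close>. It starts
  at \<open>h = - gen_code s\<close>, and the \<open>j\<close>th increment \<open>marker_exp s j\<close> is an exponent of \<open>a\<close> that
  identifies \<open>s\<close> and \<open>j\<close>.
\<close>

fun gen_code :: "surface_gen \<Rightarrow> nat" where
  "gen_code (GenA i) = 2 * i"
| "gen_code (GenB i) = 2 * i + 1"

lemma gen_code_inject: "gen_code s = gen_code t \<longleftrightarrow> s = t"
  by (cases s; cases t) (auto, presburger+)

definition marker_exp :: "surface_gen \<Rightarrow> nat \<Rightarrow> nat" where
  "marker_exp s j = prod_encode (gen_code s, j) + 1"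

lemma marker_exp_inject: "marker_exp s j = marker_exp t k \<longleftrightarrow> s = t \<and> j = k"
  by (simp add: marker_exp_def gen_code_inject)

text \<open>The summand 1 in \<open>marker_exp\<close> gives strict inequalities: no exponent is 0,
  where odd maps are trivial, and a single increment lifts \<open>- gen_code s\<close> above
  0.\<close>

lemma marker_exp_pos: "0 < marker_exp s j" "gen_code s < marker_exp s j"
  using le_prod_encode_1[of "gen_code s" j] by (simp_all add: marker_exp_def)

fun blocks :: "'x \<Rightarrow> 'x \<Rightarrow> surface_gen \<Rightarrow> nat list \<Rightarrow> int \<Rightarrow> 'x word" where
  "blocks a b s [] h = (b, True) # replicate (nat h) (a, False)"
| "blocks a b s (j # js) h =
     (b, True) # replicate (marker_exp s j) (a, True) @ blocks a b s js (h + int (marker_exp s j))"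

definition marker :: "'x \<Rightarrow> 'x \<Rightarrow> nat \<Rightarrow> surface_gen \<Rightarrow> 'x word" where
  "marker a b M s = replicate (gen_code s) (a, False) @ blocks a b s [0..<Suc M] (- int (gen_code s))"

definition marker_height :: "nat \<Rightarrow> surface_gen \<Rightarrow> int" where
  "marker_height M s = (\<Sum>j\<leftarrow>[0..<Suc M]. int (marker_exp s j)) - int (gen_code s)"

lemma marker_height_nonneg: "0 \<le> marker_height M s"
proof -
  have "int (marker_exp s 0) \<le> (\<Sum>j\<leftarrow>[0..<Suc M]. int (marker_exp s j))"
    by (intro member_le_sum_list) (auto simp del: upt_Suc)
  then show ?thesis using marker_exp_pos(2)[of s 0] by (simp add: marker_height_def del: upt_Suc)
qed

lemma reduced_replicate_append:
  "reduced w \<Longrightarrow> w = [] \<or> hd w \<noteq> flip l \<Longrightarrow> reduced (replicate n l @ w)"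
  by (induction n) (auto simp: reduced_Cons hd_append)

lemma marker_closed:
  assumes "a \<in> S" "b \<in> S" "a \<noteq> b"
  shows "marker a b M s \<in> carrier (free_group S)"
proof -
  have rep: "reduced (replicate n l)" for n and l :: "'a \<times> bool"
    using reduced_replicate_append[of "[]" l n] by simp
  have "reduced (blocks a b s js h) \<and> hd (blocks a b s js h) = (b, True) \<and> fst ` set (blocks a b s js h) \<subseteq> S" for js h
    using assms
  proof (induction js arbitrary: h)
    case Nil
    then show ?case using rep[of "nat h" "(a, False)"]
      by (cases "nat h") (auto simp: reduced_Cons flip_def)
  next
    case (Cons j js)
    have "reduced (replicate (marker_exp s j) (a, True) @ blocks a b s js (h + int (marker_exp s j)))"
      using Cons by (intro reduced_replicate_append) (auto simp: flip_def)
    moreover have "hd (replicate (marker_exp s j) (a, True) @ blocks a b s js (h + int (marker_exp s j))) = (a, True)"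
      using marker_exp_pos(1)[of s j] by (cases "marker_exp s j") auto
    ultimately show ?case using Cons by (auto simp: reduced_Cons flip_def)
  qed
  note bl = this
  have "reduced (marker a b M s)"
    unfolding marker_def using bl assms(3) by (intro reduced_replicate_append) (auto simp: flip_def simp del: upt_Suc)
  then show ?thesis using bl assms by (auto simp: marker_def simp del: upt_Suc)
qed

lemma lead_exp_replicate: "lead_exp a (replicate n (a, s) @ w) = (if s then int n else - int n) + lead_exp a w"
  by (induction n) auto

lemma syllable_tail_replicate: "syllable_tail G \<chi> a (replicate n (a, s) @ w) = syllable_tail G \<chi> a w"
  by (induction n) auto

text \<open>The powers of \<open>a\<close> in the marker are the start \<open>- gen_code s\<close>,
  the increments, and the return \<open>- marker_height M s\<close>. The hypotheses silence all of
  them but the \<open>k\<close>th increment, which occurs once.\<close>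

lemma (in group) syllable_map_marker:
  assumes \<chi>: "odd_map G \<chi>" and ab: "a \<noteq> b" and k: "k \<le> M"
    and exps: "\<And>j. \<chi> (int (marker_exp s j)) = (if j = k then y else \<one>)"
    and ends: "\<chi> (- int (gen_code s)) = \<one>" "\<chi> (- marker_height M s) = \<one>"
  shows "syllable_map G \<chi> a (marker a b M s) = y"
proof -
  have y: "y \<in> carrier G" using exps[of k] \<chi> by (metis odd_map_def)
  have lead: "lead_exp a (blocks a b s js h) = 0" for js h using ab by (cases js) auto
  have "syllable_tail G \<chi> a (blocks a b s js h) = (if k \<in> set js then y else \<one>)"
    if "distinct js" "0 \<le> h + (\<Sum>j\<leftarrow>js. int (marker_exp s j))" "h + (\<Sum>j\<leftarrow>js. int (marker_exp s j)) = marker_height M s" for js h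
    using that
  proof (induction js arbitrary: h)
    case Nil
    then show ?case
      using ab ends(2) lead_exp_replicate[of a "nat h" False "[]"] syllable_tail_replicate[of G \<chi> a "nat h" False "[]"]
      by simp
  next
    case (Cons j js)
    then have IH: "syllable_tail G \<chi> a (blocks a b s js (h + int (marker_exp s j))) = (if k \<in> set js then y else \<one>)"
      by (intro Cons.IH) (auto simp: algebra_simps)
    show ?case using Cons.prems(1) ab exps[of j] y
      by (auto simp: lead_exp_replicate syllable_tail_replicate lead IH)
  qed
  from this[of "[0..<Suc M]" "- int (gen_code s)"] marker_height_nonneg[of M s]
  have "syllable_tail G \<chi> a (blocks a b s [0..<Suc M] (- int (gen_code s))) = y"
    using k by (simp add: marker_height_def del: upt_Suc)
  then show ?thesis
    using ends(1) y lead
    by (simp add: marker_def syllable_map_def lead_exp_replicate syllable_tail_replicate del: upt_Suc)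
qed

text \<open>
  A word of total exponent \<open>height = 0\<close> in \<open>a\<close> is a product of conjugates \<open>a\<^sup>h b a\<^sup>-\<^sup>h\<close>; \<open>retract\<close>
  replaces each of them by \<open>\<kappa> h\<close>.
\<close>

fun height :: "'x \<Rightarrow> 'x word \<Rightarrow> int" where
  "height a [] = 0"
| "height a (l # w) = (if fst l = a then (if snd l then 1 else - 1) else 0) + height a w"

fun retract :: "'x \<Rightarrow> 'x \<Rightarrow> (int \<Rightarrow> 'y word) \<Rightarrow> int \<Rightarrow> 'x word \<Rightarrow> 'y word" where
  "retract a b \<kappa> h [] = []"
| "retract a b \<kappa> h (l # w) =
     (if fst l = a then retract a b \<kappa> (h + (if snd l then 1 else - 1)) w
      else if fst l = b then foldr red_cons (if snd l then \<kappa> h else winv (\<kappa> h)) (retract a b \<kappa> h w)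
      else retract a b \<kappa> h w)"

lemma height_red_cons: "height a (red_cons l w) = height a (l # w)"
  by (cases w) (auto simp: red_cons_Cons flip_def simp del: red_cons.simps(2))

lemma height_mult: "height a (foldr red_cons u v) = height a u + height a v"
  by (induction u) (simp_all add: height_red_cons)

lemma reduced_retract: "(\<And>h. reduced (\<kappa> h)) \<Longrightarrow> reduced (retract a b \<kappa> h w)"
  by (induction w arbitrary: h) (auto intro: reduced_foldr)

lemma retract_letters:
  assumes \<kappa>: "\<And>h. fst ` set (\<kappa> h) \<subseteq> Y"
  shows "fst ` set (retract a b \<kappa> h w) \<subseteq> Y"
proof (induction w arbitrary: h)
  case (Cons l w)
  have "fst ` set (if snd l then \<kappa> h else winv (\<kappa> h)) \<subseteq> Y" using \<kappa>[of h] by simp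
  then show ?case using letters_foldr[OF _ Cons[of h]] Cons by simp
qed simp

lemma retract_red_cons:
  assumes \<kappa>: "\<And>h. reduced (\<kappa> h)"
  shows "retract a b \<kappa> h (red_cons l w) = retract a b \<kappa> h (l # w)"
proof (cases w)
  case (Cons m w')
  show ?thesis
  proof (cases "m = flip l")
    case True
    have "foldr red_cons (winv (\<kappa> h)) (foldr red_cons (\<kappa> h) (retract a b \<kappa> h w')) = retract a b \<kappa> h w'"
      "foldr red_cons (\<kappa> h) (foldr red_cons (winv (\<kappa> h)) (retract a b \<kappa> h w')) = retract a b \<kappa> h w'"
      using foldr_inverse[OF reduced_retract[of \<kappa> a b h w', OF \<kappa>], of "\<kappa> h"]
        foldr_inverse[OF reduced_retract[of \<kappa> a b h w', OF \<kappa>], of "winv (\<kappa> h)"]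
      by (simp_all add: winv_def[symmetric])
    then show ?thesis using Cons True by (simp add: red_cons_Cons flip_def del: red_cons.simps(2))
  qed (use Cons in \<open>simp add: red_cons_Cons del: red_cons.simps(2)\<close>)
qed simp

text \<open>On words of height 0 this is plain multiplicativity; in general \<open>u\<close> shifts
  the height at which \<open>v\<close> is read.\<close>

lemma retract_mult:
  assumes \<kappa>: "\<And>h. reduced (\<kappa> h)" and "reduced v"
  shows "retract a b \<kappa> h (foldr red_cons u v) =
    foldr red_cons (retract a b \<kappa> h u) (retract a b \<kappa> (h + height a u) v)"
proof (induction u arbitrary: h)
  case (Cons l u)
  note red = reduced_retract[of \<kappa> a b, OF \<kappa>]
  show ?case
    using Cons by (simp add: retract_red_cons[OF \<kappa>] foldr_assoc[OF red] algebra_simps)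
qed simp

lemma height_replicate: "height a (replicate n (a, s) @ w) = (if s then int n else - int n) + height a w"
  by (induction n) auto

lemma retract_replicate:
  "retract a b \<kappa> h (replicate n (a, s) @ w) = retract a b \<kappa> (h + (if s then int n else - int n)) w"
  by (induction n arbitrary: h) (auto simp: algebra_simps)

lemma height_marker:
  assumes "a \<noteq> b"
  shows "height a (marker a b M s) = 0"
proof -
  have "height a (blocks a b s js h) = - h" if "0 \<le> h + (\<Sum>j\<leftarrow>js. int (marker_exp s j))" for js h
    using that
  proof (induction js arbitrary: h)
    case Nil
    then show ?case using assms height_replicate[of a "nat h" False "[]"] by simp
  next
    case (Cons j js)
    then show ?case using assms by (simp add: height_replicate algebra_simps)
  qed
  from this[of "- int (gen_code s)" "[0..<Suc M]"] show ?thesis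
    using marker_height_nonneg[of M s]
    by (simp add: marker_def height_replicate marker_height_def del: upt_Suc)
qed

text \<open>By \<open>gen_code s < marker_exp s j\<close>, every \<open>b\<close> after the first
  stands at positive height, where \<open>\<kappa>\<close> is trivial.\<close>

lemma retract_marker:
  assumes ab: "a \<noteq> b" and \<kappa>: "\<And>h. reduced (\<kappa> h)" "\<And>h. 0 < h \<Longrightarrow> \<kappa> h = []"
  shows "retract a b \<kappa> 0 (marker a b M s) = \<kappa> (- int (gen_code s))"
proof -
  have rep: "retract a b \<kappa> h (replicate n (a, x)) = []" for h n x
    using retract_replicate[of a b \<kappa> h n x "[]"] by simp
  have pos: "retract a b \<kappa> h (blocks a b s js h) = []" if "0 < h" for js h
    using that
  proof (induction js arbitrary: h)
    case (Cons j js)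
    then show ?case using ab \<kappa>(2)[of h] by (simp add: retract_replicate)
  qed (use ab \<kappa> rep in auto)
  have "retract a b \<kappa> 0 (marker a b M s) =
      foldr red_cons (\<kappa> (- int (gen_code s)))
        (retract a b \<kappa> (int (marker_exp s 0) - int (gen_code s)) (blocks a b s [1..<Suc M] (int (marker_exp s 0) - int (gen_code s))))"
    using ab by (simp add: marker_def retract_replicate upt_conv_Cons del: upt_Suc)
  then show ?thesis
    using pos[of "int (marker_exp s 0) - int (gen_code s)"] marker_exp_pos(2)[of s 0] foldr_reduced_Nil[OF \<kappa>(1)]
    by (simp del: upt_Suc)
qed

section \<open>The retraction onto the subgroup generated by the markers\<close>

definition gen_at :: "nat \<Rightarrow> int \<Rightarrow> surface_word" where
  "gen_at g h = (if \<exists>s\<in>surf_gens g. h = - int (gen_code s)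
     then letter (THE s. s \<in> surf_gens g \<and> h = - int (gen_code s)) else [])"

lemma gen_at:
  "reduced (gen_at g h)" "0 < h \<Longrightarrow> gen_at g h = []"
  "s \<in> surf_gens g \<Longrightarrow> gen_at g (- int (gen_code s)) = letter s"
proof -
  show "reduced (gen_at g h)" by (simp add: gen_at_def letter_def reduced_Cons)
  show "0 < h \<Longrightarrow> gen_at g h = []" by (auto simp: gen_at_def)
  assume s: "s \<in> surf_gens g"
  then have "(THE t. t \<in> surf_gens g \<and> - int (gen_code s) = - int (gen_code t)) = s"
    by (intro the_equality) (auto simp: gen_code_inject)
  then show "gen_at g (- int (gen_code s)) = letter s" using s by (auto simp: gen_at_def)
qed

context
  fixes a b :: 'x and S :: "'x set" and g M :: nat
  assumes ab: "a \<in> S" "b \<in> S" "a \<noteq> b"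
begin

lemma marker_hom: "subst_word (marker a b M) \<in> hom (surf_group g) (free_group S)"
  unfolding surf_group_eq by (rule subst_word_hom) (use marker_closed[OF ab] in blast)

lemma retract_subst_marker:
  assumes "w \<in> carrier (surf_group g)"
  shows "height a (subst_word (marker a b M) w) = 0" "retract a b (gen_at g) 0 (subst_word (marker a b M) w) = w"
proof -
  let ?m = "marker a b M" and ?r = "retract a b (gen_at g)"
  have m: "reduced (?m s)" for s using marker_closed[OF ab, of M s] by simp
  note r = retract_mult[of "gen_at g", OF gen_at(1)] and red = reduced_retract[of "gen_at g", OF gen_at(1)]
  have hw: "height a (winv (?m s)) = 0" for s
  proof -
    have "foldr red_cons (winv (?m s)) (?m s) = []"
      using foldr_inverse[of "[]" "?m s"] m[of s] by (simp add: winv_def foldr_reduced_Nil)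
    then show ?thesis
      using height_mult[of a "winv (?m s)" "?m s"] height_marker[OF ab(3), of M s] by simp
  qed
  have rw: "?r 0 (winv (?m s)) = [(s, False)]" if "s \<in> surf_gens g" for s
  proof -
    have "foldr red_cons (?m s) (winv (?m s)) = []"
      using foldr_inverse[of "[]" "winv (?m s)"] m[of s] by (simp add: winv_def[symmetric] foldr_reduced_Nil)
    then have "foldr red_cons (letter s) (?r 0 (winv (?m s))) = []"
      using r[of "winv (?m s)" a b 0 "?m s"] m[of s] height_marker[OF ab(3), of M s]
        retract_marker[OF ab(3), of "gen_at g" M s, OF gen_at(1,2)] gen_at(3)[OF that] by simp
    then have "red_cons (s, False) (red_cons (s, True) (?r 0 (winv (?m s)))) = [(s, False)]"
      by (simp add: letter_def)
    then show ?thesis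
      using red_cons_cancel[OF red[of a b 0 "winv (?m s)"], of "(s, False)" "(s, True)"] by simp
  qed
  have "height a (subst_word ?m w) = 0 \<and> reduced (subst_word ?m w) \<and> ?r 0 (subst_word ?m w) = foldr red_cons w []"
    if "fst ` set w \<subseteq> surf_gens g" for w
    using that
  proof (induction w)
    case (Cons l w)
    let ?l = "if snd l then ?m (fst l) else winv (?m (fst l))"
    have s: "fst l \<in> surf_gens g" using Cons.prems by simp
    have sub: "subst_word ?m (l # w) = foldr red_cons ?l (subst_word ?m w)" by (simp add: subst_word_def)
    have "height a ?l = 0" using height_marker[OF ab(3)] hw by simp
    moreover have "?r 0 ?l = [l]"
      using rw[OF s] retract_marker[OF ab(3), of "gen_at g" M "fst l", OF gen_at(1,2)] gen_at(3)[OF s]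
      by (cases l) (simp add: letter_def)
    ultimately show ?case
      using Cons r[of "subst_word ?m w" a b 0 ?l] unfolding sub by (auto simp: height_mult intro: reduced_foldr)
  qed (simp add: subst_word_def)
  from this[of w] assms show "height a (subst_word ?m w) = 0" "?r 0 (subst_word ?m w) = w"
    by (simp_all add: surf_group_eq foldr_reduced_Nil)
qed

lemma marker_inj: "inj_on (subst_word (marker a b M)) (carrier (surf_group g))"
  by (metis inj_onI retract_subst_marker(2))

text \<open>If a power of \<open>t\<close> lies in the image, then \<open>n\<close> times the height
  of \<open>t\<close> is 0, so the retraction is multiplicative on powers of \<open>t\<close>.
  Primitivity of \<open>R\<close> puts the retract of \<open>t\<close> into \<open>R\<close>. The
  embedded retract and \<open>t\<close> have the same \<open>n\<close>th power, so they are equal by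
  uniqueness of roots.\<close>

lemma marker_primitive:
  assumes R: "primitive_subgroup R (surf_group g)"
  shows "primitive_subgroup (subst_word (marker a b M) ` R) (free_group S)"
proof -
  let ?T = "surf_group g" and ?F = "free_group S" and ?i = "subst_word (marker a b M)"
  let ?r = "retract a b (gen_at g) 0"
  interpret T: group ?T by (rule group_surf_group)
  interpret F: group ?F by (rule group_free_group)
  interpret i: group_hom ?T ?F ?i using marker_hom by (simp add: group_hom_def group_hom_axioms_def T.is_group F.is_group)
  have sub: "subgroup R ?T" using R by (simp add: primitive_subgroup_def)
  show ?thesis
    unfolding primitive_subgroup_def
  proof (intro conjI ballI allI impI)
    show "subgroup (?i ` R) ?F" using i.subgroup_img_is_subgroup[OF sub] .
    fix t and n :: nat
    assume t: "t \<in> carrier ?F" and n: "1 \<le> n" and "t [^]\<^bsub>?F\<^esub> n \<in> ?i ` R"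
    then obtain r where r: "r \<in> R" "t [^]\<^bsub>?F\<^esub> n = ?i r" by blast
    have rT: "r \<in> carrier ?T" using r(1) subgroup.subset[OF sub] by blast
    have red: "reduced t" using t by simp
    have pw: "height a ((foldr red_cons t ^^ n) []) = int n * height a t" for n
      by (induction n) (simp_all add: height_mult algebra_simps)
    have "height a ((foldr red_cons t ^^ n) []) = 0"
      using retract_subst_marker(1)[OF rT] r(2) free_group_pow[OF t, of n] by simp
    then have ht: "height a t = 0" using pw[of n] n by simp
    have rt: "?r t \<in> carrier ?T"
    proof -
      have "fst ` set (gen_at g h) \<subseteq> surf_gens g" for h
      proof (cases "\<exists>s\<in>surf_gens g. h = - int (gen_code s)")
        case True
        then obtain s where "s \<in> surf_gens g" "h = - int (gen_code s)" by blast
        then show ?thesis using gen_at(3)[of s g] by (simp add: letter_def)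
      next
        case False
        then show ?thesis by (simp add: gen_at_def)
      qed
      from retract_letters[of "gen_at g" _ a b 0 t, OF this]
      show ?thesis using reduced_retract[of "gen_at g" a b 0 t, OF gen_at(1)] by (simp add: surf_group_eq)
    qed
    have "?r ((foldr red_cons t ^^ n) []) = (foldr red_cons (?r t) ^^ n) []" for n
    proof (induction n)
      case (Suc n)
      have "reduced ((foldr red_cons t ^^ n) [])" by (induction n) (simp_all add: reduced_foldr)
      then show ?case
        using Suc retract_mult[of "gen_at g" "(foldr red_cons t ^^ n) []" a b 0 t, OF gen_at(1)] ht by simp
    qed simp
    from this[of n] have "?r t [^]\<^bsub>?T\<^esub> n = ?r (?i r)"
      using r(2) unfolding free_group_pow[OF t] surf_group_eq free_group_pow[OF rt[unfolded surf_group_eq]]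
      by simp
    then have pr: "?r t [^]\<^bsub>?T\<^esub> n = r" using retract_subst_marker(2)[OF rT] by simp
    then have "?r t \<in> R" using R rt n r(1) pr unfolding primitive_subgroup_def by blast
    moreover have "?i (?r t) [^]\<^bsub>?F\<^esub> n = t [^]\<^bsub>?F\<^esub> n"
      using i.hom_nat_pow[OF rt, of n] pr r(2) by simp
    then have "?i (?r t) = t"
      using unique_roots_free_group[of S] i.hom_closed[OF rt] t n unfolding unique_roots_def by blast
    ultimately show "t \<in> ?i ` R" by (metis imageI)
  qed
qed

end


section \<open>The genus of the common boundary word\<close>

lemma homogeneous_system:
  fixes c :: "'k \<Rightarrow> 'v \<Rightarrow> rat"
  assumes "finite K" "finite V" "card K < card V"
  shows "\<exists>\<xi>. (\<exists>v\<in>V. \<xi> v \<noteq> 0) \<and> (\<forall>k\<in>K. (\<Sum>v\<in>V. c k v * \<xi> v) = 0)"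
  using assms
proof (induction K arbitrary: V c rule: finite_induct)
  case empty
  then have "V \<noteq> {}" by auto
  then show ?case by (intro exI[of _ "\<lambda>_. 1"]) auto
next
  case (insert k K)
  show ?case
  proof (cases "\<forall>v\<in>V. c k v = 0")
    case True
    have "card K < card V" using insert.prems insert.hyps by simp
    from insert.IH[OF insert.prems(1) this, of c] True show ?thesis by auto
  next
    case False
    then obtain u where u: "u \<in> V" "c k u \<noteq> 0" by blast
    let ?V = "V - {u}"
    have "card K < card ?V" using insert.prems insert.hyps u by simp
    \<comment> \<open>These are the coefficients that remain after equation \<open>k\<close> has
      been used to eliminate the variable \<open>u\<close>.\<close>
    from insert.IH[OF _ this, of "\<lambda>j v. c j v - c j u / c k u * c k v"] insert.prems(1)
    obtain \<xi> where \<xi>: "\<exists>v\<in>?V. \<xi> v \<noteq> 0"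
      "\<And>j. j \<in> K \<Longrightarrow> (\<Sum>v\<in>?V. (c j v - c j u / c k u * c k v) * \<xi> v) = 0" by auto
    define s where "s = (\<Sum>v\<in>?V. c k v * \<xi> v)"
    define \<eta> where "\<eta> v = (if v = u then - s / c k u else \<xi> v)" for v
    have sum: "(\<Sum>v\<in>V. c j v * \<eta> v) = c j u * (- s / c k u) + (\<Sum>v\<in>?V. c j v * \<xi> v)" for j
    proof -
      have "(\<Sum>v\<in>V. c j v * \<eta> v) = c j u * \<eta> u + (\<Sum>v\<in>?V. c j v * \<eta> v)"
        using u(1) insert.prems(1) by (simp add: sum.remove)
      also have "(\<Sum>v\<in>?V. c j v * \<eta> v) = (\<Sum>v\<in>?V. c j v * \<xi> v)"
        by (rule sum.cong) (auto simp: \<eta>_def)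
      finally show ?thesis by (simp add: \<eta>_def)
    qed
    have "(\<Sum>v\<in>V. c k v * \<eta> v) = 0" using u(2) by (simp add: sum s_def)
    moreover have "(\<Sum>v\<in>V. c j v * \<eta> v) = 0" if "j \<in> K" for j
    proof -
      have "(\<Sum>v\<in>?V. c j v * \<xi> v) = c j u / c k u * s"
        using \<xi>(2)[OF that] by (simp add: s_def left_diff_distrib sum_subtractf sum_distrib_left mult.assoc)
      then show ?thesis by (simp add: sum)
    qed
    moreover have "\<exists>v\<in>V. \<eta> v \<noteq> 0" using \<xi>(1) by (auto simp: \<eta>_def)
    ultimately show ?thesis by (intro exI[of _ \<eta>]) auto
  qed
qed

lemma card_surf_gens: "card (surf_gens g) = 2 * g"
proof -
  have "card (surf_gens g) = card (GenA ` {1..g}) + card (GenB ` {1..g})"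
    unfolding surf_gens_def by (rule card_Un_disjoint) auto
  then show ?thesis by (simp add: card_image inj_on_def)
qed

lemma boundary_form:
  assumes "x \<in> surf_gens g"
  shows "(\<Sum>z\<in>surf_gens g. gen_sign z * (if z = x then 1 else 0) * (if bar z = y then 1 else 0)) =
    (if y = bar x then gen_sign x else 0)"
proof -
  have "(\<Sum>z\<in>surf_gens g. gen_sign z * (if z = x then 1 else 0) * (if bar z = y then 1 else 0)) =
      (\<Sum>z\<in>surf_gens g. if z = x then (if y = bar x then gen_sign x else 0) else 0)"
    by (rule sum.cong) auto
  then show ?thesis using assms by simp
qed

text \<open>The symplectic form of rank \<open>2 g\<close> would be a combination of only \<open>2 g'\<close> linear forms.\<close>

lemma genus_of_base_boundary:
  assumes k: "k \<in> hom (surf_group g') (surf_group g)"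
    and kb: "k (boundary g') = subst_word base_gens (boundary g)"
  shows "g \<le> g'"
proof (rule ccontr)
  assume "\<not> g \<le> g'"
  then have card: "card (surf_gens g') < card (surf_gens g)" by (simp add: card_surf_gens)
  \<comment> \<open>Composing with \<open>co_gens\<close> normalizes the linear parts:
    \<open>?cb\<close> is the identity on the abelianization, so the form of the given word becomes
    the standard one.\<close>
  let ?f = "\<lambda>w. subst_word co_gens (k w)" and ?cb = "\<lambda>w. subst_word co_gens (subst_word base_gens w)"
  have f: "?f \<in> hom (surf_group g') (free_group (surf_gens g))"
    using comp_hom[OF k gens_homs(4)] by (simp only: surf_group_eq)
  have cb: "?cb \<in> hom (surf_group g) (free_group (surf_gens g))"
    using comp_hom[OF gens_homs(1) gens_homs(4)] by (simp only: surf_group_eq)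
  have ab: "magnus (subst_word co_gens (base_gens z)) [x] = (if z = x then 1 else 0)" for z x
    using co_base_abelianization[of z x] by simp
  define N where "N x z = magnus (?f (letter z)) [x]" for x z
  have form: "(\<Sum>z\<in>surf_gens g'. gen_sign z * N x z * N y (bar z)) = (if y = bar x then gen_sign x else 0)"
    if "x \<in> surf_gens g" for x y
    using magnus_hom_boundary[OF f, of x y] magnus_hom_boundary[OF cb, of x y] boundary_form[OF that, of y]
    by (simp add: N_def kb ab)
  \<comment> \<open>\<open>\<xi>\<close> is annihilated by all \<open>2 g'\<close> linear forms, so
    it pairs to 0 with everything under the form built from them. That form is the nondegenerate one
    of rank \<open>2 g\<close>, which forces \<open>\<xi>\<close> to vanish.\<close>
  obtain \<xi> :: "surface_gen \<Rightarrow> rat" where \<xi>: "\<exists>x\<in>surf_gens g. \<xi> x \<noteq> 0"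
    "\<And>z. z \<in> surf_gens g' \<Longrightarrow> (\<Sum>x\<in>surf_gens g. of_int (N x z) * \<xi> x) = 0"
    using homogeneous_system[OF finite_surf_gens finite_surf_gens card, of "\<lambda>z x. of_int (N x z)"] by blast
  have "\<xi> (bar y) = 0" if y: "y \<in> surf_gens g" for y
  proof -
    have "(\<Sum>x\<in>surf_gens g. \<xi> x * of_int (\<Sum>z\<in>surf_gens g'. gen_sign z * N x z * N y (bar z))) =
        (\<Sum>z\<in>surf_gens g'. of_int (gen_sign z * N y (bar z)) * (\<Sum>x\<in>surf_gens g. of_int (N x z) * \<xi> x))"
      unfolding of_int_sum sum_distrib_left by (subst sum.swap) (simp add: mult_ac)
    also have "\<dots> = 0" using \<xi>(2) by simp
    also have "(\<Sum>x\<in>surf_gens g. \<xi> x * of_int (\<Sum>z\<in>surf_gens g'. gen_sign z * N x z * N y (bar z))) =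
        (\<Sum>x\<in>surf_gens g. if x = bar y then \<xi> x * of_int (gen_sign x) else 0)"
      by (rule sum.cong) (auto simp: form)
    finally have "\<xi> (bar y) * of_int (gen_sign (bar y)) = 0" using y by simp
    moreover have "gen_sign (bar y) \<noteq> 0" by (cases y) auto
    ultimately show ?thesis by simp
  qed
  then show False using \<xi>(1) by (metis bar_bar bar_in_surf_gens)
qed

section \<open>Test functions for the kinds of marker exponents\<close>

definition exp_letter :: "nat \<Rightarrow> nat \<Rightarrow> nat \<Rightarrow> surface_word" where
  "exp_letter g k m = (if \<exists>s\<in>surf_gens g. m = marker_exp s k
     then letter (THE s. s \<in> surf_gens g \<and> m = marker_exp s k) else [])"

definition marker_test :: "nat \<Rightarrow> nat \<Rightarrow> int \<Rightarrow> surface_word" where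
  "marker_test g k n = (if 0 \<le> n then exp_letter g k (nat n) else winv (exp_letter g k (nat (- n))))"

lemma exp_letter:
  "s \<in> surf_gens g \<Longrightarrow> exp_letter g k (marker_exp s k) = letter s"
  "\<not> (\<exists>s\<in>surf_gens g. m = marker_exp s k) \<Longrightarrow> exp_letter g k m = []"
proof -
  assume s: "s \<in> surf_gens g"
  then have "(THE t. t \<in> surf_gens g \<and> marker_exp s k = marker_exp t k) = s"
    by (intro the_equality) (auto simp: marker_exp_inject)
  then show "exp_letter g k (marker_exp s k) = letter s" using s by (auto simp: exp_letter_def)
next
  assume "\<not> (\<exists>s\<in>surf_gens g. m = marker_exp s k)"
  then show "exp_letter g k m = []" by (simp add: exp_letter_def)
qed

lemma exp_letter_closed: "exp_letter g k m \<in> carrier (surf_group g)"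
proof (cases "\<exists>s\<in>surf_gens g. m = marker_exp s k")
  case True
  then obtain s where "s \<in> surf_gens g" "m = marker_exp s k" by blast
  then show ?thesis using exp_letter(1)[of s g k] surf_letter[of s g] by simp
next
  case False
  then show ?thesis using exp_letter(2)[OF False] by (simp add: surf_group_eq)
qed

lemma marker_test_odd: "odd_map (surf_group g) (marker_test g k)"
proof -
  have inv: "inv\<^bsub>surf_group g\<^esub> w = winv w" if "w \<in> carrier (surf_group g)" for w
    using that inv_free_group[of w "surf_gens g"] by (simp add: surf_group_eq)
  have winv: "winv w \<in> carrier (surf_group g)" if "w \<in> carrier (surf_group g)" for w
    using that by (simp add: surf_group_eq)
  have zero: "exp_letter g k 0 = []" using exp_letter(2)[of g 0 k] marker_exp_pos(1) by (metis less_irrefl)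
  have cl: "marker_test g k n \<in> carrier (surf_group g)" for n
    using exp_letter_closed winv by (simp add: marker_test_def)
  have neg: "marker_test g k (- n) = winv (marker_test g k n)" for n
    by (cases "n = 0") (auto simp: marker_test_def zero)
  show ?thesis
    unfolding odd_map_def
  proof (intro conjI allI)
    show "marker_test g k 0 = \<one>\<^bsub>surf_group g\<^esub>" by (simp add: marker_test_def zero surf_group_eq)
    show "marker_test g k (- n) = inv\<^bsub>surf_group g\<^esub> marker_test g k n" for n
      unfolding inv[OF cl] by (rule neg)
  qed (rule cl)
qed

lemma marker_test_exp:
  assumes "s \<in> surf_gens g"
  shows "marker_test g k (int (marker_exp s j)) = (if j = k then letter s else [])"
  using exp_letter(1)[OF assms, of k] exp_letter(2)[of g "marker_exp s j" k]
  by (auto simp: marker_test_def marker_exp_inject)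

lemma marker_test_support:
  "marker_test g k n \<noteq> [] \<Longrightarrow> \<exists>s\<in>surf_gens g. nat \<bar>n\<bar> = marker_exp s k"
  using exp_letter(2)[of g "nat n" k] exp_letter(2)[of g "nat (- n)" k]
  by (auto simp: marker_test_def split: if_splits)

text \<open>Pigeonhole: an exponent is, up to sign, a marker exponent of at most one kind, so
  \<open>M\<close> exponents cannot spoil all \<open>M + 1\<close> kinds.\<close>

lemma ex_trivial_marker_test:
  assumes "finite D" "card D \<le> M"
  shows "\<exists>k\<le>M. \<forall>n\<in>D. marker_test g k n = []"
proof (rule ccontr)
  assume "\<not> ?thesis"
  then have "\<forall>k\<in>{..M}. \<exists>n. n \<in> D \<and> marker_test g k n \<noteq> []" by auto
  from bchoice[OF this] obtain \<phi> where "\<forall>k\<in>{..M}. \<phi> k \<in> D \<and> marker_test g k (\<phi> k) \<noteq> []" ..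
  then have \<phi>: "\<phi> k \<in> D" "marker_test g k (\<phi> k) \<noteq> []" if "k \<in> {..M}" for k
    using that by blast+
  have "inj_on \<phi> {..M}"
  proof (rule inj_onI)
    fix j k assume jk: "j \<in> {..M}" "k \<in> {..M}" "\<phi> j = \<phi> k"
    obtain s t where "nat \<bar>\<phi> j\<bar> = marker_exp s j" "nat \<bar>\<phi> k\<bar> = marker_exp t k"
      using marker_test_support[OF \<phi>(2)[OF jk(1)]] marker_test_support[OF \<phi>(2)[OF jk(2)]] by blast
    then have "marker_exp s j = marker_exp t k" using jk(3) by simp
    then show "j = k" by (simp only: marker_exp_inject)
  qed
  moreover have "\<phi> ` {..M} \<subseteq> D" using \<phi>(1) by blast
  ultimately have "card {..M} \<le> card D" using assms(1) by (rule card_inj_on_le)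
  then show False using assms(2) by simp
qed

definition base_boundary :: "nat \<Rightarrow> surface_word" where
  "base_boundary g = subst_word base_gens (boundary g)"

text \<open>Bounds the number of exponents at which the test function has to be trivial: three for
  each letter of the two words compared, and two end syllables for each of the \<open>2 g\<close>
  markers. The smaller genus is not known in advance, hence the sum over all
  \<open>g' < g\<close>.\<close>

definition marker_count :: "nat \<Rightarrow> nat" where
  "marker_count g = 3 * length (base_boundary g) + 3 * (\<Sum>g'<g. length (boundary g')) + 4 * g"

lemma base_boundary_closed: "base_boundary g \<in> carrier (surf_group g)"
  unfolding base_boundary_def by (rule hom_in_carrier[OF gens_homs(1) boundary_in_surf_group])

text \<open>
  If the embedded word had smaller genus, then the syllable map that only sees the \<open>k\<close>th marker
  exponents would, for a suitable \<open>k\<close>, carry a representation of it to one of the original word.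
\<close>

lemma genus_of_marked_boundary:
  assumes ab: "a \<in> S" "b \<in> S" "a \<noteq> b"
    and h: "h \<in> hom (surf_group g') (free_group S)"
    and hb: "h (boundary g') = subst_word (marker a b (marker_count g)) (base_boundary g)"
  shows "g \<le> g'"
proof (rule ccontr)
  assume "\<not> g \<le> g'"
  then have g': "g' < g" by simp
  let ?T = "surf_group g" and ?F = "free_group S" and ?M = "marker_count g"
  let ?m = "marker a b ?M" and ?X = "base_boundary g"
  interpret T: group ?T by (rule group_surf_group)
  have m: "?m \<in> surf_gens g \<rightarrow> carrier ?F" using marker_closed[OF ab] by blast
  have X: "fst ` set ?X \<subseteq> surf_gens g" "reduced ?X" using base_boundary_closed[of g] by (simp_all add: surf_group_eq)
  have B: "boundary g' \<in> carrier (free_group (surf_gens g'))"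
    using boundary_in_surf_group[of g'] by (simp add: surf_group_eq del: free_group_simps)
  then have B': "fst ` set (boundary g') \<subseteq> surf_gens g'" by simp
  have h': "h \<in> hom (free_group (surf_gens g')) ?F" using h by (simp only: surf_group_eq)
  have e: "(\<lambda>x. h (letter x)) \<in> surf_gens g' \<rightarrow> carrier ?F"
    using hom_in_carrier[OF h' letter_in_free_group] by blast
  obtain D1 where D1: "finite D1" "card D1 \<le> 3 * length (boundary g')"
    "\<And>\<chi>. odd_map ?T \<chi> \<Longrightarrow> \<forall>n\<in>D1. \<chi> n = \<one>\<^bsub>?T\<^esub> \<Longrightarrow>
      syllable_map ?T \<chi> a (word_eval ?F (\<lambda>x. h (letter x)) (boundary g')) =
      word_eval ?T (\<lambda>x. syllable_map ?T \<chi> a (h (letter x))) (boundary g')"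
    using T.syllable_map_word_eval[OF e B', of a] by blast
  obtain D2 where D2: "finite D2" "card D2 \<le> 3 * length ?X"
    "\<And>\<chi>. odd_map ?T \<chi> \<Longrightarrow> \<forall>n\<in>D2. \<chi> n = \<one>\<^bsub>?T\<^esub> \<Longrightarrow>
      syllable_map ?T \<chi> a (word_eval ?F ?m ?X) = word_eval ?T (\<lambda>x. syllable_map ?T \<chi> a (?m x)) ?X"
    using T.syllable_map_word_eval[OF m X(1), of a] by blast
  let ?D3 = "(\<lambda>s. - int (gen_code s)) ` surf_gens g" and ?D4 = "(\<lambda>s. - marker_height ?M s) ` surf_gens g"
  let ?D = "D1 \<union> D2 \<union> ?D3 \<union> ?D4"
  have "card ?D \<le> card D1 + card D2 + card ?D3 + card ?D4"
    using card_Un_le[of "D1 \<union> D2 \<union> ?D3" ?D4] card_Un_le[of "D1 \<union> D2" ?D3] card_Un_le[of D1 D2] by linarith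
  moreover have "card ?D3 \<le> 2 * g" "card ?D4 \<le> 2 * g"
    using card_image_le[OF finite_surf_gens[of g]] by (metis card_surf_gens)+
  moreover have "length (boundary g') \<le> (\<Sum>g'<g. length (boundary g'))"
    using g' by (intro member_le_sum) auto
  ultimately have "card ?D \<le> ?M" using D1(2) D2(2) unfolding marker_count_def by linarith
  moreover have "finite ?D" using D1(1) D2(1) by simp
  ultimately obtain k where k: "k \<le> ?M" "\<forall>n\<in>?D. marker_test g k n = []"
    using ex_trivial_marker_test[of ?D ?M g] by blast
  let ?\<theta> = "syllable_map ?T (marker_test g k) a"
  note odd = marker_test_odd[of g k]
  have one: "\<one>\<^bsub>?T\<^esub> = []" by (simp add: surf_group_eq)
  have \<theta>m: "?\<theta> (?m s) = letter s" if s: "s \<in> surf_gens g" for s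
    by (rule T.syllable_map_marker[OF odd ab(3) k(1)]) (use k(2) s marker_test_exp[OF s] one in auto)
  have "word_eval ?T (\<lambda>x. ?\<theta> (h (letter x))) (boundary g') = ?\<theta> (h (boundary g'))"
    using D1(3)[OF odd] k(2) free_group_hom_eq[OF group_free_group h' B] one by simp
  also have "\<dots> = ?\<theta> (word_eval ?F ?m ?X)"
    using hb word_eval_free_group[OF m X(1)] by simp
  also have "\<dots> = word_eval ?T (\<lambda>x. ?\<theta> (?m x)) ?X" using D2(3)[OF odd] k(2) one by simp
  also have "\<dots> = word_eval ?T letter ?X" by (rule word_eval_cong) (use \<theta>m X(1) in auto)
  also have "\<dots> = ?X" using word_eval_letters[OF X] by (simp add: surf_group_eq)
  finally have eq: "word_eval ?T (\<lambda>x. ?\<theta> (h (letter x))) (boundary g') = ?X" .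
  \<comment> \<open>\<open>?\<theta>\<close> need not be a homomorphism. The values on a free basis
    may be prescribed arbitrarily, so only the equation for the boundary word matters.\<close>
  have "word_eval ?T (\<lambda>x. ?\<theta> (h (letter x))) \<in> hom (surf_group g') ?T"
    unfolding surf_group_eq[of g'] by (rule word_eval_hom[OF T.is_group]) (simp add: T.syllable_map_closed[OF odd])
  from genus_of_base_boundary[OF this eq[unfolded base_boundary_def]] show False using g' by simp
qed


section \<open>The lower bound\<close>

lemma iso_primitive:
  assumes "group G" "group H" "f \<in> iso G H" "primitive_subgroup R G"
  shows "primitive_subgroup (f ` R) H"
proof -
  interpret f: group_hom G H f
    using assms by (simp add: group_hom_def group_hom_axioms_def iso_imp_homomorphism)
  have bij: "bij_betw f (carrier G) (carrier H)" using assms(3) by (simp add: iso_def)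
  have sub: "subgroup R G" using assms(4) by (simp add: primitive_subgroup_def)
  show ?thesis
    unfolding primitive_subgroup_def
  proof (intro conjI ballI allI impI)
    show "subgroup (f ` R) H" by (rule f.subgroup_img_is_subgroup[OF sub])
    fix t and n :: nat
    assume t: "t \<in> carrier H" "1 \<le> n" "t [^]\<^bsub>H\<^esub> n \<in> f ` R"
    then obtain r u where ru: "r \<in> R" "t [^]\<^bsub>H\<^esub> n = f r" "u \<in> carrier G" "t = f u"
      using bij by (metis bij_betw_imp_surj_on imageE)
    then have "f (u [^]\<^bsub>G\<^esub> n) = f r" by (simp add: f.hom_nat_pow)
    moreover have "r \<in> carrier G" using ru(1) subgroup.subset[OF sub] by blast
    ultimately have "u [^]\<^bsub>G\<^esub> n = r"
      using inj_onD[OF bij_betw_imp_inj_on[OF bij]] f.G.nat_pow_closed[OF ru(3)] by blast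
    then have "u \<in> R" using assms(4) ru(1,3) t(2) unfolding primitive_subgroup_def by blast
    then show "t \<in> f ` R" using ru(4) by blast
  qed
qed

lemma (in group) genus_rep_in_derived:
  assumes h: "h \<in> hom (surf_group g) G"
  shows "h (boundary g) \<in> derived G (carrier G)"
proof -
  have d: "commutator G (h (letter (GenA i))) (h (letter (GenB i))) \<in> derived_set G (carrier G)" if "i \<in> {1..g}" for i
    using hom_in_carrier[OF h letter_in_surf_group[OF that, THEN conjunct1]]
      hom_in_carrier[OF h letter_in_surf_group[OF that, THEN conjunct2]]
    unfolding commutator_def by blast
  have c: "commutator G (h (letter (GenA i))) (h (letter (GenB i))) \<in> derived G (carrier G)" if "i \<in> {1..g}" for i
    unfolding derived_def by (rule generate.incl) (rule d[OF that])
  interpret D: subgroup "derived G (carrier G)" G by (rule derived_is_subgroup) simp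
  have "foldr (\<lambda>i w. commutator G (h (letter (GenA i))) (h (letter (GenB i))) \<otimes> w) ks \<one> \<in> derived G (carrier G)"
    if "set ks \<subseteq> {1..g}" for ks
    using that by (induction ks) (use c in auto)
  from this[of "[1..<g + 1]"] show ?thesis
    unfolding hom_boundary[OF is_group h] by (simp add: atLeastLessThanSuc_atLeastAtMost del: upt_Suc)
qed

lemma free_group_comm:
  assumes "\<And>x y. x \<in> S \<Longrightarrow> y \<in> S \<Longrightarrow> x = y"
    and "u \<in> carrier (free_group S)" "v \<in> carrier (free_group S)"
  shows "foldr red_cons u v = foldr red_cons v u"
proof -
  have swap: "red_cons l (red_cons m w) = red_cons m (red_cons l w)"
    if "fst l \<in> S" "fst m \<in> S" "fst ` set w \<subseteq> S" "reduced w" for l m and w :: "'a word"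
  proof -
    have lm: "fst l = fst m" using assms(1) that by blast
    show ?thesis
    proof (cases "snd l = snd m")
      case True
      then have "l = m" using lm by (rule prod_eqI[rotated])
      then show ?thesis by simp
    next
      case False
      then show ?thesis using red_cons_cancel[OF that(4), of l m] red_cons_cancel[OF that(4), of m l] lm by simp
    qed
  qed
  have one: "red_cons l (foldr red_cons w x) = foldr red_cons w (red_cons l x)"
    if "fst l \<in> S" "fst ` set w \<subseteq> S" "fst ` set x \<subseteq> S" "reduced x" for l and w x :: "'a word"
    using that(2)
  proof (induction w)
    case (Cons m w)
    then show ?case
      using swap[OF that(1), of m "foldr red_cons w x"] letters_foldr[of w S x] that(3,4)
      by (simp add: reduced_foldr)
  qed simp
  have "foldr red_cons u (foldr red_cons v []) = foldr red_cons v (foldr red_cons u [])"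
    if "fst ` set u \<subseteq> S" "fst ` set v \<subseteq> S"
    using that(1)
  proof (induction u)
    case (Cons l u)
    then show ?case
      using one[of l v "foldr red_cons u []"] that(2) letters_foldr[of u S "[]"] by (simp add: reduced_foldr)
  qed simp
  then show ?thesis using assms(2,3) by (simp add: foldr_reduced_Nil)
qed

lemma nonabelian_two_gens:
  assumes F: "group F" "\<not> comm_group F" and \<psi>: "\<psi> \<in> iso (free_group S) F"
  shows "\<exists>a\<in>S. \<exists>b\<in>S. a \<noteq> b"
proof (rule ccontr)
  assume one: "\<not> ?thesis"
  interpret F: group F by fact
  have bij: "\<psi> ` carrier (free_group S) = carrier F"
    using \<psi> by (simp add: iso_def bij_betw_def del: free_group_simps)
  have hom: "\<psi> \<in> hom (free_group S) F" using \<psi> by (rule iso_imp_homomorphism)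
  have "x \<otimes>\<^bsub>F\<^esub> y = y \<otimes>\<^bsub>F\<^esub> x" if "x \<in> carrier F" "y \<in> carrier F" for x y
  proof -
    from that bij obtain u v where uv: "u \<in> carrier (free_group S)" "v \<in> carrier (free_group S)" "x = \<psi> u" "y = \<psi> v"
      by (metis imageE)
    then show ?thesis
      using hom_mult[OF hom uv(1,2)] hom_mult[OF hom uv(2,1)] free_group_comm[of S u v] one by simp
  qed
  then have "comm_group F" by (rule F.group_comm_groupI)
  then show False using F(2) by contradiction
qed

lemma enat_two_power: "(2 :: enat) ^ n = enat (2 ^ n)"
  by (induction n) (simp_all add: one_enat_def numeral_eq_enat)

lemma two_power_le_fhat':
  assumes F: "group F" and \<psi>: "\<psi> \<in> iso (free_group S) F" and ab: "a \<in> S" "b \<in> S" "a \<noteq> b"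
  shows "2 ^ g \<le> fhat' F g"
proof -
  let ?T = "surf_group g" and ?S = "free_group S"
  interpret F: group F by fact
  interpret S: group ?S by (rule group_free_group)
  define \<iota> where "\<iota> = subst_word (marker a b (marker_count g))"
  have \<iota>: "\<iota> \<in> hom ?T ?S" unfolding \<iota>_def by (rule marker_hom[OF ab])
  have \<psi>_hom: "\<psi> \<in> hom ?S F" using \<psi> by (rule iso_imp_homomorphism)
  have \<psi>_bij: "bij_betw \<psi> (carrier ?S) (carrier F)" using \<psi> by (simp add: iso_def del: free_group_simps)
  let ?e = "\<lambda>w. \<psi> (\<iota> w)"
  have e: "?e \<in> hom ?T F" by (rule comp_hom[OF \<iota> \<psi>_hom])
  have e_inj: "inj_on ?e (carrier ?T)"
  proof (rule inj_onI)
    fix u v assume uv: "u \<in> carrier ?T" "v \<in> carrier ?T" "?e u = ?e v"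
    then have "\<iota> u = \<iota> v"
      using inj_onD[OF bij_betw_imp_inj_on[OF \<psi>_bij]] hom_in_carrier[OF \<iota>] by blast
    then show "u = v" using inj_onD[OF marker_inj[OF ab, of "marker_count g" g]] uv(1,2) by (simp add: \<iota>_def)
  qed
  define x where "x = ?e (base_boundary g)"
  \<comment> \<open>Restricting to the carrier makes the maps extensional, as membership in
    \<open>genus_reps\<close> demands.\<close>
  define h where "h \<epsilon> = restrict (\<lambda>w. ?e (twisted_rep \<epsilon> w)) (carrier ?T)" for \<epsilon>
  have h_rep: "h \<epsilon> \<in> genus_reps F g x" for \<epsilon>
  proof -
    have hom: "(\<lambda>w. ?e (twisted_rep \<epsilon> w)) \<in> hom ?T F" by (rule comp_hom[OF twisted_rep_hom e])
    then have "h \<epsilon> \<in> hom ?T F"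
      using group.is_monoid[OF group_surf_group, THEN monoid.m_closed, of _ g]
      by (simp add: h_def hom_def Pi_iff)
    then show ?thesis
      using boundary_in_surf_group[of g] twisted_rep_boundary[of \<epsilon> g]
      by (simp add: genus_reps_def h_def x_def base_boundary_def)
  qed
  have h_image: "h \<epsilon> ` carrier ?T = ?e ` (twisted_rep \<epsilon> ` carrier ?T)" for \<epsilon>
    by (simp add: h_def image_image)
  have sub: "twisted_rep \<epsilon> ` carrier ?T \<subseteq> carrier ?T" for \<epsilon>
    using hom_in_carrier[OF twisted_rep_hom] by blast
  have h_adm: "admissible F g (h \<epsilon>)" for \<epsilon>
  proof -
    have "inj_on (\<lambda>w. ?e (twisted_rep \<epsilon> w)) (carrier ?T)"
      using comp_inj_on[OF twisted_rep_inj inj_on_subset[OF e_inj sub], of \<epsilon>] by (simp add: o_def)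
    moreover have "primitive_subgroup (\<psi> ` \<iota> ` (twisted_rep \<epsilon> ` carrier ?T)) F"
      unfolding \<iota>_def
      by (rule iso_primitive[OF S.is_group F \<psi> marker_primitive[OF ab twisted_rep_primitive]])
    ultimately show ?thesis
      unfolding admissible_def h_image by (simp add: h_def inj_on_def image_image)
  qed
  have genus: "a_genus F x = g"
    unfolding a_genus_def
  proof (rule Least_equality)
    show "genus_reps F g x \<noteq> {}" using h_rep by blast
    fix g' assume "genus_reps F g' x \<noteq> {}"
    then obtain k where k: "k \<in> hom (surf_group g') F" "k (boundary g') = x" by (auto simp: genus_reps_def)
    have inv: "inv_into (carrier ?S) \<psi> \<in> hom F ?S"
      using S.iso_set_sym[OF \<psi>] by (rule iso_imp_homomorphism)
    have "\<iota> (base_boundary g) \<in> carrier ?S" by (rule hom_in_carrier[OF \<iota> base_boundary_closed])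
    then have "inv_into (carrier ?S) \<psi> (k (boundary g')) = \<iota> (base_boundary g)"
      using k(2) bij_betw_imp_inj_on[OF \<psi>_bij] by (simp add: x_def inv_into_f_f del: free_group_simps)
    then show "g \<le> g'"
      using genus_of_marked_boundary[OF ab comp_hom[OF k(1) inv]] by (simp add: \<iota>_def)
  qed
  have derived: "x \<in> derived F (carrier F)"
    using F.genus_rep_in_derived[of "h {}" g] h_rep[of "{}"] by (simp add: genus_reps_def)
  let ?I = "\<lambda>\<epsilon>. h \<epsilon> ` carrier ?T"
  have "inj_on ?I (Pow {1..g})"
  proof (rule inj_onI)
    fix \<epsilon> \<epsilon>' assume *: "\<epsilon> \<in> Pow {1..g}" "\<epsilon>' \<in> Pow {1..g}" "?I \<epsilon> = ?I \<epsilon>'"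
    then have "twisted_rep \<epsilon> ` carrier ?T = twisted_rep \<epsilon>' ` carrier ?T"
      using inj_on_image_eq_iff[OF e_inj sub sub] unfolding h_image by blast
    then show "\<epsilon> = \<epsilon>'" using twisted_rep_images_distinct[of \<epsilon> g \<epsilon>'] *(1,2) by blast
  qed
  then have "2 ^ g = ecard (?I ` Pow {1..g})"
    by (simp add: ecard_def card_image card_Pow enat_two_power)
  also have "\<dots> \<le> ecard {k ` carrier ?T | k. k \<in> genus_reps F g x \<and> admissible F g k}"
    by (rule ecard_mono) (use h_rep h_adm in blast)
  also have "\<dots> = rep_num' F x"
    unfolding rep_num'_def Let_def genus ..
  also have "\<dots> \<le> fhat' F g"
    unfolding fhat'_def by (rule Sup_upper) (use derived genus in blast)
  finally show ?thesis .
qed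

theorem corollary1p13:
  fixes F :: "('a, 'b) monoid_scheme" and g N :: nat
  assumes "free_of_finite_rank F"
    and "\<not> comm_group F"
    and "g \<ge> 1"
    and "solid_bound F g N"
  shows "enat N \<ge> fhat F g \<and> fhat F g \<ge> fhat' F g \<and> fhat' F g \<ge> 2 ^ g"
proof -
  have F: "group F" using assms(1) by (simp add: free_of_finite_rank_def)
  obtain S where S: "word_eval F (\<lambda>s. s) \<in> iso (free_group S) F"
    using assms(1) by (auto simp: free_of_finite_rank_def free_basis_def)
  have cp: "commuting_powers F"
    by (rule iso_commuting_powers[OF group_free_group F S commuting_powers_free_group])
  obtain a b where ab: "a \<in> S" "b \<in> S" "a \<noteq> b"
    using nonabelian_two_gens[OF F assms(2) S] by blast
  show ?thesis
    using fhat_le_solid_bound[OF F assms(4)] fhat'_le_fhat[OF F cp] two_power_le_fhat'[OF F S ab] by simp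
qed

end
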